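(* Let $\mathcal{G}$ be a compact, connected metric graph with total length $|\mathcal{G}|$, with $|\mathcal{E}|$ edges, and with a nonempty set $\mathcal{V}_D$ of Dirichlet vertices. Fix $\alpha\in(0,1)$. Set $L:=\frac{|\mathcal{G}|}{|\mathcal{E}|}$, and let $\mathcal{F}$ be the equilateral flower graph with $|\mathcal{E}|$ petals (edges), each of length $L$ (hence $|\mathcal{F}|=|\mathcal{G}|$), with Dirichlet condition at its single vertex. Then $$T_\alpha(\mathcal{G}) \;\ge\; T_\alpha(\mathcal{F}) \;=\; |\mathcal{E}|\; 8\,L^{1+2\alpha}\,\pi^{-2(1+\alpha)}\Big(1-2^{-2(1+\alpha)}\Big)\,\zeta\big(2(1+\alpha)\big),$$ where $\zeta(s)=\sum_{n\ge1}n^{-s}$ is the Riemann zeta function.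
   Context: A compact metric graph $\mathcal{G}$ is obtained from a finite graph with vertex set $\mathcal{V}$ and edge set $\mathcal{E}$ (loops and parallel edges allowed) by identifying each edge $e$ with an interval $[0,\ell_e]$, $0<\ell_e<\infty$, and gluing endpoints according to the graph structure. Its total length is $|\mathcal{G}|=\sum_{e}\ell_e$. A nonempty set $\mathcal{V}_D\subseteq\mathcal{V}$ of Dirichlet vertices is fixed. $L^2(\mathcal{G})=\bigoplus_{e}L^2(0,\ell_e)$ with inner product $\langle\cdot,\cdot\rangle$. The Laplacian $-\Delta_{\mathcal{G}}$ acts as $-f_e''$ on each edge, with domain the edgewise $H^2$ functions that are continuous at every vertex, vanish at every $v\in\mathcal{V}_D$, and at every $v\in\mathcal{V}\setminus\mathcal{V}_D$ satisfy the Kirchhoff condition: the sum, over all edge ends incident to $v$, of the derivatives at $v$ taken in the direction pointing into $v$, is zero. It is self-adjoint with compact resolvent, with eigenvalues $0<\lambda_1\le\lambda_2\le\cdots\to\infty$ (with multiplicity) and an $L^2$-orthonormal basis of eigenfunctions $\varphi_n$. For $\alpha\in(0,1)$, $(-\Delta_{\mathcal{G}})^\alpha f=\sum_n\lambda_n^\alpha\langle f,\varphi_n\rangle\varphi_n$ on the domain $\{f\in L^2(\mathcal{G}):\sum_n\lambda_n^{2\alpha}|\langle f,\varphi_n\rangle|^2<\infty\}$. The fractional torsion function $u_\alpha$ is the unique solution of $(-\Delta_{\mathcal{G}})^\alpha u_\alpha=1$, i.e. $u_\alpha=\sum_n\lambda_n^{-\alpha}\langle 1,\varphi_n\rangle\varphi_n$,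 and the fractional torsional rigidity is $T_\alpha(\mathcal{G})=\int_{\mathcal{G}}u_\alpha\,dx=\sum_n\lambda_n^{-\alpha}|\langle1,\varphi_n\rangle|^2$. A flower graph is a metric graph with a single vertex, all of whose edges (petals) are loops at that vertex; it is equilateral if all edges have the same length. *)

theory Defs
  imports "HOL-Analysis.Analysis" "Graph_Theory.Graph_Theory"
begin

text \<open>
  The arcs of the underlying digraph are the edges; the direction of an arc \<open>e\<close> only records the
  identification of \<open>e\<close> with \<open>[0, elength e]\<close>: the tail sits at \<open>0\<close>, the head at \<open>elength e\<close>.
\<close>

record ('v, 'e) metric_graph =
  skeleton :: "('v, 'e) pre_digraph"
  elength :: "'e \<Rightarrow> real"
  dirichlet :: "'v set"

abbreviation vertices :: "('v, 'e) metric_graph \<Rightarrow> 'v set" where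
  "vertices G \<equiv> verts (skeleton G)"

abbreviation edges :: "('v, 'e) metric_graph \<Rightarrow> 'e set" where
  "edges G \<equiv> arcs (skeleton G)"

definition compact_metric_graph :: "('v, 'e) metric_graph \<Rightarrow> bool" where
  "compact_metric_graph G \<longleftrightarrow>
     fin_digraph (skeleton G) \<and> (\<forall>e\<in>edges G. 0 < elength G e) \<and> dirichlet G \<subseteq> vertices G"

text \<open>
  The theory \<open>Digraph_Component\<close> defines connectedness through the underlying undirected graph.
\<close>

definition connected_metric_graph :: "('v, 'e) metric_graph \<Rightarrow> bool" where
  "connected_metric_graph G \<longleftrightarrow> Digraph_Component.connected (skeleton G)"

definition total_length :: "('v, 'e) metric_graph \<Rightarrow> real" where
  "total_length G = (\<Sum>e\<in>edges G. elength G e)"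

definition flower :: "nat \<Rightarrow> real \<Rightarrow> (unit, nat) metric_graph" where
  "flower m L =
     \<lparr> skeleton = \<lparr> verts = {()}, arcs = {..<m}, tail = (\<lambda>_. ()), head = (\<lambda>_. ()) \<rparr>,
       elength = (\<lambda>_. L), dirichlet = {()} \<rparr>"


text \<open>
  A (real-valued) function on the graph assigns to each edge a function of which only the values on
  \<open>[0, elength e]\<close> matter.
\<close>

type_synonym 'e graph_fun = "'e \<Rightarrow> real \<Rightarrow> real"

definition square_integrable_on :: "real \<Rightarrow> (real \<Rightarrow> real) \<Rightarrow> bool" where
  "square_integrable_on l f \<longleftrightarrow>
     f \<in> borel_measurable (lebesgue_on {0..l}) \<and> integrable (lebesgue_on {0..l}) (\<lambda>x. (f x)\<^sup>2)"

definition L2 :: "('v, 'e) metric_graph \<Rightarrow> 'e graph_fun set" where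
  "L2 G = {f. \<forall>e\<in>edges G. square_integrable_on (elength G e) (f e)}"

definition graph_integral :: "('v, 'e) metric_graph \<Rightarrow> 'e graph_fun \<Rightarrow> real" where
  "graph_integral G f = (\<Sum>e\<in>edges G. integral\<^sup>L (lebesgue_on {0..elength G e}) (f e))"

definition L2_inner :: "('v, 'e) metric_graph \<Rightarrow> 'e graph_fun \<Rightarrow> 'e graph_fun \<Rightarrow> real" where
  "L2_inner G f g = graph_integral G (\<lambda>e x. f e x * g e x)"

definition L2_sums :: "('v, 'e) metric_graph \<Rightarrow> (nat \<Rightarrow> 'e graph_fun) \<Rightarrow> 'e graph_fun \<Rightarrow> bool" where
  "L2_sums G g f \<longleftrightarrow> (\<forall>n. g n \<in> L2 G) \<and> f \<in> L2 G \<and>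
     (\<lambda>N. graph_integral G (\<lambda>e x. (f e x - (\<Sum>n<N. g n e x))\<^sup>2)) \<longlonglongrightarrow> 0"


text \<open>
  \<open>f\<close> is (the continuously differentiable representative of) an element of \<open>H\<^sup>2(0, l)\<close>, with
  derivative \<open>f'\<close> up to the boundary and second weak derivative \<open>f''\<close>: the derivative is the
  indefinite integral of a square integrable function.
\<close>

definition H2_on :: "real \<Rightarrow> (real \<Rightarrow> real) \<Rightarrow> (real \<Rightarrow> real) \<Rightarrow> (real \<Rightarrow> real) \<Rightarrow> bool" where
  "H2_on l f f' f'' \<longleftrightarrow>
     (\<forall>x\<in>{0..l}. (f has_real_derivative f' x) (at x within {0..l})) \<and>
     square_integrable_on l f'' \<and>
     (\<forall>x\<in>{0..l}. f' x = f' 0 + integral\<^sup>L (lebesgue_on {0..x}) f'')"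

definition continuous_at_vertices :: "('v, 'e) metric_graph \<Rightarrow> 'e graph_fun \<Rightarrow> bool" where
  "continuous_at_vertices G u \<longleftrightarrow>
     (\<exists>w. (\<forall>e\<in>edges G. u e 0 = w (tail (skeleton G) e) \<and>
                       u e (elength G e) = w (head (skeleton G) e)) \<and>
          (\<forall>v\<in>dirichlet G. w v = 0))"

text \<open>
  In the direction pointing into the vertex, the derivative at the head end of an edge is \<open>u'\<close> and
  at the tail end it is \<open>-u'\<close>. A loop contributes both of its ends.
\<close>

definition kirchhoff :: "('v, 'e) metric_graph \<Rightarrow> 'e graph_fun \<Rightarrow> bool" where
  "kirchhoff G u' \<longleftrightarrow>
     (\<forall>v\<in>vertices G - dirichlet G.
        (\<Sum>e\<in>in_arcs (skeleton G) v. u' e (elength G e)) +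
        (\<Sum>e\<in>out_arcs (skeleton G) v. - u' e 0) = 0)"

text \<open>\<open>laplacian G u f\<close>: \<open>u\<close> lies in the domain of the operator, and the operator maps \<open>u\<close> to \<open>f\<close>.\<close>

definition laplacian :: "('v, 'e) metric_graph \<Rightarrow> 'e graph_fun \<Rightarrow> 'e graph_fun \<Rightarrow> bool" where
  "laplacian G u f \<longleftrightarrow>
     (\<exists>u'. (\<forall>e\<in>edges G. H2_on (elength G e) (u e) (u' e) (\<lambda>x. - f e x)) \<and>
           continuous_at_vertices G u \<and> kirchhoff G u')"

text \<open>Eigenvalues and eigenfunctions are numbered from \<open>0\<close>.\<close>

definition eigenbasis ::
  "('v, 'e) metric_graph \<Rightarrow> (nat \<Rightarrow> real) \<Rightarrow> (nat \<Rightarrow> 'e graph_fun) \<Rightarrow> bool" where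
  "eigenbasis G lam phi \<longleftrightarrow>
     0 < lam 0 \<and> mono lam \<and> filterlim lam at_top sequentially \<and>
     (\<forall>n. laplacian G (phi n) (\<lambda>e x. lam n * phi n e x)) \<and>
     (\<forall>m n. L2_inner G (phi m) (phi n) = (if m = n then 1 else 0)) \<and>
     (\<forall>f\<in>L2 G. L2_sums G (\<lambda>n e x. L2_inner G f (phi n) * phi n e x) f)"

text \<open>An orthonormal basis of eigenfunctions is fixed; nothing below depends on which one.\<close>

definition spectral_data :: "('v, 'e) metric_graph \<Rightarrow> (nat \<Rightarrow> real) \<times> (nat \<Rightarrow> 'e graph_fun)" where
  "spectral_data G = (SOME (lam, phi). eigenbasis G lam phi)"

definition eigenval :: "('v, 'e) metric_graph \<Rightarrow> nat \<Rightarrow> real" where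
  "eigenval G = fst (spectral_data G)"

definition eigenfun :: "('v, 'e) metric_graph \<Rightarrow> nat \<Rightarrow> 'e graph_fun" where
  "eigenfun G = snd (spectral_data G)"

definition frac_laplacian ::
  "('v, 'e) metric_graph \<Rightarrow> real \<Rightarrow> 'e graph_fun \<Rightarrow> 'e graph_fun \<Rightarrow> bool" where
  "frac_laplacian G \<alpha> u f \<longleftrightarrow>
     u \<in> L2 G \<and>
     summable (\<lambda>n. eigenval G n powr (2 * \<alpha>) * (L2_inner G u (eigenfun G n))\<^sup>2) \<and>
     L2_sums G (\<lambda>n e x. eigenval G n powr \<alpha> * L2_inner G u (eigenfun G n) * eigenfun G n e x) f"

text \<open>The solution is unique up to null sets, which do not affect its integral.\<close>

definition frac_torsion_function :: "('v, 'e) metric_graph \<Rightarrow> real \<Rightarrow> 'e graph_fun" where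
  "frac_torsion_function G \<alpha> = (SOME u. frac_laplacian G \<alpha> u (\<lambda>e x. 1))"

definition frac_torsional_rigidity :: "('v, 'e) metric_graph \<Rightarrow> real \<Rightarrow> real" where
  "frac_torsional_rigidity G \<alpha> = graph_integral G (frac_torsion_function G \<alpha>)"

text \<open>The Riemann zeta function for real arguments greater than \<open>1\<close>.\<close>

definition zeta_real :: "real \<Rightarrow> real" where
  "zeta_real s = (\<Sum>n. real (Suc n) powr (- s))"

end

theory Submission
  imports Defs "HOL-Library.Function_Algebras" "HOL-Complex_Analysis.Great_Picard"
begin

text \<open>
  Let \<open>b n = \<langle>1, phi n\<rangle>\<close>. Since \<open>lam powr - \<alpha>\<close> is a positive multiple of
  \<open>\<integral> s powr - \<alpha> / (lam + s) ds\<close> over \<open>s > 0\<close>, the rigidity \<open>\<Sum>n. b n\<^sup>2 * lam n powr - \<alpha>\<close> is monotone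
  in the function \<open>R s = \<Sum>n. b n\<^sup>2 / (lam n + s)\<close>, for which \<open>R s = \<langle>1, w\<rangle>\<close> with \<open>- w'' + s w = 1\<close>.
  Imposing a Dirichlet condition at every vertex lowers \<open>R s\<close> to the sum over the edges of a function of
  the edge length that is explicit in terms of \<open>tanh\<close> and convex. By Jensen's inequality this sum is
  least for equal lengths, where it is the \<open>R s\<close> of the flower. The rigidity of the flower is read off
  from the expansion of the constant \<open>1\<close> in sines. That an eigenbasis exists at all follows from the
  spectral theorem for the compact Green operator, constructed from a discrete Laplace equation
  for the values at the vertices.
\<close>

text \<open>The fractional power is defined through the spectrum and is nonlocal, so it gives no
  direct access to the single edges; the resolvent equation at a fixed \<open>s\<close> is a local
  differential equation. That Dirichlet conditions lower \<open>R s\<close> is a variational fact: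
  for every \<open>w\<close> in the form domain, \<open>R s\<close> bounds
  \<open>2 * L2_inner G one w - L2_inner G w' w' - s * L2_inner G w w\<close> from above, and the
  solutions on the separate edges, being zero at all vertices, are admissible trial functions
  whatever the vertex conditions of the graph.

  Two obstacles shape the rest. Elements of \<open>L2 G\<close> are functions, not classes modulo
  null functions, and their values off the edges are arbitrary; hence inner products are only
  semidefinite, and eigenvalue equations first hold modulo null vectors and are repaired afterwards.
  Moreover the eigenbasis and the torsion function are chosen by \<open>SOME\<close>: existence has
  to come first, and the basis chosen for the flower may differ from the sines, so its rigidity has
  to be computed in a way that does not depend on the basis.\<close>

instantiation "fun" :: (type, real_vector) real_vector
begin

definition scaleR_fun :: "real \<Rightarrow> ('a \<Rightarrow> 'b) \<Rightarrow> 'a \<Rightarrow> 'b" where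
  "scaleR_fun c f = (\<lambda>x. c *\<^sub>R f x)"

instance
  by standard (auto simp: scaleR_fun_def fun_eq_iff scaleR_add_right scaleR_add_left)

end

lemma scaleR_fun_apply [simp]: "(c *\<^sub>R f) x = c *\<^sub>R f x"
  by (simp add: scaleR_fun_def)

lemma sum_fun_apply [simp]: "(sum f A) x = (\<Sum>i\<in>A. f i x)"
  by (induction A rule: infinite_finite_induct) auto

section \<open>Compact positive operators on semi-inner product spaces\<close>

text \<open>Definiteness is left out because null functions are not factored out of
  \<open>L2 G\<close>. The explicit carrier \<open>H\<close> allows the same facts to be used for
  subspaces and for other forms, such as the form of a positive operator.\<close>

locale semi_inner_space =
  fixes H :: "'a::real_vector set" and B :: "'a \<Rightarrow> 'a \<Rightarrow> real"
  assumes subspace: "subspace H"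
    and add_left: "\<lbrakk>x \<in> H; y \<in> H; z \<in> H\<rbrakk> \<Longrightarrow> B (x + y) z = B x z + B y z"
    and scale_left: "\<lbrakk>x \<in> H; y \<in> H\<rbrakk> \<Longrightarrow> B (c *\<^sub>R x) y = c * B x y"
    and sym: "\<lbrakk>x \<in> H; y \<in> H\<rbrakk> \<Longrightarrow> B x y = B y x"
    and nonneg: "x \<in> H \<Longrightarrow> 0 \<le> B x x"
begin

lemma add_mem [simp, intro]: "\<lbrakk>x \<in> H; y \<in> H\<rbrakk> \<Longrightarrow> x + y \<in> H"
  and diff_mem [simp, intro]: "\<lbrakk>x \<in> H; y \<in> H\<rbrakk> \<Longrightarrow> x - y \<in> H"
  and scale_mem [simp, intro]: "x \<in> H \<Longrightarrow> c *\<^sub>R x \<in> H"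
  and zero_mem [simp, intro]: "0 \<in> H"
  using subspace by (auto simp: subspace_add subspace_diff subspace_scale subspace_0)

lemma sum_mem [intro]: "(\<And>i. i \<in> A \<Longrightarrow> x i \<in> H) \<Longrightarrow> sum x A \<in> H"
  using subspace by (rule subspace_sum)

lemma zero_left [simp]: "y \<in> H \<Longrightarrow> B 0 y = 0"
  using scale_left[of 0 y 0] by simp

lemma diff_left: "\<lbrakk>x \<in> H; y \<in> H; z \<in> H\<rbrakk> \<Longrightarrow> B (x - y) z = B x z - B y z"
  using add_left[of "x - y" y z] by simp

lemma add_right: "\<lbrakk>x \<in> H; y \<in> H; z \<in> H\<rbrakk> \<Longrightarrow> B z (x + y) = B z x + B z y"
  using add_left[of x y z] sym by simp

lemma diff_right: "\<lbrakk>x \<in> H; y \<in> H; z \<in> H\<rbrakk> \<Longrightarrow> B z (x - y) = B z x - B z y"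
  using diff_left[of x y z] sym by simp

lemma scale_right: "\<lbrakk>x \<in> H; y \<in> H\<rbrakk> \<Longrightarrow> B y (c *\<^sub>R x) = c * B y x"
  using scale_left[of x y c] sym by simp

lemma sum_left:
  "\<lbrakk>\<And>i. i \<in> A \<Longrightarrow> x i \<in> H; y \<in> H\<rbrakk> \<Longrightarrow> B (sum x A) y = (\<Sum>i\<in>A. B (x i) y)"
  by (induction A rule: infinite_finite_induct) (auto simp: add_left sum_mem)

lemma sum_right:
  "\<lbrakk>\<And>i. i \<in> A \<Longrightarrow> x i \<in> H; y \<in> H\<rbrakk> \<Longrightarrow> B y (sum x A) = (\<Sum>i\<in>A. B y (x i))"
  by (induction A rule: infinite_finite_induct) (auto simp: add_right sum_mem sym[of _ 0])

lemmas bilinear = add_left diff_left scale_left add_right diff_right scale_right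

lemma Cauchy_Schwarz:
  assumes "x \<in> H" "y \<in> H"
  shows "(B x y)\<^sup>2 \<le> B x x * B y y"
proof -
  have q: "0 \<le> B x x - 2 * t * B x y + t\<^sup>2 * B y y" for t
    using nonneg[of "x - t *\<^sub>R y"] assms
    by (simp add: bilinear sym[of y x] power2_eq_square algebra_simps)
  show ?thesis
  proof (cases "B y y = 0")
    case True
    have "B x y = 0"
    proof (rule ccontr)
      assume "B x y \<noteq> 0"
      \<comment> \<open>With \<open>B y y = 0\<close> the quadratic is affine in \<open>t\<close>,
        and this \<open>t\<close> gives it the value \<open>-1\<close>.\<close>
      then show False
        using q[of "(B x x + 1) / (2 * B x y)"] True by simp
    qed
    then show ?thesis using True by simp
  next
    case False
    then have "B y y > 0" using nonneg[OF assms(2)] by simp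
    then show ?thesis
      using q[of "B x y / B y y"] by (simp add: field_simps power2_eq_square)
  qed
qed

lemma add_self_le:
  assumes "x \<in> H" "y \<in> H"
  shows "B (x + y) (x + y) \<le> 2 * B x x + 2 * B y y"
proof -
  have "0 \<le> B (x - y) (x - y)" using assms nonneg by simp
  then show ?thesis using assms by (simp add: bilinear sym[of y x])
qed

lemma null_left: "\<lbrakk>x \<in> H; y \<in> H; B x x = 0\<rbrakk> \<Longrightarrow> B x y = 0"
  using Cauchy_Schwarz[of x y] by simp

section \<open>Seminorm convergence and orthonormal systems\<close>

definition converges_to :: "(nat \<Rightarrow> 'a) \<Rightarrow> 'a \<Rightarrow> bool" where
  "converges_to X x \<longleftrightarrow> (\<lambda>n. B (X n - x) (X n - x)) \<longlonglongrightarrow> 0"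

lemma converges_to_subseq:
  "converges_to X x \<Longrightarrow> strict_mono r \<Longrightarrow> converges_to (\<lambda>n. X (r n)) x"
  unfolding converges_to_def by (rule LIMSEQ_subseq_LIMSEQ[of _ 0 r, unfolded o_def])

lemma converges_to_bound:
  assumes "\<And>n. X n \<in> H" "x \<in> H" "\<And>n. B (X n - x) (X n - x) \<le> c n" "c \<longlonglongrightarrow> 0"
  shows "converges_to X x"
  unfolding converges_to_def
  by (rule tendsto_sandwich[OF _ _ tendsto_const assms(4)]) (auto simp: assms nonneg)

lemma converges_to_inner:
  assumes "\<And>n. X n \<in> H" "x \<in> H" "y \<in> H" "converges_to X x"
  shows "(\<lambda>n. B (X n) y) \<longlonglongrightarrow> B x y"
proof -
  have "(\<lambda>n. sqrt (B (X n - x) (X n - x)) * sqrt (B y y)) \<longlonglongrightarrow> sqrt 0 * sqrt (B y y)"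
    using assms(4) unfolding converges_to_def by (intro tendsto_intros)
  then have 1: "(\<lambda>n. sqrt (B (X n - x) (X n - x)) * sqrt (B y y)) \<longlonglongrightarrow> 0" by simp
  have "\<bar>B (X n) y - B x y\<bar> \<le> sqrt (B (X n - x) (X n - x)) * sqrt (B y y)" for n
    using Cauchy_Schwarz[of "X n - x" y] assms
    by (metis diff_left diff_mem real_sqrt_le_mono real_sqrt_abs real_sqrt_mult)
  then have "(\<lambda>n. B (X n) y - B x y) \<longlonglongrightarrow> 0"
    by (intro Lim_null_comparison[OF _ 1]) auto
  then show ?thesis by (simp add: LIM_zero_iff)
qed

lemma converges_to_norm:
  assumes "\<And>n. X n \<in> H" "x \<in> H" "converges_to X x"
  shows "(\<lambda>n. B (X n) (X n)) \<longlonglongrightarrow> B x x"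
proof -
  have "(\<lambda>n. B (X n - x) (X n - x) + 2 * B (X n) x - B x x) \<longlonglongrightarrow> 0 + 2 * B x x - B x x"
    using assms converges_to_inner[OF assms(1,2,2,3)] unfolding converges_to_def
    by (intro tendsto_intros)
  moreover have "B (X n - x) (X n - x) + 2 * B (X n) x - B x x = B (X n) (X n)" for n
    using assms sym[OF assms(1,2), of n] by (simp add: bilinear)
  ultimately show ?thesis by simp
qed

lemma converges_to_add:
  assumes "\<And>n. X n \<in> H" "x \<in> H" "\<And>n. Y n \<in> H" "y \<in> H" "converges_to X x" "converges_to Y y"
  shows "converges_to (\<lambda>n. X n + Y n) (x + y)"
proof (rule converges_to_bound)
  show "B (X n + Y n - (x + y)) (X n + Y n - (x + y))
      \<le> 2 * B (X n - x) (X n - x) + 2 * B (Y n - y) (Y n - y)" for n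
    using add_self_le[of "X n - x" "Y n - y"] assms by (simp add: algebra_simps)
  show "(\<lambda>n. 2 * B (X n - x) (X n - x) + 2 * B (Y n - y) (Y n - y)) \<longlonglongrightarrow> 0"
    using assms(5,6) unfolding converges_to_def
    by (auto intro!: tendsto_eq_intros)
qed (use assms in auto)

text \<open>The exact norm of the residual is kept next to the inequality: it allows convergence of
  an expansion to be read off from a numerical series, as is done for the constant 1 on the
  flower.\<close>

lemma Bessel:
  assumes phi: "\<And>n. \<phi> n \<in> H" and on: "\<And>m n. B (\<phi> m) (\<phi> n) = (if m = n then 1 else 0)"
    and x: "x \<in> H" and fin: "finite A"
  shows "B (x - (\<Sum>n\<in>A. B x (\<phi> n) *\<^sub>R \<phi> n)) (x - (\<Sum>n\<in>A. B x (\<phi> n) *\<^sub>R \<phi> n))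
           = B x x - (\<Sum>n\<in>A. (B x (\<phi> n))\<^sup>2)"
    and "(\<Sum>n\<in>A. (B x (\<phi> n))\<^sup>2) \<le> B x x"
proof -
  let ?s = "\<Sum>n\<in>A. B x (\<phi> n) *\<^sub>R \<phi> n"
  have s: "?s \<in> H" using phi by auto
  have 1: "B x ?s = (\<Sum>n\<in>A. (B x (\<phi> n))\<^sup>2)"
    using phi x by (simp add: sum_right scale_right power2_eq_square)
  have "B (\<phi> n) ?s = (if n \<in> A then B x (\<phi> n) else 0)" for n
    using phi x fin by (simp add: sum_right scale_right on if_distrib cong: if_cong)
  then have 2: "B ?s ?s = (\<Sum>n\<in>A. (B x (\<phi> n))\<^sup>2)"
    using phi x s by (subst sum_left) (auto simp: scale_left power2_eq_square)
  show e: "B (x - ?s) (x - ?s) = B x x - (\<Sum>n\<in>A. (B x (\<phi> n))\<^sup>2)"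
    using 1 2 x s sym[of ?s x] by (simp add: bilinear)
  show "(\<Sum>n\<in>A. (B x (\<phi> n))\<^sup>2) \<le> B x x"
    using e nonneg[of "x - ?s"] x s by simp
qed

end

locale complete_semi_inner_space = semi_inner_space +
  assumes complete: "\<lbrakk>\<And>n. X n \<in> H; \<And>e. 0 < e \<Longrightarrow> \<exists>N. \<forall>m\<ge>N. \<forall>n\<ge>N. B (X m - X n) (X m - X n) < e\<rbrakk>
      \<Longrightarrow> \<exists>x\<in>H. converges_to X x"
begin

lemma orthonormal_series:
  assumes phi: "\<And>n. \<phi> n \<in> H" and on: "\<And>m n. B (\<phi> m) (\<phi> n) = (if m = n then 1 else 0)"
    and c: "summable (\<lambda>n. (c n)\<^sup>2)"
  obtains x where "x \<in> H" "converges_to (\<lambda>N. \<Sum>n<N. c n *\<^sub>R \<phi> n) x" "\<And>n. B x (\<phi> n) = c n"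
proof -
  let ?s = "\<lambda>N. \<Sum>n<N. c n *\<^sub>R \<phi> n"
  have s: "?s N \<in> H" for N using phi by auto
  have coeff: "B (\<Sum>n\<in>A. c n *\<^sub>R \<phi> n) (\<phi> k) = (if k \<in> A then c k else 0)" if "finite A" for A k
    using phi that by (subst sum_left) (auto simp: scale_left on if_distrib cong: if_cong)
  have nrm: "B (\<Sum>n\<in>A. c n *\<^sub>R \<phi> n) (\<Sum>n\<in>A. c n *\<^sub>R \<phi> n) = (\<Sum>n\<in>A. (c n)\<^sup>2)" if "finite A" for A
    using phi that coeff[OF that]
    by (subst sum_right) (auto simp: scale_right sum_mem power2_eq_square)
  have diff: "B (?s m - ?s n) (?s m - ?s n) = (\<Sum>k\<in>{n..<m}. (c k)\<^sup>2)" if "n \<le> m" for m n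
  proof -
    have "?s m - ?s n = (\<Sum>k\<in>{n..<m}. c k *\<^sub>R \<phi> k)"
      using sum_diff_nat_ivl[of 0 n m "\<lambda>k. c k *\<^sub>R \<phi> k"] that by (simp add: atLeast0LessThan)
    then show ?thesis using nrm by simp
  qed
  have "\<exists>x\<in>H. converges_to ?s x"
  proof (rule complete)
    fix e :: real assume "0 < e"
    then obtain N where N: "\<And>m n. m \<ge> N \<Longrightarrow> norm (\<Sum>k\<in>{m..<n}. (c k)\<^sup>2) < e"
      using c unfolding summable_Cauchy by meson
    have "B (?s m - ?s n) (?s m - ?s n) < e" if "m \<ge> N" "n \<ge> N" for m n
    proof (cases "n \<le> m")
      case True
      then show ?thesis using diff[OF True] N[of n m] that by (simp add: sum_nonneg)
    next
      case False
      have "?s m - ?s n = (-1) *\<^sub>R (?s n - ?s m)" by simp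
      then have "B (?s m - ?s n) (?s m - ?s n) = B (?s n - ?s m) (?s n - ?s m)"
        using s by (simp only: scale_left scale_right diff_mem scale_mem)
      then show ?thesis using diff[of m n] N[of m n] that False by (simp add: sum_nonneg)
    qed
    then show "\<exists>N. \<forall>m\<ge>N. \<forall>n\<ge>N. B (?s m - ?s n) (?s m - ?s n) < e" by blast
  qed (use s in auto)
  then obtain x where x: "x \<in> H" "converges_to ?s x" by blast
  have "B x (\<phi> k) = c k" for k
  proof (rule LIMSEQ_unique)
    show "(\<lambda>N. B (?s N) (\<phi> k)) \<longlonglongrightarrow> B x (\<phi> k)"
      using s x phi by (intro converges_to_inner)
    show "(\<lambda>N. B (?s N) (\<phi> k)) \<longlonglongrightarrow> c k"
      by (rule tendsto_eventually, rule eventually_sequentiallyI[of "Suc k"]) (simp add: coeff)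
  qed
  with x that show ?thesis by blast
qed

end

text \<open>\<open>K_definite\<close> excludes a kernel modulo null vectors, so that eigenvectors
  with positive eigenvalues exhaust the space. \<open>infinite_dim\<close> supplies a non-null
  vector orthogonal to any finite set, so that the eigenvectors form an infinite sequence.\<close>

locale compact_positive_operator = complete_semi_inner_space H B
  for H :: "'a::real_vector set" and B +
  fixes K :: "'a \<Rightarrow> 'a" and C :: real
  assumes K_mem [simp, intro]: "x \<in> H \<Longrightarrow> K x \<in> H"
    and K_add: "\<lbrakk>x \<in> H; y \<in> H\<rbrakk> \<Longrightarrow> K (x + y) = K x + K y"
    and K_scale: "x \<in> H \<Longrightarrow> K (c *\<^sub>R x) = c *\<^sub>R K x"
    and K_sym: "\<lbrakk>x \<in> H; y \<in> H\<rbrakk> \<Longrightarrow> B (K x) y = B x (K y)"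
    and K_nonneg: "x \<in> H \<Longrightarrow> 0 \<le> B (K x) x"
    and K_definite: "\<lbrakk>x \<in> H; B (K x) x = 0\<rbrakk> \<Longrightarrow> B x x = 0"
    and K_bound: "x \<in> H \<Longrightarrow> B (K x) x \<le> C * B x x"
    and K_compact: "\<lbrakk>\<And>n. X n \<in> H; \<And>n. B (X n) (X n) \<le> 1\<rbrakk>
      \<Longrightarrow> \<exists>r x. strict_mono (r :: nat \<Rightarrow> nat) \<and> x \<in> H \<and> converges_to (\<lambda>n. K (X (r n))) x"
    and infinite_dim: "finite S \<Longrightarrow> S \<subseteq> H \<Longrightarrow> \<exists>x\<in>H. 0 < B x x \<and> (\<forall>y\<in>S. B x y = 0)"
begin

section \<open>Eigenvectors by maximising the Rayleigh quotient\<close>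

lemma K_diff: "\<lbrakk>x \<in> H; y \<in> H\<rbrakk> \<Longrightarrow> K (x - y) = K x - K y"
  using K_add[of "x - y" y] by simp

lemma K_form: "semi_inner_space H (\<lambda>x y. B (K x) y)"
proof unfold_locales
  show "B (K x) y = B (K y) x" if "x \<in> H" "y \<in> H" for x y
    using that K_sym[OF that] sym[of x "K y"] by simp
qed (use subspace in \<open>auto simp: K_add K_scale bilinear K_nonneg\<close>)

text \<open>Cauchy--Schwarz for a positive form \<open>\<langle>A x, y\<rangle>\<close> with \<open>A \<le> c\<close>, applied to \<open>x\<close> and \<open>A x\<close>.\<close>

lemma positive_operator_norm_bound:
  assumes W: "semi_inner_space W (\<lambda>x y. B (A x) y)" "W \<subseteq> H"
    and A: "\<And>x. x \<in> W \<Longrightarrow> A x \<in> W" and b: "\<And>x. x \<in> W \<Longrightarrow> B (A x) x \<le> c * B x x"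
    and x: "x \<in> W"
  shows "B (A x) (A x) \<le> c * B (A x) x"
proof -
  interpret W: semi_inner_space W "\<lambda>x y. B (A x) y" by fact
  have Ax: "A x \<in> H" using A x W(2) by auto
  have "(B (A x) (A x))\<^sup>2 \<le> B (A x) x * B (A (A x)) (A x)"
    using W.Cauchy_Schwarz[of x "A x"] x A by simp
  also have "\<dots> \<le> B (A x) x * (c * B (A x) (A x))"
    using b[of "A x"] A x W.nonneg[OF x] by (intro mult_left_mono) auto
  finally have "B (A x) (A x) * B (A x) (A x) \<le> (c * B (A x) x) * B (A x) (A x)"
    by (simp add: power2_eq_square algebra_simps)
  moreover have "0 \<le> B (A x) (A x)" using Ax nonneg by auto
  moreover have "0 \<le> c * B x x" using b[OF x] W.nonneg[OF x] by simp
  ultimately show ?thesis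
    using x W(2) null_left[OF Ax _] by (cases "B (A x) (A x) = 0") auto
qed

lemma K_norm_bound: "x \<in> H \<Longrightarrow> B (K x) (K x) \<le> C * B (K x) x"
  using positive_operator_norm_bound[OF K_form order_refl] K_bound by auto

lemma converges_to_K:
  assumes "\<And>n. X n \<in> H" "x \<in> H" "converges_to X x"
  shows "converges_to (\<lambda>n. K (X n)) (K x)"
proof (rule converges_to_bound)
  let ?d = "\<lambda>n. X n - x"
  have "B (K (?d n)) (K (?d n)) \<le> \<bar>C\<bar> * (\<bar>C\<bar> * B (?d n) (?d n))" for n
  proof -
    have d: "?d n \<in> H" using assms by auto
    have "B (K (?d n)) (K (?d n)) \<le> C * B (K (?d n)) (?d n)" using K_norm_bound[OF d] .
    also have "\<dots> \<le> \<bar>C\<bar> * B (K (?d n)) (?d n)"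
      using K_nonneg[OF d] by (intro mult_right_mono) auto
    also have "B (K (?d n)) (?d n) \<le> \<bar>C\<bar> * B (?d n) (?d n)"
      using K_bound[OF d] mult_right_mono[OF abs_ge_self[of C] nonneg[OF d]] by linarith
    finally show ?thesis by (simp add: mult_left_mono)
  qed
  then show "B (K (X n) - K x) (K (X n) - K x) \<le> \<bar>C\<bar> * (\<bar>C\<bar> * B (?d n) (?d n))" for n
    using assms by (simp add: K_diff)
  show "(\<lambda>n. \<bar>C\<bar> * (\<bar>C\<bar> * B (?d n) (?d n))) \<longlonglongrightarrow> 0"
    using assms(3) unfolding converges_to_def by (auto intro!: tendsto_eq_intros)
qed (use assms in auto)

text \<open>A maximising sequence for the Rayleigh quotient consists of approximate eigenvectors.\<close>

lemma top_eigenvector: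
  assumes W: "subspace W" "W \<subseteq> H" "\<And>x. x \<in> W \<Longrightarrow> K x \<in> W"
    and closed: "\<And>X x. \<lbrakk>\<And>n. X n \<in> W; x \<in> H; converges_to X x\<rbrakk> \<Longrightarrow> x \<in> W"
    and nontrivial: "x0 \<in> W" "0 < B x0 x0"
  obtains \<mu> p where "0 < \<mu>" "p \<in> W" "B p p = 1" "B (K p - \<mu> *\<^sub>R p) (K p - \<mu> *\<^sub>R p) = 0"
    "\<And>x. x \<in> W \<Longrightarrow> B (K x) x \<le> \<mu> * B x x"
proof -
  define S where "S = {B (K x) x |x. x \<in> W \<and> B x x \<le> 1}"
  define \<mu> where "\<mu> = Sup S"
  have WH: "x \<in> H" if "x \<in> W" for x using that W(2) by auto
  have scW: "c *\<^sub>R x \<in> W" if "x \<in> W" for c x using W(1) that by (simp add: subspace_scale)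
  have bdd: "bdd_above S"
  proof (rule bdd_aboveI[of _ "\<bar>C\<bar>"])
    fix s assume "s \<in> S"
    then obtain x where x: "x \<in> W" "B x x \<le> 1" "s = B (K x) x" by (auto simp: S_def)
    have "s \<le> C * B x x" using x WH K_bound by auto
    also have "\<dots> \<le> \<bar>C\<bar> * B x x" using nonneg[OF WH[OF x(1)]] by (intro mult_right_mono) auto
    also have "\<dots> \<le> \<bar>C\<bar> * 1" using x by (intro mult_left_mono) auto
    finally show "s \<le> \<bar>C\<bar>" by simp
  qed
  have scaled: "B (K x) x / B x x \<in> S" if "x \<in> W" "0 < B x x" for x
    unfolding S_def
    using that WH scW
    by (intro CollectI exI[of _ "(1 / sqrt (B x x)) *\<^sub>R x"])
       (simp add: K_scale bilinear field_simps)
  have le: "B (K x) x \<le> \<mu> * B x x" if "x \<in> W" for x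
  proof (cases "B x x = 0")
    case True
    then show ?thesis using K_sym[of x x] null_left[of x "K x"] WH[OF that] by simp
  next
    case False
    then have "0 < B x x" using nonneg[OF WH[OF that]] by simp
    then show ?thesis
      using cSup_upper[OF scaled[OF that] bdd] by (simp add: \<mu>_def field_simps)
  qed
  have ne: "S \<noteq> {}" using scaled[OF nontrivial] by auto
  have \<mu>_pos: "0 < \<mu>"
  proof -
    have "0 < B (K x0) x0" using K_definite[of x0] K_nonneg[of x0] nontrivial WH by force
    then show ?thesis using le[OF nontrivial(1)] nontrivial(2) by (smt (verit) mult_nonpos_nonneg)
  qed
  have "\<exists>x. x \<in> W \<and> B x x \<le> 1 \<and> \<mu> - 1 / real (Suc n) < B (K x) x" for n
    using less_cSupD[OF ne, of "\<mu> - 1 / real (Suc n)"] by (auto simp: \<mu>_def S_def)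
  then obtain X where X: "\<And>n. X n \<in> W" "\<And>n. B (X n) (X n) \<le> 1"
      "\<And>n. \<mu> - 1 / real (Suc n) < B (K (X n)) (X n)" by metis
  have XH: "X n \<in> H" for n using X WH by auto
  \<comment> \<open>\<open>\<mu> - K\<close> is nonnegative on \<open>W\<close> because
    \<open>\<mu>\<close> is the supremum, and it is at most \<open>\<mu>\<close> because
    \<open>K\<close> is nonnegative. So \<open>A x\<close> is small as soon as the Rayleigh quotient
    of \<open>x\<close> is nearly maximal.\<close>
  define A where "A = (\<lambda>x. \<mu> *\<^sub>R x - K x)"
  have A_form: "semi_inner_space W (\<lambda>x y. B (A x) y)"
  proof unfold_locales
    show "B (A x) y = B (A y) x" if "x \<in> W" "y \<in> W" for x y
      using that WH K_sym[of x y] sym[of x y] sym[of x "K y"] by (simp add: A_def bilinear)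
  qed (use W(1) le WH in \<open>auto simp: A_def K_add K_scale bilinear algebra_simps\<close>)
  have A_small: "B (A (X n)) (A (X n)) \<le> \<mu> * (1 / real (Suc n))" for n
  proof -
    have "B (A (X n)) (A (X n)) \<le> \<mu> * B (A (X n)) (X n)"
      using X K_nonneg W WH
      by (intro positive_operator_norm_bound[OF A_form W(2)])
         (auto simp: A_def bilinear subspace_diff scW)
    also have "B (A (X n)) (X n) = \<mu> * B (X n) (X n) - B (K (X n)) (X n)"
      using XH by (simp add: A_def bilinear)
    also have "\<dots> \<le> \<mu> * 1 - B (K (X n)) (X n)"
      using X(2) \<mu>_pos by (intro diff_right_mono mult_left_mono) auto
    also have "\<dots> \<le> 1 / real (Suc n)" using X(3)[of n] by simp
    finally show ?thesis using \<mu>_pos by (simp add: mult_left_mono)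
  qed
  obtain r y where r: "strict_mono r" and y: "y \<in> H" "converges_to (\<lambda>n. K (X (r n))) y"
    using K_compact[of X, OF XH X(2)] by metis
  have "converges_to (\<lambda>n. A (X n)) 0"
  proof (rule converges_to_bound)
    show "B (A (X n) - 0) (A (X n) - 0) \<le> \<mu> * (1 / real (Suc n))" for n
      using A_small by simp
    show "(\<lambda>n. \<mu> * (1 / real (Suc n))) \<longlonglongrightarrow> 0"
      using tendsto_mult_right_zero[OF LIMSEQ_inverse_real_of_nat, of \<mu>] by (simp add: divide_inverse)
  qed (use XH in \<open>auto simp: A_def\<close>)
  then have "converges_to (\<lambda>n. A (X (r n))) 0" using r by (rule converges_to_subseq)
  \<comment> \<open>The sum of the two sequences is \<open>\<mu> *\<^sub>R X (r n)\<close>; in this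
    way the compactness of \<open>K\<close> yields convergence of the maximising sequence
    itself.\<close>
  then have "converges_to (\<lambda>n. A (X (r n)) + K (X (r n))) (0 + y)"
    using y XH by (intro converges_to_add) (auto simp: A_def)
  then have lim: "converges_to (\<lambda>n. \<mu> *\<^sub>R X (r n)) y" by (simp add: A_def)
  have yW: "y \<in> W" using closed[OF _ y(1) y(2)] X W by auto
  \<comment> \<open>\<open>\<mu> *\<^sub>R K (X (r n))\<close> tends to \<open>K y\<close> by
    continuity of \<open>K\<close>, and to \<open>\<mu> *\<^sub>R y\<close> by the choice of the
    subsequence.\<close>
  have Ky: "B (K y - \<mu> *\<^sub>R y) (K y - \<mu> *\<^sub>R y) = 0"
  proof -
    have "converges_to (\<lambda>n. K (\<mu> *\<^sub>R X (r n))) (K y)"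
      using lim XH y by (intro converges_to_K) auto
    then have "(\<lambda>n. B (\<mu> *\<^sub>R K (X (r n)) - K y) (\<mu> *\<^sub>R K (X (r n)) - K y)) \<longlonglongrightarrow> 0"
      using XH by (simp add: converges_to_def K_scale)
    moreover have "(\<lambda>n. B (\<mu> *\<^sub>R K (X (r n)) - K y) (\<mu> *\<^sub>R K (X (r n)) - K y))
        \<longlonglongrightarrow> B (\<mu> *\<^sub>R y - K y) (\<mu> *\<^sub>R y - K y)"
    proof (rule converges_to_norm)
      have "(\<lambda>n. \<mu>\<^sup>2 * B (K (X (r n)) - y) (K (X (r n)) - y)) \<longlonglongrightarrow> \<mu>\<^sup>2 * 0"
        using y(2) unfolding converges_to_def by (intro tendsto_intros)
      moreover have "\<mu> *\<^sub>R K (X (r n)) - K y - (\<mu> *\<^sub>R y - K y) = \<mu> *\<^sub>R (K (X (r n)) - y)" for n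
        by (simp add: algebra_simps)
      ultimately show "converges_to (\<lambda>n. \<mu> *\<^sub>R K (X (r n)) - K y) (\<mu> *\<^sub>R y - K y)"
        using XH y by (simp add: converges_to_def scale_left scale_right power2_eq_square algebra_simps del: scaleR_right_diff_distrib)
    qed (use XH y in auto)
    ultimately have "B (\<mu> *\<^sub>R y - K y) (\<mu> *\<^sub>R y - K y) = 0" using LIMSEQ_unique by blast
    moreover have "B y (K y) = B (K y) y" using y(1) by (simp add: sym)
    ultimately show ?thesis using y by (simp add: bilinear algebra_simps)
  qed
  \<comment> \<open>The vectors \<open>X n\<close> lie in the unit ball and could tend to 0.
    Near-maximality forces their norms up: in the limit \<open>B y y\<close> is at least
    \<open>\<mu>\<close> squared, so \<open>y\<close> is not null.\<close>
  have "(\<lambda>n. \<mu> * (\<mu> - 1 / real (Suc (r n)))) \<longlonglongrightarrow> \<mu> * (\<mu> - 0)"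
    using LIMSEQ_subseq_LIMSEQ[OF LIMSEQ_inverse_real_of_nat r]
    by (intro tendsto_intros) (simp add: o_def divide_inverse)
  moreover have "\<mu> * (\<mu> - 1 / real (Suc (r n))) \<le> B (\<mu> *\<^sub>R X (r n)) (\<mu> *\<^sub>R X (r n))" for n
  proof -
    have "\<mu> - 1 / real (Suc (r n)) \<le> \<mu> * B (X (r n)) (X (r n))"
      using X(3)[of "r n"] le[OF X(1)[of "r n"]] by simp
    then show ?thesis using XH \<mu>_pos by (simp add: bilinear mult_left_mono)
  qed
  moreover have "(\<lambda>n. B (\<mu> *\<^sub>R X (r n)) (\<mu> *\<^sub>R X (r n))) \<longlonglongrightarrow> B y y"
    using lim XH y by (intro converges_to_norm) auto
  ultimately have "\<mu> * (\<mu> - 0) \<le> B y y" by (intro LIMSEQ_le) auto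
  then have yy: "0 < B y y" using \<mu>_pos by (smt (verit) mult_pos_pos)
  define p where "p = (1 / sqrt (B y y)) *\<^sub>R y"
  have "p \<in> W" "B p p = 1" using yW y yy by (auto simp: p_def scW bilinear)
  moreover have "K p - \<mu> *\<^sub>R p = (1 / sqrt (B y y)) *\<^sub>R (K y - \<mu> *\<^sub>R y)"
    using y by (simp add: p_def K_scale algebra_simps)
  then have "B (K p - \<mu> *\<^sub>R p) (K p - \<mu> *\<^sub>R p) = 0"
    using Ky y by (simp add: scale_left scale_right del: scaleR_right_diff_distrib)
  ultimately show ?thesis using that \<mu>_pos le by blast
qed

section \<open>Orthonormal eigenvectors by iterated maximisation\<close>

definition orthogonal_complement :: "'a set \<Rightarrow> 'a set" where
  "orthogonal_complement S = {x \<in> H. \<forall>y\<in>S. B x y = 0}"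

definition eigenpair :: "real \<Rightarrow> 'a \<Rightarrow> bool" where
  "eigenpair \<mu> p \<longleftrightarrow> 0 < \<mu> \<and> p \<in> H \<and> B p p = 1 \<and> B (K p - \<mu> *\<^sub>R p) (K p - \<mu> *\<^sub>R p) = 0"

lemma eigenpair_mem: "eigenpair \<mu> p \<Longrightarrow> p \<in> H"
  by (simp add: eigenpair_def)

lemma eigenpair_inner:
  assumes "eigenpair \<mu> p" "x \<in> H"
  shows "B (K p) x = \<mu> * B p x" "B (K x) p = \<mu> * B x p"
proof -
  have p: "p \<in> H" using assms by (auto simp: eigenpair_def)
  have "B (K p - \<mu> *\<^sub>R p) x = 0"
    using null_left[of "K p - \<mu> *\<^sub>R p" x] assms p unfolding eigenpair_def by blast
  then show "B (K p) x = \<mu> * B p x" using p assms by (simp add: bilinear)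
  then show "B (K x) p = \<mu> * B x p"
    using p assms(2) K_sym[of x p] sym[of x "K p"] sym[of x p] by simp
qed

text \<open>By symmetry of \<open>K\<close> the complement of finitely many eigenvectors is
  invariant; it is closed by continuity of the inner product and nontrivial by
  \<open>infinite_dim\<close>, so \<open>top_eigenvector\<close> applies to it.\<close>

lemma next_eigenpair:
  assumes "finite S" "S \<subseteq> H" "\<And>p. p \<in> S \<Longrightarrow> \<exists>\<mu>. eigenpair \<mu> p"
  shows "\<exists>\<mu> p. eigenpair \<mu> p \<and> p \<in> orthogonal_complement S \<and>
    (\<forall>x\<in>orthogonal_complement S. B (K x) x \<le> \<mu> * B x x)"
proof -
  let ?W = "orthogonal_complement S"
  obtain x0 where x0: "x0 \<in> ?W" "0 < B x0 x0"
    using infinite_dim[OF assms(1,2)] by (auto simp: orthogonal_complement_def)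
  have sub: "subspace ?W"
    unfolding subspace_def orthogonal_complement_def
    using assms(2) by (auto simp: add_left scale_left subset_iff)
  have KW: "K x \<in> ?W" if "x \<in> ?W" for x
    using that assms(3) eigenpair_inner(2) by (force simp: orthogonal_complement_def)
  have closed: "x \<in> ?W" if X: "\<And>n. X n \<in> ?W" "x \<in> H" "converges_to X x" for X x
  proof -
    have "B x y = 0" if "y \<in> S" for y
    proof -
      have "(\<lambda>n. B (X n) y) \<longlonglongrightarrow> B x y"
        using X assms(2) that by (intro converges_to_inner) (auto simp: orthogonal_complement_def)
      moreover have "B (X n) y = 0" for n using X(1) that by (auto simp: orthogonal_complement_def)
      ultimately show ?thesis by (simp add: LIMSEQ_const_iff)
    qed
    then show ?thesis using X(2) by (simp add: orthogonal_complement_def)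
  qed
  have WH: "?W \<subseteq> H" by (auto simp: orthogonal_complement_def)
  obtain \<mu> p where "0 < \<mu>" "p \<in> ?W" "B p p = 1" "B (K p - \<mu> *\<^sub>R p) (K p - \<mu> *\<^sub>R p) = 0"
    "\<And>x. x \<in> ?W \<Longrightarrow> B (K x) x \<le> \<mu> * B x x"
    by (rule top_eigenvector[OF sub WH KW closed x0]) (assumption | rule that)+
  then show ?thesis using WH by (auto simp: eigenpair_def)
qed

theorem spectral_theorem:
  obtains \<mu> \<phi> where "\<And>n. eigenpair (\<mu> n) (\<phi> n)" "decseq \<mu>" "\<mu> \<longlonglongrightarrow> 0"
    "\<And>m n. B (\<phi> m) (\<phi> n) = (if m = n then 1 else 0)"
    "\<And>x. x \<in> H \<Longrightarrow> converges_to (\<lambda>N. \<Sum>n<N. B x (\<phi> n) *\<^sub>R \<phi> n) x"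
proof -
  define good where "good S q \<longleftrightarrow> eigenpair (fst q) (snd q) \<and> snd q \<in> orthogonal_complement S \<and>
    (\<forall>x\<in>orthogonal_complement S. B (K x) x \<le> fst q * B x x)" for S q
  have "\<exists>f. \<forall>n::nat. good (snd ` f ` {..<n}) (f n)"
  proof -
    \<comment> \<open>The n-th choice depends on all earlier vectors, hence well-founded recursion.
      That a choice exists at all is known only if the earlier ones were good, hence the strong
      induction below.\<close>
    define F where "F g n = (SOME q. good (snd ` g ` {..<n}) q)"
      for g :: "nat \<Rightarrow> real \<times> 'a" and n :: nat
    define f where "f = wfrec less_than F"
    have adm: "adm_wf less_than F"
      unfolding adm_wf_def
    proof (intro allI impI)
      fix g h :: "nat \<Rightarrow> real \<times> 'a" and n
      assume "\<forall>z. (z, n) \<in> less_than \<longrightarrow> g z = h z"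
      then have "g ` {..<n} = h ` {..<n}" by (intro image_cong) auto
      then show "F g n = F h n" by (simp add: F_def)
    qed
    have f: "f n = F f n" for n
      unfolding f_def by (subst wfrec_fixpoint[OF wf_less_than adm]) simp
    have "good (snd ` f ` {..<n}) (f n)" for n
    proof (induction n rule: less_induct)
      case (less n)
      have "\<exists>q. good (snd ` f ` {..<n}) q"
      proof -
        have "\<exists>\<mu>. eigenpair \<mu> p" if "p \<in> snd ` f ` {..<n}" for p
          using that less unfolding good_def by blast
        moreover have "snd ` f ` {..<n} \<subseteq> H"
          using less eigenpair_mem unfolding good_def by blast
        ultimately obtain \<mu> p where "good (snd ` f ` {..<n}) (\<mu>, p)"
          using next_eigenpair[of "snd ` f ` {..<n}"] by (auto simp: good_def)
        then show ?thesis by blast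
      qed
      then show ?case unfolding f[of n] F_def by (rule someI_ex)
    qed
    then show ?thesis by blast
  qed
  then obtain f :: "nat \<Rightarrow> real \<times> 'a" where f: "\<And>n. good (snd ` f ` {..<n}) (f n)" by blast
  define \<mu> where "\<mu> n = fst (f n)" for n
  define \<phi> where "\<phi> n = snd (f n)" for n
  define W where "W n = {x \<in> H. \<forall>i<n. B x (\<phi> i) = 0}" for n
  have oc: "orthogonal_complement (snd ` f ` {..<n}) = W n" for n
    by (auto simp: W_def orthogonal_complement_def \<phi>_def)
  have ep: "eigenpair (\<mu> n) (\<phi> n)" and \<phi>W: "\<phi> n \<in> W n"
    and maxi: "x \<in> W n \<Longrightarrow> B (K x) x \<le> \<mu> n * B x x" for n x
    using f[of n] unfolding good_def oc by (auto simp: \<mu>_def \<phi>_def)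
  have \<mu>_pos: "0 < \<mu> n" and \<phi>H: "\<phi> n \<in> H" and \<phi>1: "B (\<phi> n) (\<phi> n) = 1" for n
    using ep[of n] by (auto simp: eigenpair_def)
  have orth: "B (\<phi> m) (\<phi> n) = 0" if "n < m" for m n
    using \<phi>W[of m] that by (auto simp: W_def)
  have on: "B (\<phi> m) (\<phi> n) = (if m = n then 1 else 0)" for m n
    using orth[of m n] orth[of n m] \<phi>1 sym[OF \<phi>H \<phi>H, of m n] by (cases m n rule: linorder_cases) auto
  have dec: "decseq \<mu>"
  proof (rule decseq_SucI)
    fix n
    have "\<mu> (Suc n) = B (K (\<phi> (Suc n))) (\<phi> (Suc n))"
      using eigenpair_inner(1)[OF ep \<phi>H] \<phi>1 by simp
    also have "\<dots> \<le> \<mu> n * B (\<phi> (Suc n)) (\<phi> (Suc n))"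
      using \<phi>W[of "Suc n"] by (intro maxi) (auto simp: W_def)
    finally show "\<mu> (Suc n) \<le> \<mu> n" using \<phi>1 by simp
  qed
  have lim: "\<mu> \<longlonglongrightarrow> 0"
  proof -
    obtain l where l: "\<mu> \<longlonglongrightarrow> l" "\<And>n. l \<le> \<mu> n"
      using decseq_convergent[OF dec, of 0] \<mu>_pos by (metis less_imp_le)
    have "0 \<le> l" using l(1) \<mu>_pos by (intro LIMSEQ_le_const) (auto intro: less_imp_le)
    obtain r x where r: "strict_mono r" and x: "x \<in> H" "converges_to (\<lambda>n. K (\<phi> (r n))) x"
      using K_compact[of \<phi>] \<phi>H \<phi>1 by auto
    \<comment> \<open>The images \<open>K (\<phi> n)\<close> are pairwise orthogonal. The limit
      \<open>x\<close> of a subsequence is therefore orthogonal to the images in that subsequence,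
      hence to itself; but its squared norm is the square of \<open>l\<close>.\<close>
    have Kn: "B (K (\<phi> n)) (K (\<phi> n)) = (\<mu> n)\<^sup>2" for n
      using eigenpair_inner[OF ep] \<phi>H \<phi>1 sym[of "\<phi> n" "K (\<phi> n)"] by (simp add: power2_eq_square)
    have "(\<lambda>n. B (K (\<phi> (r n))) (K (\<phi> (r n)))) \<longlonglongrightarrow> B x x"
      using x \<phi>H by (intro converges_to_norm) auto
    moreover have "(\<lambda>n. (\<mu> (r n))\<^sup>2) \<longlonglongrightarrow> l\<^sup>2"
      using LIMSEQ_subseq_LIMSEQ[OF l(1) r] by (intro tendsto_intros) (simp add: o_def)
    ultimately have xx: "B x x = l\<^sup>2" using Kn LIMSEQ_unique by simp
    have "B x (K (\<phi> (r m))) = 0" for m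
    proof (rule LIMSEQ_unique)
      show "(\<lambda>n. B (K (\<phi> (r n))) (K (\<phi> (r m)))) \<longlonglongrightarrow> B x (K (\<phi> (r m)))"
        using x \<phi>H by (intro converges_to_inner) auto
      have "B (K (\<phi> (r n))) (K (\<phi> (r m))) = 0" if "n > m" for n
        using eigenpair_inner[OF ep] \<phi>H orth strict_mono_less[OF r, of m n] that
          sym[of "\<phi> (r n)" "K (\<phi> (r m))"] sym[of "\<phi> (r m)" "\<phi> (r n)"] by simp
      then show "(\<lambda>n. B (K (\<phi> (r n))) (K (\<phi> (r m)))) \<longlonglongrightarrow> 0"
        by (intro tendsto_eventually eventually_sequentiallyI[of "Suc m"]) auto
    qed
    moreover have "(\<lambda>m. B (K (\<phi> (r m))) x) \<longlonglongrightarrow> B x x"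
      using x \<phi>H by (intro converges_to_inner) auto
    ultimately have "B x x = 0" using sym[OF x(1) K_mem[OF \<phi>H]] by (simp add: LIMSEQ_const_iff)
    then show ?thesis using xx l by simp
  qed
  have basis: "converges_to (\<lambda>N. \<Sum>n<N. B x (\<phi> n) *\<^sub>R \<phi> n) x" if x: "x \<in> H" for x
  proof -
    have "summable (\<lambda>n. (B x (\<phi> n))\<^sup>2)"
      using Bessel(2)[OF \<phi>H on x] by (intro summableI_nonneg_bounded[of _ "B x x"]) auto
    then obtain y where y: "y \<in> H" "converges_to (\<lambda>N. \<Sum>n<N. B x (\<phi> n) *\<^sub>R \<phi> n) y"
        "\<And>n. B y (\<phi> n) = B x (\<phi> n)"
      by (rule orthonormal_series[OF \<phi>H on]) (rule that)
    let ?z = "y - x"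
    have z: "?z \<in> H" "?z \<in> W n" for n using x y \<phi>H by (auto simp: W_def bilinear)
    \<comment> \<open>The residual lies in every \<open>W n\<close>, so its Rayleigh quotient is at
      most every \<open>\<mu> n\<close>; in the limit \<open>K_definite\<close> makes it
      null.\<close>
    have "(\<lambda>n. \<mu> n * B ?z ?z) \<longlonglongrightarrow> 0 * B ?z ?z" using lim by (intro tendsto_intros)
    then have "B (K ?z) ?z \<le> 0 * B ?z ?z" using maxi[OF z(2)] by (intro LIMSEQ_le_const) auto
    then have z0: "B ?z ?z = 0" using K_definite[OF z(1)] K_nonneg[OF z(1)] by simp
    let ?s = "\<lambda>N. \<Sum>n<N. B x (\<phi> n) *\<^sub>R \<phi> n"
    have s: "?s N \<in> H" for N using \<phi>H by auto
    \<comment> \<open>The series converges to \<open>y\<close>; adding the null vector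
      \<open>- ?z\<close> turns the limit into \<open>x\<close>.\<close>
    have "converges_to (\<lambda>N. ?s N + 0) (y + (0 - ?z))"
      using s y x z0 by (intro converges_to_add) (auto simp: converges_to_def)
    then show ?thesis by simp
  qed
  show ?thesis using that ep dec lim on basis by blast
qed

text \<open>
  Eigenvectors in the range of \<open>K\<close> inherit the regularity that \<open>K\<close> provides, whereas an eigenpair
  satisfies \<open>K p = \<mu> p\<close> only up to a null vector.
\<close>

corollary spectral_theorem_range:
  obtains \<mu> p \<phi> where "\<And>n. 0 < \<mu> n" "decseq \<mu>" "\<mu> \<longlonglongrightarrow> 0" "\<And>n. p n \<in> H"
    "\<And>n. \<phi> n = (1 / \<mu> n) *\<^sub>R K (p n)" "\<And>n. B (\<phi> n - p n) (\<phi> n - p n) = 0"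
    "\<And>m n. B (\<phi> m) (\<phi> n) = (if m = n then 1 else 0)"
    "\<And>x. x \<in> H \<Longrightarrow> converges_to (\<lambda>N. \<Sum>n<N. B x (\<phi> n) *\<^sub>R \<phi> n) x"
proof -
  obtain \<mu> p where ep: "\<And>n. eigenpair (\<mu> n) (p n)" and mu: "decseq \<mu>" "\<mu> \<longlonglongrightarrow> 0"
    and on: "\<And>m n. B (p m) (p n) = (if m = n then 1 else 0)"
    and basis: "\<And>x. x \<in> H \<Longrightarrow> converges_to (\<lambda>N. \<Sum>n<N. B x (p n) *\<^sub>R p n) x"
    by (rule spectral_theorem) (assumption | rule that)+
  define \<phi> where "\<phi> n = (1 / \<mu> n) *\<^sub>R K (p n)" for n
  have pos: "0 < \<mu> n" and pH: "p n \<in> H" for n using ep[of n] by (auto simp: eigenpair_def)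
  have \<phi>H: "\<phi> n \<in> H" for n using pH by (auto simp: \<phi>_def)
  have null: "B (\<phi> n - p n) (\<phi> n - p n) = 0" for n
  proof -
    have "\<phi> n - p n = (1 / \<mu> n) *\<^sub>R (K (p n) - \<mu> n *\<^sub>R p n)"
      using pos[of n] by (simp add: \<phi>_def scaleR_right_diff_distrib)
    then show ?thesis
      using ep[of n] pH[of n] by (simp add: eigenpair_def scale_left scale_right del: scaleR_right_diff_distrib)
  qed
  have eqL: "B (\<phi> n) x = B (p n) x" if "x \<in> H" for n x
    using null_left[OF _ that null[of n]] \<phi>H[of n] pH[of n] that by (simp add: diff_left)
  have eqR: "B x (\<phi> n) = B x (p n)" if "x \<in> H" for n x
    using eqL[OF that, of n] sym[OF that \<phi>H[of n]] sym[OF that pH[of n]] by simp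
  have on': "B (\<phi> m) (\<phi> n) = (if m = n then 1 else 0)" for m n
    using eqL[OF \<phi>H] eqR[OF pH] on by simp
  have basis': "converges_to (\<lambda>N. \<Sum>n<N. B x (\<phi> n) *\<^sub>R \<phi> n) x" if x: "x \<in> H" for x
  proof -
    have d: "(\<Sum>n<N. B x (\<phi> n) *\<^sub>R (\<phi> n - p n)) \<in> H" for N using \<phi>H pH by auto
    have "B (\<Sum>n<N. B x (\<phi> n) *\<^sub>R (\<phi> n - p n)) y = 0" if "y \<in> H" for N y
      using that \<phi>H pH by (subst sum_left) (auto simp: scale_left diff_left eqL)
    then have "converges_to (\<lambda>N. \<Sum>n<N. B x (\<phi> n) *\<^sub>R (\<phi> n - p n)) 0"
      using d by (simp add: converges_to_def)
    then have "converges_to (\<lambda>N. (\<Sum>n<N. B x (p n) *\<^sub>R p n) + (\<Sum>n<N. B x (\<phi> n) *\<^sub>R (\<phi> n - p n))) (x + 0)"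
      using d x pH basis[OF x] by (intro converges_to_add) (auto intro!: sum_mem)
    then show ?thesis using eqR[OF x] by (simp flip: sum.distrib scaleR_right_distrib)
  qed
  show ?thesis by (rule that[OF pos mu pH \<phi>_def null on' basis'])
qed

end

section \<open>Square integrable functions on an interval\<close>

lemma square_integrable_on_measurable:
  "square_integrable_on l f \<Longrightarrow> f \<in> borel_measurable (lebesgue_on {0..l})"
  by (simp add: square_integrable_on_def)

lemma square_integrable_on_mult:
  assumes "square_integrable_on l f" "square_integrable_on l g"
  shows "integrable (lebesgue_on {0..l}) (\<lambda>x. f x * g x)"
proof (rule Bochner_Integration.integrable_bound)
  show "integrable (lebesgue_on {0..l}) (\<lambda>x. (f x)\<^sup>2 + (g x)\<^sup>2)"
    using assms by (simp add: square_integrable_on_def)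
  show "AE x in lebesgue_on {0..l}. norm (f x * g x) \<le> norm ((f x)\<^sup>2 + (g x)\<^sup>2)"
  proof (rule AE_I2)
    fix x
    have "2 * \<bar>f x\<bar> * \<bar>g x\<bar> \<le> \<bar>f x\<bar>\<^sup>2 + \<bar>g x\<bar>\<^sup>2" by (rule sum_squares_bound)
    moreover have "0 \<le> \<bar>f x\<bar> * \<bar>g x\<bar>" by simp
    ultimately show "norm (f x * g x) \<le> norm ((f x)\<^sup>2 + (g x)\<^sup>2)"
      unfolding real_norm_def abs_mult power2_abs by linarith
  qed
qed (intro borel_measurable_times square_integrable_on_measurable assms)

lemma square_integrable_on_continuous:
  assumes "continuous_on {0..l} f"
  shows "square_integrable_on l f"
  unfolding square_integrable_on_def
proof
  have "integrable (lebesgue_on {0..l}) f" using assms by (rule continuous_imp_integrable_real)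
  then show "f \<in> borel_measurable (lebesgue_on {0..l})" by simp
  show "integrable (lebesgue_on {0..l}) (\<lambda>x. (f x)\<^sup>2)"
    using assms by (intro continuous_imp_integrable_real continuous_intros)
qed

lemma square_integrable_on_const [simp]: "square_integrable_on l (\<lambda>x. c)"
  by (intro square_integrable_on_continuous continuous_intros)

lemma square_integrable_on_integrable:
  "square_integrable_on l f \<Longrightarrow> integrable (lebesgue_on {0..l}) f"
  using square_integrable_on_mult[of l f "\<lambda>_. 1"] by simp

lemma square_integrable_on_cmult:
  "square_integrable_on l f \<Longrightarrow> square_integrable_on l (\<lambda>x. c * f x)"
  by (auto simp: square_integrable_on_def power_mult_distrib)

lemma square_integrable_on_add:
  assumes "square_integrable_on l f" "square_integrable_on l g"
  shows "square_integrable_on l (\<lambda>x. f x + g x)"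
  using assms square_integrable_on_mult[OF assms]
  by (auto simp: square_integrable_on_def power2_sum mult.assoc)

lemma square_integrable_on_minus:
  "square_integrable_on l f \<Longrightarrow> square_integrable_on l (\<lambda>x. - f x)"
  using square_integrable_on_cmult[of l f "-1"] by simp

interpretation interval: semi_inner_space "{f. square_integrable_on l f}"
    "\<lambda>f g. \<integral>x. f x * g x \<partial>lebesgue_on {0..l}" for l
proof
  show "subspace {f. square_integrable_on l f}"
    by (auto simp: subspace_def zero_fun_def plus_fun_def scaleR_fun_def
        square_integrable_on_add square_integrable_on_cmult)
  show "(\<integral>x. f x * g x \<partial>lebesgue_on {0..l}) = (\<integral>x. g x * f x \<partial>lebesgue_on {0..l})"
    for f g :: "real \<Rightarrow> real"
    by (simp add: mult.commute)
qed (auto simp: distrib_right square_integrable_on_mult mult.assoc)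

lemma integral_square_Cauchy_Schwarz:
  assumes "square_integrable_on l f" "square_integrable_on l g"
  shows "(\<integral>x. f x * g x \<partial>lebesgue_on {0..l})\<^sup>2
    \<le> (\<integral>x. (f x)\<^sup>2 \<partial>lebesgue_on {0..l}) * (\<integral>x. (g x)\<^sup>2 \<partial>lebesgue_on {0..l})"
  using interval.Cauchy_Schwarz[of f l g] assms by (simp add: power2_eq_square)

section \<open>Primitives of square integrable functions\<close>

lemma integrable_lebesgue_on_imp_absolutely_integrable:
  fixes f :: "real \<Rightarrow> real"
  shows "integrable (lebesgue_on {a..b}) f \<Longrightarrow> f absolutely_integrable_on {a..b}"
  by (simp add: set_integrable_def integrable_restrict_space)

lemma lebesgue_on_primitive:
  assumes "integrable (lebesgue_on {0..l}) f" "x \<in> {0..l::real}"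
  shows "integral\<^sup>L (lebesgue_on {0..x}) f = integral {0..x} (f :: real \<Rightarrow> real)"
proof (rule lebesgue_integral_eq_integral)
  have "f absolutely_integrable_on {0..x}"
    using set_integrable_subset[OF integrable_lebesgue_on_imp_absolutely_integrable[OF assms(1)]] assms(2)
    by auto
  then show "integrable (lebesgue_on {0..x}) f"
    by (simp add: set_integrable_def integrable_restrict_space)
qed auto

text \<open>Cauchy--Schwarz against the indicator of \<open>{x..y}\<close>. The modulus
  \<open>sqrt (y - x)\<close> drives both the integration by parts below and the equicontinuity
  behind the compactness of the Green operator.\<close>

lemma primitive_Holder:
  assumes f: "square_integrable_on l f" and xy: "0 \<le> x" "x \<le> y" "y \<le> l"
  shows "integral {x..y} (\<lambda>t. \<bar>f t\<bar>) \<le> sqrt (y - x) * sqrt (\<integral>t. (f t)\<^sup>2 \<partial>lebesgue_on {0..l})"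
proof -
  let ?M = "lebesgue_on {0..l}"
  let ?i = "\<lambda>t. indicat_real {x..y} t"
  have xyM: "{x..y} \<in> sets ?M" using xy by (auto simp: sets_restrict_space_iff)
  then have m: "?i \<in> borel_measurable ?M" by (rule borel_measurable_indicator)
  have ii: "\<And>t. (?i t)\<^sup>2 = ?i t" by (simp add: indicator_def)
  have "emeasure ?M {x..y} = ennreal (y - x)"
    using xy by (subst emeasure_restrict_space) auto
  then have e: "integrable ?M ?i \<and> (\<integral>t. ?i t \<partial>?M) = y - x"
    using xy xyM by (simp add: measure_def Int_absorb2)
  then have i: "square_integrable_on l ?i" using m by (simp add: square_integrable_on_def ii)
  have f': "square_integrable_on l (\<lambda>t. \<bar>f t\<bar>)"
    using f by (auto simp: square_integrable_on_def)
  have "integral {x..y} (\<lambda>t. \<bar>f t\<bar>) = (\<integral>t. \<bar>f t\<bar> * ?i t \<partial>?M)"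
  proof -
    have "(\<integral>t. \<bar>f t\<bar> * ?i t \<partial>?M) = integral {0..l} (\<lambda>t. \<bar>f t\<bar> * ?i t)"
      using square_integrable_on_mult[OF f' i] by (intro lebesgue_integral_eq_integral) auto
    also have "\<dots> = integral {0..l} (\<lambda>t. if t \<in> {x..y} then \<bar>f t\<bar> else 0)"
      by (intro integral_cong) (auto simp: indicator_def)
    also have "\<dots> = integral {x..y} (\<lambda>t. \<bar>f t\<bar>)"
      using xy by (subst integral_restrict_Int) (simp add: Int_absorb1)
    finally show ?thesis by simp
  qed
  moreover have "(\<integral>t. \<bar>f t\<bar> * ?i t \<partial>?M)\<^sup>2 \<le> (\<integral>t. (f t)\<^sup>2 \<partial>?M) * (y - x)"
    using integral_square_Cauchy_Schwarz[OF f' i] e by (simp add: ii)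
  ultimately show ?thesis
    using real_le_rsqrt[of "integral {x..y} (\<lambda>t. \<bar>f t\<bar>)" "(\<integral>t. (f t)\<^sup>2 \<partial>?M) * (y - x)"]
    by (simp add: real_sqrt_mult mult.commute)
qed

text \<open>A modulus of order 3/2 makes every difference quotient tend to 0, so \<open>P\<close>
  has derivative 0 everywhere.\<close>

lemma constant_if_superlinear_modulus:
  fixes P :: "real \<Rightarrow> real"
  assumes "0 \<le> l"
    and b: "\<And>x y. \<lbrakk>0 \<le> x; x \<le> y; y \<le> l\<rbrakk> \<Longrightarrow> \<bar>P y - P x\<bar> \<le> C * ((y - x) * sqrt (y - x))"
  shows "P l = P 0"
proof -
  have b': "\<bar>P y - P x\<bar> \<le> C * (\<bar>y - x\<bar> * sqrt \<bar>y - x\<bar>)" if "x \<in> {0..l}" "y \<in> {0..l}" for x y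
    using b[of x y] b[of y x] that by (cases "x \<le> y") (auto simp: abs_minus_commute)
  have "(P has_derivative (\<lambda>_. 0)) (at x within {0..l})" if x: "x \<in> {0..l}" for x
    unfolding has_derivative_within
  proof
    have "((\<lambda>y. C * sqrt \<bar>y - x\<bar>) \<longlongrightarrow> C * sqrt \<bar>x - x\<bar>) (at x within {0..l})"
      by (intro tendsto_intros)
    then have "((\<lambda>y. C * sqrt \<bar>y - x\<bar>) \<longlongrightarrow> 0) (at x within {0..l})" by simp
    moreover have "\<forall>\<^sub>F y in at x within {0..l}.
        norm ((1 / norm (y - x)) *\<^sub>R (P y - (P x + 0))) \<le> C * sqrt \<bar>y - x\<bar>"
      unfolding eventually_at
      using b'[OF x] by (intro exI[of _ 1]) (auto simp: field_simps)
    ultimately show "((\<lambda>y. (1 / norm (y - x)) *\<^sub>R (P y - (P x + 0))) \<longlongrightarrow> 0) (at x within {0..l})"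
      by (rule Lim_null_comparison[rotated])
  qed simp
  then have "\<exists>c. \<forall>x\<in>{0..l}. P x = c"
    by (intro has_derivative_zero_constant) auto
  then show ?thesis using assms(1) by auto
qed

lemma primitive_diff:
  assumes "f integrable_on {0..l}" "0 \<le> x" "x \<le> y" "y \<le> (l::real)"
  shows "integral {0..y} f - integral {0..x} f = integral {x..y} (f :: real \<Rightarrow> real)"
proof -
  have "f integrable_on {0..y}" by (rule integrable_on_subinterval[OF assms(1)]) (use assms in auto)
  then show ?thesis using Henstock_Kurzweil_Integration.integral_combine[of 0 x y f] assms by simp
qed

lemma primitive_abs_le:
  assumes f: "square_integrable_on l f" and xy: "0 \<le> x" "x \<le> y" "y \<le> l"
  shows "\<bar>integral {0..y} f - integral {0..x} f\<bar>
    \<le> sqrt (y - x) * sqrt (\<integral>t. (f t)\<^sup>2 \<partial>lebesgue_on {0..l})"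
proof -
  have ai: "f absolutely_integrable_on {0..l}"
    using f square_integrable_on_integrable integrable_lebesgue_on_imp_absolutely_integrable by blast
  then have "f absolutely_integrable_on {x..y}"
    using xy by (auto intro: set_integrable_subset)
  then have "\<bar>integral {x..y} f\<bar> \<le> integral {x..y} (\<lambda>t. \<bar>f t\<bar>)"
    using absolutely_integrable_on_def[of "{x..y}" f]
      integral_norm_bound_integral[of f "{x..y}" "\<lambda>t. \<bar>f t\<bar>"] by simp
  also note primitive_Holder[OF f xy]
  finally show ?thesis
    using primitive_diff[OF set_lebesgue_integral_eq_integral(1)[OF ai] xy] by simp
qed

lemma primitive_continuous:
  assumes "square_integrable_on l f"
  shows "continuous_on {0..l} (\<lambda>x. integral {0..x} f)"
  using assms square_integrable_on_integrable integrable_lebesgue_on_imp_absolutely_integrable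
    set_lebesgue_integral_eq_integral(1)
  by (intro indefinite_integral_continuous_1) blast

text \<open>
  Since \<open>f\<close> is only square integrable, the primitive of \<open>f\<close> need not be differentiable. The defect
  of the formula on \<open>[x, y]\<close> is however of order \<open>(y - x) powr (3/2)\<close> and therefore vanishes.
\<close>

lemma primitive_integration_by_parts:
  assumes l: "0 \<le> l" and f: "square_integrable_on l f"
    and v: "\<And>x. x \<in> {0..l} \<Longrightarrow> (v has_real_derivative v' x) (at x within {0..l})"
    and v': "continuous_on {0..l} v'"
  shows "integral {0..l} (\<lambda>t. f t * v t) + integral {0..l} (\<lambda>t. integral {0..t} f * v' t)
    = integral {0..l} f * v l"
proof -
  define F where "F x = integral {0..x} f" for x
  define P where "P x = F x * v x - integral {0..x} (\<lambda>t. F t * v' t) - integral {0..x} (\<lambda>t. f t * v t)" for x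
  define N where "N = sqrt (\<integral>t. (f t)\<^sup>2 \<partial>lebesgue_on {0..l})"
  have N: "0 \<le> N" by (simp add: N_def)
  obtain M where "\<forall>x\<in>v' ` {0..l}. norm x \<le> M"
    using compact_imp_bounded[OF compact_continuous_image[OF v' compact_Icc]]
    unfolding bounded_iff by blast
  then have M: "\<bar>v' x\<bar> \<le> M" if "x \<in> {0..l}" for x using that by auto
  have M0: "0 \<le> M" using M[of 0] l by auto
  have cv: "continuous_on {0..l} v"
    using v by (meson DERIV_continuous continuous_on_eq_continuous_within)
  have cF: "continuous_on {0..l} F" unfolding F_def using f by (rule primitive_continuous)
  have fa: "f absolutely_integrable_on {0..l}"
    using f square_integrable_on_integrable integrable_lebesgue_on_imp_absolutely_integrable by blast
  have fi: "f integrable_on {0..l}" using fa set_lebesgue_integral_eq_integral(1) by blast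
  have sub: "g integrable_on {x..y}" if "g integrable_on {0..l}" "0 \<le> x" "y \<le> l"
    for g :: "real \<Rightarrow> real" and x y
    by (rule integrable_on_subinterval[OF that(1)]) (use that in auto)
  have fva: "(\<lambda>t. f t * v t) absolutely_integrable_on {0..l}"
    using square_integrable_on_mult[OF f square_integrable_on_continuous[OF cv]]
    by (rule integrable_lebesgue_on_imp_absolutely_integrable)
  have fvi: "(\<lambda>t. f t * v t) integrable_on {0..l}" using fva set_lebesgue_integral_eq_integral(1) by blast
  have Fvi: "(\<lambda>t. F t * v' t) integrable_on {0..l}"
    by (intro integrable_continuous_real continuous_intros cF v')
  have ftc: "(v' has_integral (v y - v x)) {x..y}" if "0 \<le> x" "x \<le> y" "y \<le> l" for x y
    using that v by (intro fundamental_theorem_of_calculus)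
      (auto simp flip: has_real_derivative_iff_has_vector_derivative
            intro: has_field_derivative_subset[OF v])
  have "\<bar>P y - P x\<bar> \<le> (2 * M * N) * ((y - x) * sqrt (y - x))" if xy: "0 \<le> x" "x \<le> y" "y \<le> l" for x y
  proof -
    have vlip: "\<bar>v y - v t\<bar> \<le> M * (y - x)" if "t \<in> {x..y}" for t
    proof -
      have "norm (v y - v t) \<le> M * norm (y - t)"
      proof (rule field_differentiable_bound[of "{0..l}" v v'])
      qed (use v M that xy in auto)
      also have "\<dots> \<le> M * (y - x)" using that M0 by (intro mult_left_mono) auto
      finally show ?thesis by simp
    qed
    have Flip: "\<bar>F x - F t\<bar> \<le> N * sqrt (y - x)" if "t \<in> {x..y}" for t
    proof -
      have "\<bar>F t - F x\<bar> \<le> sqrt (t - x) * N"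
        using primitive_abs_le[OF f, of x t] that xy unfolding F_def N_def by auto
      also have "\<dots> \<le> sqrt (y - x) * N" using that N by (intro mult_right_mono) auto
      finally show ?thesis by (simp add: abs_minus_commute mult.commute)
    qed
    have i1: "((\<lambda>t. (F x - F t) * v' t) has_integral
        (F x * (v y - v x) - integral {x..y} (\<lambda>t. F t * v' t))) {x..y}"
      unfolding left_diff_distrib
      by (intro has_integral_diff has_integral_mult_right ftc xy integrable_integral sub[OF Fvi])
    have i2: "((\<lambda>t. f t * (v y - v t)) has_integral
        (integral {x..y} f * v y - integral {x..y} (\<lambda>t. f t * v t))) {x..y}"
      unfolding right_diff_distrib
      by (intro has_integral_diff has_integral_mult_left integrable_integral sub[OF fi] sub[OF fvi] xy)
    \<comment> \<open>The increment splits into the integrals of \<open>(F x - F t) * v' t\<close>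
      and of \<open>f t * (v y - v t)\<close>. Each has a factor \<open>y - x\<close>, from the
      interval or from the Lipschitz bound of \<open>v\<close>, and a factor
      \<open>sqrt (y - x)\<close>, from \<open>primitive_Holder\<close>.\<close>
    have "P y - P x = (F x * (v y - v x) - integral {x..y} (\<lambda>t. F t * v' t))
        + (integral {x..y} f * v y - integral {x..y} (\<lambda>t. f t * v t))"
      using primitive_diff[OF fi xy] primitive_diff[OF fvi xy] primitive_diff[OF Fvi xy]
      unfolding P_def F_def by (simp add: algebra_simps)
    moreover have "\<bar>F x * (v y - v x) - integral {x..y} (\<lambda>t. F t * v' t)\<bar>
        \<le> (N * sqrt (y - x) * M) * (y - x)"
    proof -
      have "norm (F x * (v y - v x) - integral {x..y} (\<lambda>t. F t * v' t))
          \<le> (N * sqrt (y - x) * M) * measure lborel {x..y}"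
        using xy N M0 Flip M
        by (intro has_integral_bound_real[OF _ finite.emptyI i1])
           (auto simp: abs_mult intro!: mult_mono)
      then show ?thesis using xy by simp
    qed
    moreover have "\<bar>integral {x..y} f * v y - integral {x..y} (\<lambda>t. f t * v t)\<bar>
        \<le> (M * (y - x)) * (N * sqrt (y - x))"
    proof -
      have fxy: "f absolutely_integrable_on {x..y}"
        using fa xy by (auto intro: set_integrable_subset)
      have "norm (integral {x..y} (\<lambda>t. f t * (v y - v t))) \<le> integral {x..y} (\<lambda>t. M * (y - x) * \<bar>f t\<bar>)"
      proof (rule integral_norm_bound_integral)
        show "(\<lambda>t. M * (y - x) * \<bar>f t\<bar>) integrable_on {x..y}"
          using fxy by (intro integrable_on_mult_right) (simp add: absolutely_integrable_on_def)
        show "norm (f t * (v y - v t)) \<le> M * (y - x) * \<bar>f t\<bar>" if "t \<in> {x..y}" for t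
          using mult_left_mono[OF vlip[OF that], of "\<bar>f t\<bar>"] by (simp add: abs_mult mult.commute)
      qed (use i2 in blast)
      also have "\<dots> \<le> M * (y - x) * (sqrt (y - x) * N)"
        using primitive_Holder[OF f xy] M0 xy unfolding N_def by (simp add: mult_left_mono)
      finally show ?thesis using integral_unique[OF i2] by (simp add: mult.commute)
    qed
    ultimately show ?thesis by (simp add: algebra_simps)
  qed
  then have "P l = P 0" using l by (intro constant_if_superlinear_modulus[of l P]) auto
  then show ?thesis by (simp add: P_def F_def)
qed

text \<open>Vanishing primitives say that the positive and negative parts of \<open>f\<close>, as
  densities, define measures that agree on all half lines. Half lines determine these measures, so
  the two parts agree almost everywhere, which forces both to vanish.\<close>

lemma AE_zero_if_primitive_zero:
  assumes f: "square_integrable_on l f" and z: "\<And>x. x \<in> {0..l} \<Longrightarrow> integral {0..x} f = 0"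
  shows "AE x in lebesgue_on {0..l}. f x = 0"
proof -
  let ?h = "\<lambda>x. indicat_real {0..l} x * f x"
  have fint: "integrable (lebesgue_on {0..l}) f" using f by (rule square_integrable_on_integrable)
  have fa: "f absolutely_integrable_on {0..l}"
    using fint by (rule integrable_lebesgue_on_imp_absolutely_integrable)
  have hint: "integrable lebesgue ?h" using fa by (simp add: set_integrable_def)
  \<comment> \<open>A Borel representative of \<open>f\<close>, extended by 0, so that the measures
    below can be compared on \<open>lborel\<close>.\<close>
  then obtain g where g [measurable]: "g \<in> borel_measurable lborel" and ae: "AE x in lborel. ?h x = g x"
    using completion_ex_borel_measurable_real[of ?h lborel] by auto
  have ae': "AE x in lebesgue. g x = ?h x"
    using AE_completion[OF ae] by eventually_elim simp
  have gint: "integrable lborel g"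
  proof -
    have "integrable lebesgue g"
      using hint ae' g by (subst integrable_cong_AE[of _ _ ?h]) (auto intro: measurable_completion)
    then show ?thesis using g by (simp add: integrable_completion)
  qed
  have g0: "(\<integral>x. indicat_real {a<..} x * g x \<partial>lborel) = 0" for a
  proof -
    have "(\<integral>x. indicat_real {a<..} x * g x \<partial>lborel) = (\<integral>x. indicat_real {a<..} x * g x \<partial>lebesgue)"
      by (simp add: integral_completion)
    also have "\<dots> = (\<integral>x. indicat_real {a<..} x * ?h x \<partial>lebesgue)"
    proof (rule integral_cong_AE)
      show "(\<lambda>x. indicat_real {a<..} x * g x) \<in> borel_measurable lebesgue"
        by (rule measurable_completion) measurable
      show "(\<lambda>x. indicat_real {a<..} x * ?h x) \<in> borel_measurable lebesgue"
        by (rule borel_measurable_times[OF _ borel_measurable_integrable[OF hint]])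
           (auto intro: measurable_completion)
      show "AE x in lebesgue. indicat_real {a<..} x * g x = indicat_real {a<..} x * ?h x"
        using ae' by eventually_elim simp
    qed
    also have "\<dots> = (\<integral>x. indicat_real ({0..l} \<inter> {a<..}) x *\<^sub>R f x \<partial>lebesgue)"
      by (intro Bochner_Integration.integral_cong) (auto simp: indicator_def)
    also have "\<dots> = integral ({0..l} \<inter> {a<..}) f"
      using set_integrable_subset[OF fa, of "{0..l} \<inter> {a<..}"]
      by (intro set_lebesgue_integral_eq_integral(2)[unfolded set_lebesgue_integral_def]) auto
    also have "\<dots> = 0"
    proof -
      consider "a < 0" | "0 \<le> a" "a \<le> l" | "l < a" by linarith
      then show ?thesis
      proof cases
        case 1
        then have "{0..l} \<inter> {a<..} = {0..l}" by auto
        then show ?thesis using z[of l] by (cases "0 \<le> l") auto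
      next
        case 2
        have "integral ({0..l} \<inter> {a<..}) f = integral {a..l} f"
          by (rule integral_spike_set; rule negligible_subset[of "{a}"]) (use 2 in auto)
        also have "\<dots> = 0"
          using primitive_diff[OF set_lebesgue_integral_eq_integral(1)[OF fa], of a l] 2 z by simp
        finally show ?thesis .
      next
        case 3
        then have "{0..l} \<inter> {a<..} = {}" by auto
        then show ?thesis by simp
      qed
    qed
    finally show ?thesis .
  qed
  \<comment> \<open>\<open>ennreal\<close> truncates negative values to 0, so these are the measures
    of the positive and of the negative part of \<open>g\<close>.\<close>
  let ?P = "density lborel (\<lambda>x. ennreal (g x))" and ?N = "density lborel (\<lambda>x. ennreal (- g x))"
  have P: "emeasure ?P {a<..} = ennreal (\<integral>x. indicat_real {a<..} x * max 0 (g x) \<partial>lborel)"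
    and N: "emeasure ?N {a<..} = ennreal (\<integral>x. indicat_real {a<..} x * max 0 (- g x) \<partial>lborel)"
    and eq: "(\<integral>x. indicat_real {a<..} x * max 0 (g x) \<partial>lborel)
      = (\<integral>x. indicat_real {a<..} x * max 0 (- g x) \<partial>lborel)" for a
  proof -
    have ip: "integrable lborel (\<lambda>x. indicat_real {a<..} x * max 0 (g x))"
      and im: "integrable lborel (\<lambda>x. indicat_real {a<..} x * max 0 (- g x))"
      by (rule Bochner_Integration.integrable_bound[OF gint]; auto simp: indicator_def)+
    show "emeasure ?P {a<..} = ennreal (\<integral>x. indicat_real {a<..} x * max 0 (g x) \<partial>lborel)"
      by (subst emeasure_density, simp, simp, subst nn_integral_eq_integral[OF ip, symmetric])
         (auto intro!: nn_integral_cong simp: indicator_def max_def ennreal_neg)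
    show "emeasure ?N {a<..} = ennreal (\<integral>x. indicat_real {a<..} x * max 0 (- g x) \<partial>lborel)"
      by (subst emeasure_density, simp, simp, subst nn_integral_eq_integral[OF im, symmetric])
         (auto intro!: nn_integral_cong simp: indicator_def max_def ennreal_neg)
    have "(\<integral>x. indicat_real {a<..} x * g x \<partial>lborel) =
        (\<integral>x. indicat_real {a<..} x * max 0 (g x) - indicat_real {a<..} x * max 0 (- g x) \<partial>lborel)"
      by (intro Bochner_Integration.integral_cong) (auto simp: max_def)
    then show "(\<integral>x. indicat_real {a<..} x * max 0 (g x) \<partial>lborel)
      = (\<integral>x. indicat_real {a<..} x * max 0 (- g x) \<partial>lborel)"
      using ip im g0[of a] by simp
  qed
  have "?P = ?N"
    by (rule measure_eqI_lessThan) (auto simp: P N eq)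
  then have "AE x in lborel. ennreal (g x) = ennreal (- g x)"
    by (intro sigma_finite_measure.density_unique[OF sigma_finite_lborel]) auto
  then have "AE x in lborel. g x = 0"
    by eventually_elim (metis ennreal_eq_0_iff ennreal_neg linorder_le_cases neg_le_0_iff_le order_antisym)
  from AE_completion[OF this] ae' have "AE x in lebesgue. ?h x = 0"
    by eventually_elim simp
  then show ?thesis
    by (subst AE_restrict_space_iff) (auto simp: indicator_def elim: AE_mp)
qed

text \<open>
  Along a subsequence with rapidly decreasing increments the increments are almost everywhere
  absolutely summable; Fatou's lemma then identifies the pointwise limit.
\<close>

lemma (in finite_measure) Riesz_Fischer:
  fixes f :: "nat \<Rightarrow> 'a \<Rightarrow> real"
  assumes m [measurable]: "\<And>n. f n \<in> borel_measurable M"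
    and i: "\<And>n. integrable M (\<lambda>x. (f n x)\<^sup>2)"
    and C: "\<And>e. 0 < e \<Longrightarrow> \<exists>N. \<forall>m\<ge>N. \<forall>n\<ge>N. (\<integral>x. (f m x - f n x)\<^sup>2 \<partial>M) < e"
  obtains g where "g \<in> borel_measurable M" "integrable M (\<lambda>x. (g x)\<^sup>2)"
    "(\<lambda>n. \<integral>x. (f n x - g x)\<^sup>2 \<partial>M) \<longlonglongrightarrow> 0"
proof -
  have id: "integrable M (\<lambda>x. (f m x - f n x)\<^sup>2)" for m n
  proof (rule Bochner_Integration.integrable_bound)
    show "integrable M (\<lambda>x. 2 * (f m x)\<^sup>2 + 2 * (f n x)\<^sup>2)" using i by simp
    have "(f m x - f n x)\<^sup>2 \<le> 2 * (f m x)\<^sup>2 + 2 * (f n x)\<^sup>2" for x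
      using zero_le_power2[of "f m x + f n x"] by (simp add: power2_eq_square algebra_simps)
    then show "AE x in M. norm ((f m x - f n x)\<^sup>2) \<le> norm (2 * (f m x)\<^sup>2 + 2 * (f n x)\<^sup>2)" by simp
  qed auto
  have "\<exists>N. \<forall>m\<ge>N. \<forall>n\<ge>N. (\<integral>x. (f m x - f n x)\<^sup>2 \<partial>M) < (1 / 4) ^ k" for k :: nat
    by (intro C) simp
  then obtain N where N: "\<And>k m n. m \<ge> N k \<Longrightarrow> n \<ge> N k \<Longrightarrow> (\<integral>x. (f m x - f n x)\<^sup>2 \<partial>M) < (1 / 4) ^ k"
    by metis
  \<comment> \<open>Summing the thresholds makes \<open>r\<close> monotone and at least
    \<open>N k\<close>; the extra \<open>k\<close> ensures that \<open>r k\<close> passes any given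
    index.\<close>
  define r where "r k = k + (\<Sum>j\<le>k. N j)" for k
  have rN: "N k \<le> r k" for k
    unfolding r_def by (rule trans_le_add2, rule member_le_sum) auto
  have r_mono: "r k \<le> r (Suc k)" for k by (simp add: r_def)
  have r_ge: "k \<le> r k" for k by (simp add: r_def)
  define d where "d k x = \<bar>f (r (Suc k)) x - f (r k) x\<bar>" for k x
  have d_nonneg: "0 \<le> d k x" for k x by (simp add: d_def)
  have d_meas [measurable]: "d k \<in> borel_measurable M" for k by (simp add: d_def[abs_def])
  have d2: "integrable M (\<lambda>x. (d k x)\<^sup>2)" "(\<integral>x. (d k x)\<^sup>2 \<partial>M) \<le> (1 / 4) ^ k" for k
    using id[of "r (Suc k)" "r k"] N[of k "r (Suc k)" "r k"] rN[of k] r_mono[of k]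
    by (auto simp: d_def)
  have d1: "integrable M (d k)" "(\<integral>x. d k x \<partial>M) \<le> (1 + measure M (space M)) * (1 / 2) ^ k" for k
  proof -
    \<comment> \<open>The weight \<open>2 ^ k\<close> balances the two terms: the integral of
      \<open>(d k x)\<^sup>2\<close> is at most \<open>(1 / 4) ^ k\<close>, so each contributes a
      multiple of \<open>(1 / 2) ^ k\<close>. Finiteness of the measure is what bounds the constant
      term.\<close>
    have le: "d k x \<le> 2 ^ k * (d k x)\<^sup>2 + (1 / 2) ^ k" for x
    proof -
      have "0 \<le> (2 ^ k * d k x - 1 / 2)\<^sup>2" by simp
      then have "2 ^ k * d k x \<le> (2 ^ k * d k x)\<^sup>2 + 1"
        by (simp add: power2_eq_square algebra_simps)
      then show ?thesis by (simp add: field_simps power2_eq_square)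
    qed
    have iu: "integrable M (\<lambda>x. 2 ^ k * (d k x)\<^sup>2 + (1 / 2) ^ k)" using d2(1) by simp
    show "integrable M (d k)"
      by (rule Bochner_Integration.integrable_bound[OF iu]) (use le in \<open>auto simp: d_def\<close>)
    then have "(\<integral>x. d k x \<partial>M) \<le> (\<integral>x. 2 ^ k * (d k x)\<^sup>2 + (1 / 2) ^ k \<partial>M)"
      using iu le by (intro integral_mono) auto
    also have "\<dots> = 2 ^ k * (\<integral>x. (d k x)\<^sup>2 \<partial>M) + (1 / 2) ^ k * measure M (space M)"
      using d2(1) by simp
    also have "\<dots> \<le> 2 ^ k * (1 / 4) ^ k + (1 / 2) ^ k * measure M (space M)"
      using d2(2) by simp
    also have "2 ^ k * (1 / 4) ^ k = (1 / 2 :: real) ^ k"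
      by (simp flip: power_mult_distrib)
    finally show "(\<integral>x. d k x \<partial>M) \<le> (1 + measure M (space M)) * (1 / 2) ^ k"
      by (simp add: algebra_simps)
  qed
  have "(\<integral>\<^sup>+ x. (\<Sum>k. ennreal (d k x)) \<partial>M) = (\<Sum>k. \<integral>\<^sup>+ x. ennreal (d k x) \<partial>M)"
    by (rule nn_integral_suminf) measurable
  also have "\<dots> = (\<Sum>k. ennreal (\<integral>x. d k x \<partial>M))"
    using d1(1) by (intro suminf_cong nn_integral_eq_integral) (simp_all add: d_nonneg)
  also have "\<dots> \<le> (\<Sum>k. ennreal ((1 + measure M (space M)) * (1 / 2) ^ k))"
    using d1(2) by (intro suminf_le ennreal_leI) auto
  also have "\<dots> < \<infinity>"
    by (subst suminf_ennreal2) (auto intro!: summable_mult simp: summable_geometric less_top[symmetric])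
  finally have "AE x in M. (\<Sum>k. ennreal (d k x)) \<noteq> \<infinity>"
    by (intro nn_integral_PInf_AE) auto
  then have conv: "AE x in M. convergent (\<lambda>k. f (r k) x)"
  proof eventually_elim
    case (elim x)
    have "summable (\<lambda>k. d k x)"
      using elim by (intro summable_suminf_not_top) (auto simp: d_def)
    then have "summable (\<lambda>k. f (r (Suc k)) x - f (r k) x)"
      unfolding d_def by (rule summable_rabs_cancel)
    then have "convergent (\<lambda>n. \<Sum>k<n. f (r (Suc k)) x - f (r k) x)"
      by (simp add: summable_iff_convergent)
    then have "convergent (\<lambda>n. f (r n) x - f (r 0) x)"
      by (simp add: sum_lessThan_telescope[of "\<lambda>k. f (r k) x"])
    then show ?case by (simp add: convergent_diff_const_right_iff)
  qed
  define g where "g x = lim (\<lambda>k. f (r k) x)" for x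
  have g [measurable]: "g \<in> borel_measurable M"
    unfolding g_def by measurable
  have Fatou: "(\<integral>\<^sup>+x. ennreal ((f n x - g x)\<^sup>2) \<partial>M) \<le> ennreal e"
    if "0 < e" and Ne: "\<And>m. m \<ge> K \<Longrightarrow> (\<integral>x. (f n x - f m x)\<^sup>2 \<partial>M) \<le> e" for n e K
  proof -
    have "(\<integral>\<^sup>+x. ennreal ((f n x - g x)\<^sup>2) \<partial>M)
        = (\<integral>\<^sup>+x. liminf (\<lambda>k. ennreal ((f n x - f (r k) x)\<^sup>2)) \<partial>M)"
    proof (rule nn_integral_cong_AE)
      show "AE x in M. ennreal ((f n x - g x)\<^sup>2) = liminf (\<lambda>k. ennreal ((f n x - f (r k) x)\<^sup>2))"
        using conv
      proof eventually_elim
        case (elim x)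
        then have "(\<lambda>k. f (r k) x) \<longlonglongrightarrow> g x" by (simp add: g_def convergent_LIMSEQ_iff)
        then have "(\<lambda>k. ennreal ((f n x - f (r k) x)\<^sup>2)) \<longlonglongrightarrow> ennreal ((f n x - g x)\<^sup>2)"
          by (intro tendsto_intros)
        then show ?case by (intro lim_imp_Liminf[symmetric]) auto
      qed
    qed
    also have "\<dots> \<le> liminf (\<lambda>k. \<integral>\<^sup>+x. ennreal ((f n x - f (r k) x)\<^sup>2) \<partial>M)"
      by (rule nn_integral_liminf) measurable
    also have "\<dots> \<le> ennreal e"
    proof (rule Liminf_le)
      show "\<forall>\<^sub>F k in sequentially. (\<integral>\<^sup>+x. ennreal ((f n x - f (r k) x)\<^sup>2) \<partial>M) \<le> ennreal e"
      proof (rule eventually_sequentiallyI[of K])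
        fix k assume "K \<le> k"
        then have "(\<integral>x. (f n x - f (r k) x)\<^sup>2 \<partial>M) \<le> e" using Ne[of "r k"] r_ge[of k] by simp
        then show "(\<integral>\<^sup>+x. ennreal ((f n x - f (r k) x)\<^sup>2) \<partial>M) \<le> ennreal e"
          using id by (subst nn_integral_eq_integral) (auto intro: ennreal_leI)
      qed
    qed simp
    finally show ?thesis .
  qed
  have fg: "integrable M (\<lambda>x. (f n x - g x)\<^sup>2)" "(\<integral>x. (f n x - g x)\<^sup>2 \<partial>M) \<le> e"
    if "0 < e" "\<And>m. m \<ge> K \<Longrightarrow> (\<integral>x. (f n x - f m x)\<^sup>2 \<partial>M) \<le> e" for n e K
  proof -
    have b: "(\<integral>\<^sup>+x. ennreal ((f n x - g x)\<^sup>2) \<partial>M) \<le> ennreal e"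
      by (rule Fatou[OF that])
    show int: "integrable M (\<lambda>x. (f n x - g x)\<^sup>2)"
      by (rule integrableI_bounded) (use b in \<open>auto intro: le_less_trans\<close>)
    show "(\<integral>x. (f n x - g x)\<^sup>2 \<partial>M) \<le> e"
      using b that(1) by (subst (asm) nn_integral_eq_integral[OF int]) auto
  qed
  have lim: "(\<lambda>n. \<integral>x. (f n x - g x)\<^sup>2 \<partial>M) \<longlonglongrightarrow> 0"
  proof (rule LIMSEQ_I)
    fix e :: real assume "0 < e"
    then obtain K where K: "\<And>m n. m \<ge> K \<Longrightarrow> n \<ge> K \<Longrightarrow> (\<integral>x. (f m x - f n x)\<^sup>2 \<partial>M) < e / 2"
      using C[of "e / 2"] by auto
    have "(\<integral>x. (f n x - g x)\<^sup>2 \<partial>M) \<le> e / 2" if "n \<ge> K" for n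
      using fg(2)[of "e / 2" K n] \<open>0 < e\<close> K[OF that] by force
    then show "\<exists>no. \<forall>n\<ge>no. norm ((\<integral>x. (f n x - g x)\<^sup>2 \<partial>M) - 0) < e"
      using \<open>0 < e\<close> by (intro exI[of _ K]) force
  qed
  \<comment> \<open>The threshold \<open>N 0\<close> serves the bound 1, since
    \<open>(1 / 4) ^ 0 = 1\<close>. One square integrable difference suffices to make
    \<open>g\<close> square integrable.\<close>
  obtain n where n: "integrable M (\<lambda>x. (f n x - g x)\<^sup>2)"
    using fg(1)[of 1 "N 0" "N 0"] N[of 0 "N 0"] by (metis less_imp_le power_0 order_refl zero_less_one)
  have "integrable M (\<lambda>x. (g x)\<^sup>2)"
  proof (rule Bochner_Integration.integrable_bound)
    show "integrable M (\<lambda>x. 2 * (f n x)\<^sup>2 + 2 * (f n x - g x)\<^sup>2)" using i n by simp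
    have "(g x)\<^sup>2 \<le> 2 * (f n x)\<^sup>2 + 2 * (f n x - g x)\<^sup>2" for x
      using zero_le_power2[of "2 * f n x - g x"] by (simp add: power2_eq_square algebra_simps)
    then show "AE x in M. norm ((g x)\<^sup>2) \<le> norm (2 * (f n x)\<^sup>2 + 2 * (f n x - g x)\<^sup>2)" by simp
  qed auto
  with that g lim show ?thesis by blast
qed

section \<open>The energy form of a metric graph\<close>

lemma H2_on_has_derivative:
  "H2_on l u u' g \<Longrightarrow> x \<in> {0..l} \<Longrightarrow> (u has_real_derivative u' x) (at x within {0..l})"
  unfolding H2_on_def by blast

lemma H2_on_square_integrable: "H2_on l u u' g \<Longrightarrow> square_integrable_on l g"
  unfolding H2_on_def by blast

lemma H2_on_primitive:
  assumes "H2_on l u u' g" "x \<in> {0..l}"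
  shows "u' x = u' 0 + integral {0..x} g"
proof -
  have "u' x = u' 0 + integral\<^sup>L (lebesgue_on {0..x}) g" using assms unfolding H2_on_def by blast
  then show ?thesis
    by (simp only: lebesgue_on_primitive[OF
          square_integrable_on_integrable[OF H2_on_square_integrable[OF assms(1)]] assms(2)])
qed

lemma H2_on_continuous_derivative:
  assumes "H2_on l u u' g"
  shows "continuous_on {0..l} u'"
proof -
  have "continuous_on {0..l} (\<lambda>x. u' 0 + integral {0..x} g)"
    using assms by (intro continuous_intros primitive_continuous H2_on_square_integrable)
  then show ?thesis
    by (rule continuous_on_eq) (rule H2_on_primitive[OF assms, symmetric])
qed

text \<open>Integration by parts with \<open>u''\<close> merely square integrable. The primitive of
  \<open>u''\<close> is \<open>u' - u' 0\<close>, and its constant accounts for the boundary term at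
  0.\<close>

lemma H2_on_Green:
  assumes l: "0 \<le> l" and u: "H2_on l u u' (\<lambda>x. - f x)"
    and v: "\<And>x. x \<in> {0..l} \<Longrightarrow> (v has_real_derivative v' x) (at x within {0..l})"
    and v': "continuous_on {0..l} v'"
  shows "(\<integral>x. f x * v x \<partial>lebesgue_on {0..l})
    = (\<integral>x. u' x * v' x \<partial>lebesgue_on {0..l}) - (u' l * v l - u' 0 * v 0)"
proof -
  let ?g = "\<lambda>x. - f x"
  have g: "square_integrable_on l ?g" using u by (rule H2_on_square_integrable)
  have F: "integral {0..x} ?g = u' x - u' 0" if "x \<in> {0..l}" for x
    using H2_on_primitive[OF u that] by simp
  have cv: "continuous_on {0..l} v"
    using v by (meson DERIV_continuous continuous_on_eq_continuous_within)
  have cu': "continuous_on {0..l} u'" using u by (rule H2_on_continuous_derivative)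
  have ftc: "(v' has_integral (v l - v 0)) {0..l}"
    using l v by (intro fundamental_theorem_of_calculus)
      (auto simp flip: has_real_derivative_iff_has_vector_derivative)
  have "integral {0..l} (\<lambda>t. integral {0..t} ?g * v' t) = integral {0..l} (\<lambda>t. u' t * v' t - u' 0 * v' t)"
    by (intro integral_cong) (simp only: F left_diff_distrib)
  also have "\<dots> = integral {0..l} (\<lambda>t. u' t * v' t) - u' 0 * (v l - v 0)"
    using ftc by (subst Henstock_Kurzweil_Integration.integral_diff)
      (auto intro!: integrable_continuous_real continuous_intros cu' v' simp: integral_unique)
  finally have I: "integral {0..l} (\<lambda>t. integral {0..t} ?g * v' t)
      = integral {0..l} (\<lambda>t. u' t * v' t) - u' 0 * (v l - v 0)" .
  have "integral {0..l} ?g * v l = (u' l - u' 0) * v l"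
    by (subst F) (use l in auto)
  then have "integral {0..l} (\<lambda>t. ?g t * v t) + integral {0..l} (\<lambda>t. u' t * v' t)
      = (u' l - u' 0) * v l + u' 0 * (v l - v 0)"
    using primitive_integration_by_parts[OF l g v v'] I by linarith
  moreover have "(\<integral>x. ?g x * v x \<partial>lebesgue_on {0..l}) = integral {0..l} (\<lambda>t. ?g t * v t)"
    by (rule lebesgue_integral_eq_integral[OF
          square_integrable_on_mult[OF g square_integrable_on_continuous[OF cv]]]) simp
  moreover have "(\<integral>x. u' x * v' x \<partial>lebesgue_on {0..l}) = integral {0..l} (\<lambda>t. u' t * v' t)"
    by (rule lebesgue_integral_eq_integral[OF square_integrable_on_mult[OF
          square_integrable_on_continuous[OF cu'] square_integrable_on_continuous[OF v']]]) simp
  ultimately show ?thesis by (simp add: algebra_simps)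
qed

text \<open>The Kirchhoff condition is absent: for the energy form it is a natural condition,
  produced by Green's formula. Edgewise continuously differentiable functions are enough, since
  trial functions and eigenfunctions are all of this kind. Derivative and vertex values are
  arguments so that they can be referred to without choosing them.\<close>

definition form_domain ::
  "('v, 'e) metric_graph \<Rightarrow> 'e graph_fun \<Rightarrow> 'e graph_fun \<Rightarrow> ('v \<Rightarrow> real) \<Rightarrow> bool" where
  "form_domain G u u' w \<longleftrightarrow>
     (\<forall>e\<in>edges G.
        (\<forall>x\<in>{0..elength G e}. (u e has_real_derivative u' e x) (at x within {0..elength G e})) \<and>
        continuous_on {0..elength G e} (u' e) \<and>
        u e 0 = w (tail (skeleton G) e) \<and> u e (elength G e) = w (head (skeleton G) e)) \<and>
     (\<forall>v\<in>dirichlet G. w v = 0)"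

text \<open>The discrete divergence: \<open>c\<close> holds the values at the head ends and
  \<open>d\<close> those at the tail ends, kept apart because a derivative differs at the two ends
  of an edge.\<close>

definition flux ::
  "('v, 'e) metric_graph \<Rightarrow> ('e \<Rightarrow> real) \<Rightarrow> ('e \<Rightarrow> real) \<Rightarrow> 'v \<Rightarrow> real" where
  "flux G c d v = (\<Sum>e\<in>in_arcs (skeleton G) v. c e) - (\<Sum>e\<in>out_arcs (skeleton G) v. d e)"

lemma kirchhoff_flux:
  "kirchhoff G u' \<longleftrightarrow>
    (\<forall>v\<in>vertices G - dirichlet G. flux G (\<lambda>e. u' e (elength G e)) (\<lambda>e. u' e 0) v = 0)"
  by (simp add: kirchhoff_def flux_def sum_negf)

text \<open>A nonempty edge set is demanded because without edges the inner product vanishes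
  identically and there is no orthonormal sequence; the edgeless graph is treated apart in the
  theorem.\<close>

locale dirichlet_graph =
  fixes G :: "('v, 'e) metric_graph"
  assumes compact: "compact_metric_graph G"
    and connected: "connected_metric_graph G"
    and dirichlet_nonempty: "dirichlet G \<noteq> {}"
    and edges_nonempty: "edges G \<noteq> {}"
begin

abbreviation "len \<equiv> elength G"
abbreviation "source \<equiv> tail (skeleton G)"
abbreviation "target \<equiv> head (skeleton G)"

lemma len_pos: "e \<in> edges G \<Longrightarrow> 0 < len e"
  using compact by (simp add: compact_metric_graph_def)

lemma fin: "fin_digraph (skeleton G)"
  using compact by (simp add: compact_metric_graph_def)

lemma finite_edges [simp, intro]: "finite (edges G)"
  and finite_vertices [simp, intro]: "finite (vertices G)"
  and source_in: "e \<in> edges G \<Longrightarrow> source e \<in> vertices G"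
  and target_in: "e \<in> edges G \<Longrightarrow> target e \<in> vertices G"
proof -
  interpret fin_digraph "skeleton G" by (rule fin)
  show "finite (edges G)" "finite (vertices G)"
    "e \<in> edges G \<Longrightarrow> source e \<in> vertices G" "e \<in> edges G \<Longrightarrow> target e \<in> vertices G" by auto
qed

lemma dirichlet_subset: "dirichlet G \<subseteq> vertices G"
  using compact by (simp add: compact_metric_graph_def)

lemma L2_edge: "f \<in> L2 G \<Longrightarrow> e \<in> edges G \<Longrightarrow> square_integrable_on (len e) (f e)"
  by (simp add: L2_def)

lemma L2_inner_sum: "L2_inner G f g = (\<Sum>e\<in>edges G. \<integral>x. f e x * g e x \<partial>lebesgue_on {0..len e})"
  by (simp add: L2_inner_def graph_integral_def)

lemma L2_semi_inner: "semi_inner_space (L2 G) (L2_inner G)"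
proof
  show "subspace (L2 G)"
    by (auto simp: subspace_def L2_def zero_fun_def plus_fun_def scaleR_fun_def
        square_integrable_on_add square_integrable_on_cmult)
  show "L2_inner G (x + y) z = L2_inner G x z + L2_inner G y z"
    if "x \<in> L2 G" "y \<in> L2 G" "z \<in> L2 G" for x y z
    using that by (simp add: L2_inner_sum distrib_right square_integrable_on_mult[OF L2_edge L2_edge]
        sum.distrib)
  show "L2_inner G (c *\<^sub>R x) y = c * L2_inner G x y" for c x y
    by (simp add: L2_inner_sum mult.assoc sum_distrib_left)
  show "L2_inner G x y = L2_inner G y x" for x y :: "'e graph_fun"
    by (simp add: L2_inner_sum mult.commute)
  show "0 \<le> L2_inner G x x" for x
    by (auto simp: L2_inner_sum intro!: sum_nonneg)
qed

sublocale L2: semi_inner_space "L2 G" "L2_inner G"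
  by (rule L2_semi_inner)

lemma L2_norm_sum: "L2_inner G f f = (\<Sum>e\<in>edges G. \<integral>x. (f e x)\<^sup>2 \<partial>lebesgue_on {0..len e})"
  by (simp add: L2_inner_sum power2_eq_square)

lemma edge_norm_le:
  assumes "e \<in> edges G"
  shows "(\<integral>x. (f e x)\<^sup>2 \<partial>lebesgue_on {0..len e}) \<le> L2_inner G f f"
  unfolding L2_norm_sum using assms by (intro member_le_sum) auto

sublocale L2: complete_semi_inner_space "L2 G" "L2_inner G"
proof
  fix X :: "nat \<Rightarrow> 'e graph_fun"
  assume X: "\<And>n. X n \<in> L2 G"
    and C: "\<And>e. 0 < e \<Longrightarrow> \<exists>N. \<forall>m\<ge>N. \<forall>n\<ge>N. L2_inner G (X m - X n) (X m - X n) < e"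
  have "\<exists>g. square_integrable_on (len e) g \<and>
      (\<lambda>n. \<integral>x. (X n e x - g x)\<^sup>2 \<partial>lebesgue_on {0..len e}) \<longlonglongrightarrow> 0" if e: "e \<in> edges G" for e
  proof -
    interpret finite_measure "lebesgue_on {0..len e}"
      by (rule finite_measure_lebesgue_on) simp
    have "\<exists>N. \<forall>m\<ge>N. \<forall>n\<ge>N. (\<integral>x. (X m e x - X n e x)\<^sup>2 \<partial>lebesgue_on {0..len e}) < \<epsilon>" if "0 < \<epsilon>" for \<epsilon>
    proof -
      have "(\<integral>x. (X m e x - X n e x)\<^sup>2 \<partial>lebesgue_on {0..len e}) \<le> L2_inner G (X m - X n) (X m - X n)" for m n
        using edge_norm_le[OF e, of "X m - X n"] by simp
      then show ?thesis using C[OF that] by (meson le_less_trans)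
    qed
    then obtain g where "g \<in> borel_measurable (lebesgue_on {0..len e})"
        "integrable (lebesgue_on {0..len e}) (\<lambda>x. (g x)\<^sup>2)"
        "(\<lambda>n. \<integral>x. (X n e x - g x)\<^sup>2 \<partial>lebesgue_on {0..len e}) \<longlonglongrightarrow> 0"
      by (rule Riesz_Fischer[of "\<lambda>n. X n e", rotated 2])
         (use L2_edge[OF X e] that in \<open>auto simp: square_integrable_on_def\<close>)
    then show ?thesis unfolding square_integrable_on_def by blast
  qed
  then have "\<exists>g. \<forall>e\<in>edges G. square_integrable_on (len e) (g e) \<and>
      (\<lambda>n. \<integral>x. (X n e x - g e x)\<^sup>2 \<partial>lebesgue_on {0..len e}) \<longlonglongrightarrow> 0"
    by (intro bchoice ballI)
  then obtain g where g: "\<And>e. e \<in> edges G \<Longrightarrow> square_integrable_on (len e) (g e)"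
    "\<And>e. e \<in> edges G \<Longrightarrow> (\<lambda>n. \<integral>x. (X n e x - g e x)\<^sup>2 \<partial>lebesgue_on {0..len e}) \<longlonglongrightarrow> 0"
    by blast
  have "(\<lambda>n. \<Sum>e\<in>edges G. \<integral>x. (X n e x - g e x)\<^sup>2 \<partial>lebesgue_on {0..len e}) \<longlonglongrightarrow> (\<Sum>e\<in>edges G. 0)"
    by (intro tendsto_sum g)
  then have "L2.converges_to X g" by (simp add: L2.converges_to_def L2_norm_sum)
  moreover have "g \<in> L2 G" using g(1) by (simp add: L2_def)
  ultimately show "\<exists>x\<in>L2 G. L2.converges_to X x" by blast
qed

lemma L2_sums_iff:
  assumes "\<And>n. g n \<in> L2 G" "f \<in> L2 G"
  shows "L2_sums G g f \<longleftrightarrow> L2.converges_to (\<lambda>N. \<Sum>n<N. g n) f"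
  using assms by (simp add: L2_sums_def L2.converges_to_def L2_norm_sum graph_integral_def power2_commute)

text \<open>Summation by parts: grouping by heads and by tails meets every edge once at each end. A
  loop is met twice at its vertex, as it should be.\<close>

lemma flux_sum:
  "(\<Sum>v\<in>vertices G. w v * flux G c d v) = (\<Sum>e\<in>edges G. c e * w (target e) - d e * w (source e))"
proof -
  have "(\<Sum>v\<in>vertices G. \<Sum>e\<in>in_arcs (skeleton G) v. w v * c e) = (\<Sum>e\<in>edges G. w (target e) * c e)"
    unfolding in_arcs_def using target_in
    by (subst sum.group[of _ _ target "\<lambda>e. w (target e) * c e", symmetric]) (auto intro!: sum.cong)
  moreover have "(\<Sum>v\<in>vertices G. \<Sum>e\<in>out_arcs (skeleton G) v. w v * d e) = (\<Sum>e\<in>edges G. w (source e) * d e)"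
    unfolding out_arcs_def using source_in
    by (subst sum.group[of _ _ source "\<lambda>e. w (source e) * d e", symmetric]) (auto intro!: sum.cong)
  ultimately show ?thesis
    by (simp add: flux_def right_diff_distrib sum_subtractf sum_distrib_left mult.commute)
qed

lemma form_domain_L2:
  assumes "form_domain G u u' w"
  shows "u \<in> L2 G" "u' \<in> L2 G"
proof -
  have "continuous_on {0..len e} (u e)" if "e \<in> edges G" for e
    using assms that unfolding form_domain_def by (intro DERIV_continuous_on) blast
  then show "u \<in> L2 G" by (simp add: L2_def square_integrable_on_continuous)
  show "u' \<in> L2 G"
    using assms unfolding form_domain_def L2_def by (simp add: square_integrable_on_continuous)
qed

text \<open>The boundary terms of the edges regroup into a sum over the vertices, in which each term
  vanishes: at Dirichlet vertices through \<open>w\<close>, elsewhere through the flux of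
  \<open>u'\<close>.\<close>

lemma Green:
  assumes u: "\<And>e. e \<in> edges G \<Longrightarrow> H2_on (len e) (u e) (u' e) (\<lambda>x. - f e x)"
    and k: "kirchhoff G u'" and v: "form_domain G v v' w"
  shows "L2_inner G f v = L2_inner G u' v'"
proof -
  have "L2_inner G f v = (\<Sum>e\<in>edges G. (\<integral>x. u' e x * v' e x \<partial>lebesgue_on {0..len e})
      - (u' e (len e) * w (target e) - u' e 0 * w (source e)))"
    unfolding L2_inner_sum
  proof (rule sum.cong)
    fix e assume e: "e \<in> edges G"
    then show "(\<integral>x. f e x * v e x \<partial>lebesgue_on {0..len e}) =
        (\<integral>x. u' e x * v' e x \<partial>lebesgue_on {0..len e}) - (u' e (len e) * w (target e) - u' e 0 * w (source e))"
      using H2_on_Green[OF _ u[OF e], of "v e" "v' e"] v len_pos[OF e] by (simp add: form_domain_def)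
  qed simp
  also have "\<dots> = L2_inner G u' v' -
      (\<Sum>v\<in>vertices G. w v * flux G (\<lambda>e. u' e (len e)) (\<lambda>e. u' e 0) v)"
    by (simp add: flux_sum sum_subtractf L2_inner_sum)
  also have "(\<Sum>v\<in>vertices G. w v * flux G (\<lambda>e. u' e (len e)) (\<lambda>e. u' e 0) v) = 0"
  proof (rule sum.neutral, rule ballI)
    fix x assume "x \<in> vertices G"
    then show "w x * flux G (\<lambda>e. u' e (len e)) (\<lambda>e. u' e 0) x = 0"
      using k v by (cases "x \<in> dirichlet G") (auto simp: kirchhoff_flux form_domain_def)
  qed
  finally show ?thesis by simp
qed

lemma laplacianE:
  assumes "laplacian G u f"
  obtains u' w where "form_domain G u u' w" "kirchhoff G u'" "f \<in> L2 G"
    "\<And>e. e \<in> edges G \<Longrightarrow> H2_on (len e) (u e) (u' e) (\<lambda>x. - f e x)"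
    "\<And>v v' z. form_domain G v v' z \<Longrightarrow> L2_inner G f v = L2_inner G u' v'"
proof -
  obtain u' w where u': "\<And>e. e \<in> edges G \<Longrightarrow> H2_on (len e) (u e) (u' e) (\<lambda>x. - f e x)"
    and w: "\<And>e. e \<in> edges G \<Longrightarrow> u e 0 = w (source e) \<and> u e (len e) = w (target e)"
      "\<And>v. v \<in> dirichlet G \<Longrightarrow> w v = 0" and k: "kirchhoff G u'"
    using assms unfolding laplacian_def continuous_at_vertices_def by blast
  have fd: "form_domain G u u' w"
    unfolding form_domain_def
    using H2_on_continuous_derivative[OF u'] H2_on_has_derivative[OF u'] w by blast
  moreover have "f \<in> L2 G"
    using square_integrable_on_minus[OF H2_on_square_integrable[OF u']] by (simp add: L2_def)
  ultimately show ?thesis using that k u' Green[OF u' k] by blast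
qed

section \<open>Hoelder and Poincare estimates in terms of the energy\<close>

lemma form_domain_edge_Holder:
  assumes fd: "form_domain G u u' w" and e: "e \<in> edges G" and xy: "0 \<le> x" "x \<le> y" "y \<le> len e"
  shows "\<bar>u e y - u e x\<bar> \<le> sqrt (y - x) * sqrt (L2_inner G u' u')"
proof -
  have s: "square_integrable_on (len e) (u' e)" using form_domain_L2(2)[OF fd] e by (simp add: L2_def)
  have d: "(u e has_real_derivative u' e t) (at t within {0..len e})" if "t \<in> {0..len e}" for t
    using fd e that by (simp add: form_domain_def)
  have ftc: "(u' e has_integral (u e b - u e 0)) {0..b}" if "0 \<le> b" "b \<le> len e" for b
    using that by (intro fundamental_theorem_of_calculus)
      (auto simp flip: has_real_derivative_iff_has_vector_derivative
            intro: has_field_derivative_subset[OF d])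
  have "u e y - u e x = integral {0..y} (u' e) - integral {0..x} (u' e)"
    using ftc[of x] ftc[of y] xy by (simp add: integral_unique)
  also have "\<bar>\<dots>\<bar> \<le> sqrt (y - x) * sqrt (\<integral>t. (u' e t)\<^sup>2 \<partial>lebesgue_on {0..len e})"
    by (rule primitive_abs_le[OF s xy])
  also have "\<dots> \<le> sqrt (y - x) * sqrt (L2_inner G u' u')"
    using edge_norm_le[OF e] xy by (intro mult_left_mono) auto
  finally show ?thesis .
qed

text \<open>Propagate the bound from a Dirichlet vertex along paths.\<close>

lemma vertex_bound:
  assumes "v \<in> vertices G"
  shows "\<exists>C. \<forall>u u' w. form_domain G u u' w \<longrightarrow> \<bar>w v\<bar> \<le> C * sqrt (L2_inner G u' u')"
proof -
  obtain a where a: "a \<in> dirichlet G" using dirichlet_nonempty by blast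
  let ?S = "with_proj (mk_symmetric (skeleton G))"
  let ?P = "\<lambda>v. \<exists>C. \<forall>u u' w. form_domain G u u' w \<longrightarrow> \<bar>w v\<bar> \<le> C * sqrt (L2_inner G u' u')"
  have adj: "?P y" if xy: "(x, y) \<in> arcs_ends ?S" and Px: "?P x" for x y
  proof -
    obtain C where C: "\<And>u u' w. form_domain G u u' w \<Longrightarrow> \<bar>w x\<bar> \<le> C * sqrt (L2_inner G u' u')"
      using Px by blast
    obtain e where e: "e \<in> edges G" "(x = source e \<and> y = target e) \<or> (y = source e \<and> x = target e)"
      using xy by (auto simp: mk_symmetric_def arcs_ends_def arc_to_ends_def)
    have "\<bar>w y\<bar> \<le> (C + sqrt (len e)) * sqrt (L2_inner G u' u')" if fd: "form_domain G u u' w" for u u' w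
    proof -
      have "\<bar>w (target e) - w (source e)\<bar> \<le> sqrt (len e) * sqrt (L2_inner G u' u')"
        using form_domain_edge_Holder[OF fd e(1), of 0 "len e"] fd e(1) len_pos[OF e(1)]
        by (simp add: form_domain_def)
      then show ?thesis using C[OF fd] e(2) by (auto simp: distrib_right)
    qed
    then show ?thesis by blast
  qed
  have "a \<rightarrow>\<^sup>*\<^bsub>?S\<^esub> v"
    using connected a assms dirichlet_subset
    by (auto simp: connected_metric_graph_def connected_def strongly_connected_def mk_symmetric_def)
  then have "(a, v) \<in> (arcs_ends ?S)\<^sup>*" by (rule reachable_rtranclI)
  then show "?P v"
  proof (induction rule: rtrancl_induct)
    case base
    show ?case using a by (intro exI[of _ 0]) (auto simp: form_domain_def)
  next
    case (step y z)
    then show ?case using adj by blast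
  qed
qed

lemma Poincare_pointwise:
  obtains C where "0 < C" "\<And>u u' w e x. \<lbrakk>form_domain G u u' w; e \<in> edges G; x \<in> {0..len e}\<rbrakk>
      \<Longrightarrow> \<bar>u e x\<bar> \<le> C * sqrt (L2_inner G u' u')"
proof -
  obtain c where c: "\<And>v u u' w. v \<in> vertices G \<Longrightarrow> form_domain G u u' w \<Longrightarrow>
      \<bar>w v\<bar> \<le> c v * sqrt (L2_inner G u' u')"
    using vertex_bound by metis
  define C where "C = 1 + (\<Sum>v\<in>vertices G. \<bar>c v\<bar>) + (\<Sum>e\<in>edges G. sqrt (len e))"
  have "0 < C"
    unfolding C_def using len_pos
    by (intro add_pos_nonneg) (auto intro!: sum_nonneg intro: less_imp_le)
  moreover have "\<bar>u e x\<bar> \<le> C * sqrt (L2_inner G u' u')"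
    if fd: "form_domain G u u' w" and e: "e \<in> edges G" and x: "x \<in> {0..len e}" for u u' w e x
  proof -
    have N: "0 \<le> L2_inner G u' u'" by (auto simp: L2_norm_sum intro!: sum_nonneg)
    have "\<bar>u e x - u e 0\<bar> \<le> sqrt x * sqrt (L2_inner G u' u')"
      using form_domain_edge_Holder[OF fd e, of 0 x] x by simp
    also have "\<dots> \<le> sqrt (len e) * sqrt (L2_inner G u' u')"
      using x N by (intro mult_right_mono) auto
    finally have "\<bar>u e x\<bar> \<le> (c (source e) + sqrt (len e)) * sqrt (L2_inner G u' u')"
      using c[OF source_in[OF e] fd] fd e by (simp add: form_domain_def distrib_right)
    also have "\<dots> \<le> C * sqrt (L2_inner G u' u')"
    proof (rule mult_right_mono)
      have "\<bar>c (source e)\<bar> \<le> (\<Sum>v\<in>vertices G. \<bar>c v\<bar>)"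
        using source_in[OF e] by (intro member_le_sum) auto
      moreover have "sqrt (len e) \<le> (\<Sum>e\<in>edges G. sqrt (len e))"
        using e len_pos by (intro member_le_sum) (auto intro: less_imp_le)
      ultimately show "c (source e) + sqrt (len e) \<le> C" by (simp add: C_def)
    qed (use N in simp)
    finally show ?thesis .
  qed
  ultimately show ?thesis using that by blast
qed

text \<open>The Poincare bound makes \<open>u\<close> vanish. As \<open>u'\<close> is a derivative
  at every point, it vanishes everywhere and not only almost everywhere, which lets
  \<open>green_definite\<close> evaluate it at single points.\<close>

lemma form_domain_energy_zero:
  assumes fd: "form_domain G u u' w" and z: "L2_inner G u' u' = 0"
  shows "v \<in> vertices G \<Longrightarrow> w v = 0"
    and "\<lbrakk>e \<in> edges G; x \<in> {0..len e}\<rbrakk> \<Longrightarrow> u e x = 0"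
    and "\<lbrakk>e \<in> edges G; x \<in> {0..len e}\<rbrakk> \<Longrightarrow> u' e x = 0"
proof -
  show "w v = 0" if "v \<in> vertices G" using vertex_bound[OF that] fd z by fastforce
  show u: "u e x = 0" if "e \<in> edges G" "x \<in> {0..len e}" for e x
    using Poincare_pointwise fd that z by (metis abs_le_zero_iff mult_zero_right real_sqrt_zero)
  show "u' e x = 0" if e: "e \<in> edges G" and x: "x \<in> {0..len e}"
  proof -
    have "(u e has_real_derivative u' e x) (at x within {0..len e})"
      using fd e x by (simp add: form_domain_def)
    moreover have "(u e has_vector_derivative 0) (at x within {0..len e})"
      by (rule has_vector_derivative_transform[OF x _ has_vector_derivative_const[of 0]]) (use u[OF e] in auto)
    ultimately show ?thesis
      using vector_derivative_unique_within_closed_interval[of 0 "len e" x "u e" "u' e x" 0] x len_pos[OF e]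
      by (simp add: has_real_derivative_iff_has_vector_derivative)
  qed
qed

lemma Poincare:
  obtains C where "0 < C" "\<And>u u' w. form_domain G u u' w \<Longrightarrow> L2_inner G u u \<le> C * L2_inner G u' u'"
proof -
  obtain c where c: "0 < c" "\<And>u u' w e x. \<lbrakk>form_domain G u u' w; e \<in> edges G; x \<in> {0..len e}\<rbrakk>
      \<Longrightarrow> \<bar>u e x\<bar> \<le> c * sqrt (L2_inner G u' u')"
    using Poincare_pointwise by blast
  have "L2_inner G u u \<le> (c\<^sup>2 * total_length G) * L2_inner G u' u'" if fd: "form_domain G u u' w" for u u' w
  proof -
    have N: "0 \<le> L2_inner G u' u'" by (auto simp: L2_norm_sum intro!: sum_nonneg)
    have "L2_inner G u u \<le> (\<Sum>e\<in>edges G. c\<^sup>2 * L2_inner G u' u' * len e)"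
      unfolding L2_norm_sum[of u]
    proof (rule sum_mono)
      fix e assume e: "e \<in> edges G"
      have s: "square_integrable_on (len e) (u e)" using form_domain_L2(1)[OF fd] e by (simp add: L2_def)
      have "(u e x)\<^sup>2 \<le> c\<^sup>2 * L2_inner G u' u'" if "x \<in> {0..len e}" for x
        using power_mono[OF c(2)[OF fd e that], of 2] N by (simp add: power_mult_distrib)
      then have "(\<integral>x. (u e x)\<^sup>2 \<partial>lebesgue_on {0..len e}) \<le> (\<integral>x. c\<^sup>2 * L2_inner G u' u' \<partial>lebesgue_on {0..len e})"
        using s square_integrable_on_integrable[OF square_integrable_on_const]
        by (intro integral_mono) (auto simp: square_integrable_on_def)
      also have "\<dots> = c\<^sup>2 * L2_inner G u' u' * len e"
        using len_pos[OF e] by (simp add: measure_restrict_space)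
      finally show "(\<integral>x. (u e x)\<^sup>2 \<partial>lebesgue_on {0..len e}) \<le> c\<^sup>2 * L2_inner G u' u' * len e" .
    qed
    then show ?thesis by (simp add: total_length_def sum_distrib_left sum_distrib_right mult_ac)
  qed
  moreover have "0 < c\<^sup>2 * total_length G"
    using c(1) len_pos edges_nonempty by (auto simp: total_length_def intro!: mult_pos_pos sum_pos)
  ultimately show ?thesis using that by blast
qed

end

section \<open>Existence of an orthonormal basis of eigenfunctions\<close>

context dirichlet_graph
begin

section \<open>The Poisson equation, reduced to the vertex values\<close>

definition slope :: "('v \<Rightarrow> real) \<Rightarrow> 'e \<Rightarrow> real" where
  "slope w e = (w (target e) - w (source e)) / len e"

text \<open>The edgewise affine interpolation of vertex values, that is, the functions that are
  harmonic inside every edge.\<close>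

definition hat :: "('v \<Rightarrow> real) \<Rightarrow> 'e graph_fun" where
  "hat w e x = w (source e) + slope w e * x"

text \<open>The positive graph Laplacian with conductances \<open>1 / len e\<close>.\<close>

abbreviation "slope_flux w \<equiv> flux G (slope w) (slope w)"

lemma hat_form_domain:
  assumes "\<And>v. v \<in> dirichlet G \<Longrightarrow> w v = 0"
  shows "form_domain G (hat w) (\<lambda>e x. slope w e) w"
  unfolding form_domain_def
proof (intro conjI ballI)
  fix e assume e: "e \<in> edges G"
  show "hat w e 0 = w (source e)" by (simp add: hat_def)
  show "hat w e (len e) = w (target e)" using len_pos[OF e] by (simp add: hat_def slope_def)
  show "(hat w e has_real_derivative slope w e) (at x within {0..len e})" for x
    unfolding hat_def[abs_def] by (auto intro!: derivative_eq_intros)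
qed (use assms in auto)

lemma slope_flux_sum:
  "(\<Sum>v\<in>vertices G. z v * slope_flux w v) = (\<Sum>e\<in>edges G. len e * slope w e * slope z e)"
  unfolding flux_sum by (intro sum.cong) (auto simp: slope_def field_simps dest: len_pos)

lemma slope_energy: "L2_inner G (\<lambda>e x. slope w e) (\<lambda>e x. slope z e) = (\<Sum>e\<in>edges G. len e * slope w e * slope z e)"
  unfolding L2_inner_sum
  by (intro sum.cong) (auto simp: measure_restrict_space dest: len_pos)

text \<open>The discrete energy of \<open>q\<close> is the energy of its affine interpolant, so
  definiteness is inherited from the Poincare estimate on the metric graph.\<close>

lemma slope_flux_definite:
  assumes q: "\<And>v. v \<in> dirichlet G \<Longrightarrow> q v = 0" and x: "x \<in> vertices G" "q x \<noteq> 0"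
  shows "0 < (\<Sum>v\<in>vertices G. q v * slope_flux q v)"
proof -
  let ?E = "L2_inner G (\<lambda>e x. slope q e) (\<lambda>e x. slope q e)"
  have "form_domain G (hat q) (\<lambda>e x. slope q e) q" using q by (rule hat_form_domain)
  from form_domain_energy_zero(1)[OF this _ x(1)] x(2) have "?E \<noteq> 0" by blast
  moreover have "0 \<le> ?E" by (auto simp: L2_norm_sum intro!: sum_nonneg)
  ultimately show ?thesis by (simp add: slope_flux_sum slope_energy)
qed

lemma slope_flux_lin: "slope_flux (\<lambda>v. w v + c * z v) x = slope_flux w x + c * slope_flux z x"
proof -
  have "slope (\<lambda>v. w v + c * z v) = (\<lambda>e. slope w e + c * slope z e)"
    by (auto simp: slope_def fun_eq_iff add_divide_distrib diff_divide_distrib algebra_simps)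
  then show ?thesis by (simp add: flux_def sum.distrib sum_distrib_left algebra_simps)
qed

text \<open>Gram--Schmidt: the potential \<open>q\<close> below is orthogonal, in energy, to the potentials supported on \<open>S\<close>.\<close>

lemma slope_flux_solvable:
  assumes "finite S" "S \<subseteq> vertices G - dirichlet G"
  shows "\<exists>w. (\<forall>v. v \<notin> S \<longrightarrow> w v = 0) \<and> (\<forall>v\<in>S. slope_flux w v = b v)"
  using assms
proof (induction S arbitrary: b rule: finite_induct)
  case empty
  show ?case by (intro exI[of _ "\<lambda>_. 0"]) simp
next
  case (insert x S)
  define \<delta> where "\<delta> v = (if v = x then 1 else 0 :: real)" for v
  obtain p where p: "\<And>v. v \<notin> S \<Longrightarrow> p v = 0" "\<And>v. v \<in> S \<Longrightarrow> slope_flux p v = slope_flux \<delta> v"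
    using insert.IH[of "slope_flux \<delta>"] insert.prems by blast
  obtain w where w: "\<And>v. v \<notin> S \<Longrightarrow> w v = 0" "\<And>v. v \<in> S \<Longrightarrow> slope_flux w v = b v"
    using insert.IH[of b] insert.prems by blast
  define q where "q v = \<delta> v + (-1) * p v" for v
  have qx: "q x = 1" using p(1) insert.hyps by (simp add: q_def \<delta>_def)
  have q0: "q v = 0" if "v \<notin> insert x S" for v using that p(1) by (auto simp: q_def \<delta>_def)
  have qS: "slope_flux q v = 0" if "v \<in> S" for v
    using p(2)[OF that] slope_flux_lin[of \<delta> "-1" p v] by (simp add: q_def[abs_def])
  have "0 < (\<Sum>v\<in>vertices G. q v * slope_flux q v)"
  proof (rule slope_flux_definite)
    show "q v = 0" if "v \<in> dirichlet G" for v using q0[of v] that insert.prems by blast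
    show "x \<in> vertices G" "q x \<noteq> 0" using insert.prems qx by auto
  qed
  \<comment> \<open>\<open>q\<close> vanishes off \<open>insert x S\<close> and its flux vanishes on
    \<open>S\<close>, so only the term at \<open>x\<close> survives.\<close>
  also have "\<dots> = (\<Sum>v\<in>{x}. q v * slope_flux q v)"
    using q0 qS insert.prems by (intro sum.mono_neutral_right) auto
  finally have pos: "0 < slope_flux q x" using qx by simp
  \<comment> \<open>Since \<open>q\<close> has no flux on \<open>S\<close>, adding this multiple
    corrects the flux at \<open>x\<close> without disturbing the values already attained.\<close>
  define c where "c = (b x - slope_flux w x) / slope_flux q x"
  have "slope_flux (\<lambda>v. w v + c * q v) v = b v" if "v \<in> insert x S" for v
    using that w(2) qS pos slope_flux_lin[of w c q v] by (auto simp: c_def)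
  moreover have "w v + c * q v = 0" if "v \<notin> insert x S" for v
    using that w(1) q0 by auto
  ultimately show ?case by (intro exI[of _ "\<lambda>v. w v + c * q v"]) blast
qed

text \<open>On each edge the equation is solved by integrating twice with zero end values. This
  solution is continuous at the vertices but violates the Kirchhoff condition; an affine
  interpolant, which does not change the second derivative, is added to cancel its flux.\<close>

lemma laplacian_solvable:
  assumes f: "f \<in> L2 G"
  shows "\<exists>u. laplacian G u f"
proof -
  define F where "F e x = integral {0..x} (f e)" for e x
  define F2 where "F2 e x = integral {0..x} (F e)" for e x
  \<comment> \<open>Chosen so that \<open>s e * x - F2 e x\<close> vanishes at \<open>len e\<close>
    as well as at 0.\<close>
  define s where "s e = F2 e (len e) / len e" for e
  have sq: "square_integrable_on (len e) (f e)" if "e \<in> edges G" for e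
    using f that by (rule L2_edge)
  have cF: "continuous_on {0..len e} (F e)" if "e \<in> edges G" for e
    unfolding F_def[abs_def] by (rule primitive_continuous[OF sq[OF that]])
  have dF2: "(F2 e has_real_derivative F e x) (at x within {0..len e})"
    if "e \<in> edges G" "x \<in> {0..len e}" for e x
    unfolding F2_def[abs_def] using integral_has_real_derivative[OF cF[OF that(1)] that(2)] .
  define u0' where "u0' e x = s e - F e x" for e x
  obtain w where w: "\<And>v. v \<notin> vertices G - dirichlet G \<Longrightarrow> w v = 0"
    "\<And>v. v \<in> vertices G - dirichlet G \<Longrightarrow> slope_flux w v = - flux G (\<lambda>e. u0' e (len e)) (\<lambda>e. u0' e 0) v"
    using slope_flux_solvable[of "vertices G - dirichlet G" "\<lambda>v. - flux G (\<lambda>e. u0' e (len e)) (\<lambda>e. u0' e 0) v"]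
    by auto
  define u where "u e x = hat w e x + s e * x - F2 e x" for e x
  define u' where "u' e x = slope w e + u0' e x" for e x
  have "H2_on (len e) (u e) (u' e) (\<lambda>x. - f e x)" if e: "e \<in> edges G" for e
    unfolding H2_on_def
  proof (intro conjI ballI)
    fix x assume x: "x \<in> {0..len e}"
    show "(u e has_real_derivative u' e x) (at x within {0..len e})"
      unfolding u_def[abs_def] u'_def hat_def u0'_def
      using dF2[OF e x] by (auto intro!: derivative_eq_intros)
    have m: "integrable (lebesgue_on {0..len e}) (\<lambda>x. - f e x)"
      by (rule square_integrable_on_integrable[OF square_integrable_on_minus[OF sq[OF e]]])
    show "u' e x = u' e 0 + (\<integral>x. - f e x \<partial>lebesgue_on {0..x})"
      unfolding lebesgue_on_primitive[OF m x] by (simp add: u'_def u0'_def F_def)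
  qed (rule square_integrable_on_minus[OF sq[OF e]])
  moreover have "continuous_at_vertices G u"
    unfolding continuous_at_vertices_def
  proof (intro exI[of _ w] conjI ballI)
    fix e assume e: "e \<in> edges G"
    show "u e 0 = w (source e)" by (simp add: u_def hat_def F2_def)
    show "u e (len e) = w (target e)"
      using len_pos[OF e] by (simp add: u_def hat_def s_def slope_def)
  qed (use w(1) in blast)
  moreover have "kirchhoff G u'"
    unfolding kirchhoff_flux
  proof
    fix v assume v: "v \<in> vertices G - dirichlet G"
    have "flux G (\<lambda>e. u' e (len e)) (\<lambda>e. u' e 0) v = slope_flux w v + flux G (\<lambda>e. u0' e (len e)) (\<lambda>e. u0' e 0) v"
      by (simp add: flux_def u'_def sum.distrib)
    then show "flux G (\<lambda>e. u' e (len e)) (\<lambda>e. u' e 0) v = 0" using w(2)[OF v] by simp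
  qed
  ultimately show ?thesis unfolding laplacian_def by blast
qed

lemma H2_on_lin:
  assumes u: "H2_on l u u' f" and v: "H2_on l v v' g"
  shows "H2_on l (\<lambda>x. u x + c * v x) (\<lambda>x. u' x + c * v' x) (\<lambda>x. f x + c * g x)"
  unfolding H2_on_def
proof (intro conjI ballI)
  note sq = H2_on_square_integrable[OF u] H2_on_square_integrable[OF v]
  note sum = square_integrable_on_add[OF sq(1) square_integrable_on_cmult[OF sq(2)], of c]
  show "square_integrable_on l (\<lambda>x. f x + c * g x)" by (rule sum)
  fix x assume x: "x \<in> {0..l}"
  show "((\<lambda>x. u x + c * v x) has_real_derivative u' x + c * v' x) (at x within {0..l})"
    using H2_on_has_derivative[OF u x] H2_on_has_derivative[OF v x] by (auto intro!: derivative_eq_intros)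
  have i: "h integrable_on {0..x}" if "square_integrable_on l h" for h
    using set_lebesgue_integral_eq_integral(1)[OF integrable_lebesgue_on_imp_absolutely_integrable[OF
          square_integrable_on_integrable[OF that]]] x
    by (auto intro: integrable_on_subinterval)
  have "integral {0..x} (\<lambda>x. f x + c * g x) = integral {0..x} f + c * integral {0..x} g"
    using i[OF sq(1)] i[OF sq(2)]
    by (subst Henstock_Kurzweil_Integration.integral_add) (auto intro: integrable_on_mult_right)
  then show "u' x + c * v' x = u' 0 + c * v' 0 + integral\<^sup>L (lebesgue_on {0..x}) (\<lambda>x. f x + c * g x)"
    unfolding lebesgue_on_primitive[OF square_integrable_on_integrable[OF sum] x]
    using H2_on_primitive[OF u x] H2_on_primitive[OF v x] by (simp only: algebra_simps)
qed

lemma laplacian_lin: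
  assumes u: "laplacian G u f" and v: "laplacian G v g"
  shows "laplacian G (u + c *\<^sub>R v) (f + c *\<^sub>R g)"
proof -
  obtain u' w where u': "\<And>e. e \<in> edges G \<Longrightarrow> H2_on (len e) (u e) (u' e) (\<lambda>x. - f e x)"
    "form_domain G u u' w" "kirchhoff G u'" by (rule laplacianE[OF u]) (rule that)
  obtain v' z where v': "\<And>e. e \<in> edges G \<Longrightarrow> H2_on (len e) (v e) (v' e) (\<lambda>x. - g e x)"
    "form_domain G v v' z" "kirchhoff G v'" by (rule laplacianE[OF v]) (rule that)
  show ?thesis
    unfolding laplacian_def
  proof (intro exI[of _ "u' + c *\<^sub>R v'"] conjI ballI)
    fix e assume e: "e \<in> edges G"
    show "H2_on (len e) ((u + c *\<^sub>R v) e) ((u' + c *\<^sub>R v') e) (\<lambda>x. - (f + c *\<^sub>R g) e x)"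
      using H2_on_lin[OF u'(1)[OF e] v'(1)[OF e], of c]
      by (simp add: plus_fun_def scaleR_fun_def algebra_simps)
  next
    show "continuous_at_vertices G (u + c *\<^sub>R v)"
      using u'(2) v'(2) unfolding form_domain_def continuous_at_vertices_def
      by (intro exI[of _ "\<lambda>x. w x + c * z x"]) auto
    have "flux G (\<lambda>e. (u' + c *\<^sub>R v') e (len e)) (\<lambda>e. (u' + c *\<^sub>R v') e 0) x =
        flux G (\<lambda>e. u' e (len e)) (\<lambda>e. u' e 0) x + c * flux G (\<lambda>e. v' e (len e)) (\<lambda>e. v' e 0) x" for x
      by (simp add: flux_def sum.distrib sum_distrib_left algebra_simps)
    then show "kirchhoff G (u' + c *\<^sub>R v')"
      using u'(3) v'(3) by (simp add: kirchhoff_flux)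
  qed
qed

lemma laplacian_zero: "laplacian G 0 0"
  unfolding laplacian_def
proof (intro exI[of _ 0] conjI ballI)
  show "continuous_at_vertices G 0"
    unfolding continuous_at_vertices_def by (intro exI[of _ "\<lambda>_. 0"]) simp
qed (auto simp: H2_on_def kirchhoff_def zero_fun_def)

lemma laplacian_scale: "laplacian G u f \<Longrightarrow> laplacian G (c *\<^sub>R u) (c *\<^sub>R f)"
  using laplacian_lin[OF laplacian_zero, of u f c] by simp

lemma laplacian_cong:
  assumes u: "laplacian G u f" and eq: "\<And>e x. \<lbrakk>e \<in> edges G; x \<in> {0..len e}\<rbrakk> \<Longrightarrow> v e x = u e x"
  shows "laplacian G v f"
proof -
  obtain u' w where u': "\<And>e. e \<in> edges G \<Longrightarrow> H2_on (len e) (u e) (u' e) (\<lambda>x. - f e x)"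
    "form_domain G u u' w" "kirchhoff G u'" by (rule laplacianE[OF u]) (rule that)
  have "H2_on (len e) (v e) (u' e) (\<lambda>x. - f e x)" if e: "e \<in> edges G" for e
  proof -
    have "(v e has_real_derivative u' e x) (at x within {0..len e})" if x: "x \<in> {0..len e}" for x
      using H2_on_has_derivative[OF u'(1)[OF e] x] unfolding has_real_derivative_iff_has_vector_derivative
      by (intro has_vector_derivative_transform[OF x eq[OF e]])
    then show ?thesis using u'(1)[OF e] unfolding H2_on_def by blast
  qed
  moreover have "v e 0 = w (source e) \<and> v e (len e) = w (target e)" if e: "e \<in> edges G" for e
    using u'(2) eq[OF e, of 0] eq[OF e, of "len e"] len_pos[OF e] e by (simp add: form_domain_def)
  then have "continuous_at_vertices G v"
    using u'(2) unfolding form_domain_def continuous_at_vertices_def by blast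
  ultimately show ?thesis using u'(3) unfolding laplacian_def by blast
qed

text \<open>The right-hand side enters \<open>laplacian\<close> only through its square
  integrability and its primitives, hence only modulo null functions. This is what later turns an
  eigenvalue equation modulo null vectors into an exact one.\<close>

lemma laplacian_null_cong:
  assumes u: "laplacian G u f" and g: "g \<in> L2 G" and null: "L2_inner G (f - g) (f - g) = 0"
  shows "laplacian G u g"
proof -
  obtain u' w where u': "\<And>e. e \<in> edges G \<Longrightarrow> H2_on (len e) (u e) (u' e) (\<lambda>x. - f e x)"
    "form_domain G u u' w" "kirchhoff G u'" "f \<in> L2 G" by (rule laplacianE[OF u]) (rule that)
  have "H2_on (len e) (u e) (u' e) (\<lambda>x. - g e x)" if e: "e \<in> edges G" for e
  proof -
    have fi: "square_integrable_on (len e) (f e)" and gi: "square_integrable_on (len e) (g e)"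
      using u'(4) g e by (auto simp: L2_def)
    have fg: "square_integrable_on (len e) (\<lambda>x. f e x - g e x)"
      using square_integrable_on_add[OF fi square_integrable_on_minus[OF gi]] by simp
    have "(\<integral>x. (f e x - g e x)\<^sup>2 \<partial>lebesgue_on {0..len e}) \<le> 0"
      using edge_norm_le[OF e, of "f - g"] null by simp
    moreover have "0 \<le> (\<integral>x. (f e x - g e x)\<^sup>2 \<partial>lebesgue_on {0..len e})" by simp
    ultimately have "(\<integral>x. (f e x - g e x)\<^sup>2 \<partial>lebesgue_on {0..len e}) = 0" by linarith
    then have ae: "AE x in lebesgue_on {0..len e}. f e x = g e x"
      using fg by (subst (asm) integral_nonneg_eq_0_iff_AE) (auto simp: square_integrable_on_def)
    show ?thesis
      unfolding H2_on_def
    proof (intro conjI ballI)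
      show "square_integrable_on (len e) (\<lambda>x. - g e x)" by (rule square_integrable_on_minus[OF gi])
      fix x assume x: "x \<in> {0..len e}"
      show "(u e has_real_derivative u' e x) (at x within {0..len e})"
        using H2_on_has_derivative[OF u'(1)[OF e] x] .
      have "AE t in lebesgue. t \<in> {0..len e} \<longrightarrow> f e t = g e t"
        using ae by (subst (asm) AE_restrict_space_iff) auto
      then have "AE t in lebesgue. t \<in> {0..x} \<longrightarrow> f e t = g e t"
        by eventually_elim (use x in auto)
      then have "AE t in lebesgue_on {0..x}. f e t = g e t"
        by (subst AE_restrict_space_iff) auto
      then have "AE t in lebesgue_on {0..x}. - g e t = - f e t" by eventually_elim simp
      moreover have "integrable (lebesgue_on {0..x}) h" if "square_integrable_on (len e) h" for h
        using set_integrable_subset[OF integrable_lebesgue_on_imp_absolutely_integrable[OF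
              square_integrable_on_integrable[OF that]], of "{0..x}"] x
        by (auto simp: set_integrable_def integrable_restrict_space)
      ultimately have "(\<integral>t. - g e t \<partial>lebesgue_on {0..x}) = (\<integral>t. - f e t \<partial>lebesgue_on {0..x})"
        using fi gi by (intro integral_cong_AE) auto
      then show "u' e x = u' e 0 + (\<integral>t. - g e t \<partial>lebesgue_on {0..x})"
        using u'(1)[OF e] x unfolding H2_on_def by metis
    qed
  qed
  then show ?thesis
    using u'(2,3) unfolding laplacian_def form_domain_def continuous_at_vertices_def by blast
qed

section \<open>The Green operator\<close>

text \<open>The equation leaves values off the edges free. Fixing them to be 0 makes the solution
  unique as a function, so that \<open>green\<close> is linear exactly and not only modulo
  irrelevant values.\<close>

definition supported :: "'e graph_fun \<Rightarrow> bool" where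
  "supported u \<longleftrightarrow> (\<forall>e x. \<not> (e \<in> edges G \<and> x \<in> {0..len e}) \<longrightarrow> u e x = 0)"

definition green :: "'e graph_fun \<Rightarrow> 'e graph_fun" where
  "green f = (SOME u. laplacian G u f \<and> supported u)"

lemma laplacian_unique:
  assumes "laplacian G u f" "laplacian G v f" "supported u" "supported v"
  shows "u = v"
proof -
  have "laplacian G (u + (-1) *\<^sub>R v) (f + (-1) *\<^sub>R f)" by (rule laplacian_lin[OF assms(1,2)])
  then have "laplacian G (u - v) 0" by simp
  then obtain d' w where d: "form_domain G (u - v) d' w"
      "\<And>h h' z. form_domain G h h' z \<Longrightarrow> L2_inner G 0 h = L2_inner G d' h'"
    by (rule laplacianE) (rule that)
  have "L2_inner G d' d' = 0" using d(2)[OF d(1)] form_domain_L2(1)[OF d(1)] by simp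
  from form_domain_energy_zero(2)[OF d(1) this]
  have "u e x = v e x" if "e \<in> edges G" "x \<in> {0..len e}" for e x using that by fastforce
  then show ?thesis using assms(3,4) by (auto simp: supported_def fun_eq_iff) metis
qed

lemma green:
  assumes "f \<in> L2 G"
  shows "laplacian G (green f) f" "supported (green f)"
proof -
  obtain u where u: "laplacian G u f" using laplacian_solvable[OF assms] by blast
  let ?v = "\<lambda>e x. if e \<in> edges G \<and> x \<in> {0..len e} then u e x else 0"
  have "laplacian G ?v f \<and> supported ?v"
    using laplacian_cong[OF u, of ?v] by (simp add: supported_def)
  then have "\<exists>u. laplacian G u f \<and> supported u" by blast
  from someI_ex[OF this] have "laplacian G (green f) f \<and> supported (green f)" by (simp add: green_def)
  then show "laplacian G (green f) f" "supported (green f)" by auto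
qed

lemma greenE:
  assumes "f \<in> L2 G"
  obtains u' w where "form_domain G (green f) u' w"
    "\<And>v v' z. form_domain G v v' z \<Longrightarrow> L2_inner G f v = L2_inner G u' v'"
    "\<And>e. e \<in> edges G \<Longrightarrow> H2_on (len e) (green f e) (u' e) (\<lambda>x. - f e x)"
  by (rule laplacianE[OF green(1)[OF assms]]) (rule that)

lemma green_mem: "f \<in> L2 G \<Longrightarrow> green f \<in> L2 G"
  by (erule greenE) (rule form_domain_L2(1))

lemma green_lin:
  assumes "f \<in> L2 G" "g \<in> L2 G"
  shows "green (f + c *\<^sub>R g) = green f + c *\<^sub>R green g"
proof (rule laplacian_unique)
  show "laplacian G (green (f + c *\<^sub>R g)) (f + c *\<^sub>R g)" "supported (green (f + c *\<^sub>R g))"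
    using assms green by auto
  show "laplacian G (green f + c *\<^sub>R green g) (f + c *\<^sub>R g)"
    by (rule laplacian_lin[OF green(1)[OF assms(1)] green(1)[OF assms(2)]])
  show "supported (green f + c *\<^sub>R green g)"
    using green(2)[OF assms(1)] green(2)[OF assms(2)] by (auto simp: supported_def)
qed

text \<open>Both sides are the energy inner product of the two solutions.\<close>

lemma green_sym:
  assumes "f \<in> L2 G" "g \<in> L2 G"
  shows "L2_inner G (green f) g = L2_inner G f (green g)"
proof -
  obtain u' w where u: "form_domain G (green f) u' w"
    "\<And>v v' z. form_domain G v v' z \<Longrightarrow> L2_inner G f v = L2_inner G u' v'"
    by (rule greenE[OF assms(1)]) (rule that)
  obtain v' z where v: "form_domain G (green g) v' z"
    "\<And>u u' w. form_domain G u u' w \<Longrightarrow> L2_inner G g u = L2_inner G v' u'"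
    by (rule greenE[OF assms(2)]) (rule that)
  have "L2_inner G (green f) g = L2_inner G v' u'"
    using v(2)[OF u(1)] by (simp add: L2_inner_sum mult.commute)
  also have "\<dots> = L2_inner G f (green g)"
    using u(2)[OF v(1)] by (simp add: L2_inner_sum mult.commute)
  finally show ?thesis .
qed

lemma green_energyE:
  assumes f: "f \<in> L2 G"
  obtains u' w where "form_domain G (green f) u' w" "L2_inner G (green f) f = L2_inner G u' u'"
    "\<And>e. e \<in> edges G \<Longrightarrow> H2_on (len e) (green f e) (u' e) (\<lambda>x. - f e x)"
proof -
  obtain u' w where u: "form_domain G (green f) u' w"
    "\<And>v v' z. form_domain G v v' z \<Longrightarrow> L2_inner G f v = L2_inner G u' v'"
    "\<And>e. e \<in> edges G \<Longrightarrow> H2_on (len e) (green f e) (u' e) (\<lambda>x. - f e x)"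
    by (rule greenE[OF f]) (rule that)
  show ?thesis
    using that[OF u(1) _ u(3)] u(2)[OF u(1)] L2.sym[OF f green_mem[OF f]] by simp
qed

lemma energy_nonneg: "0 \<le> L2_inner G u' u'"
  by (auto simp: L2_norm_sum intro!: sum_nonneg)

lemma green_nonneg: "f \<in> L2 G \<Longrightarrow> 0 \<le> L2_inner G (green f) f"
  by (erule green_energyE) (simp add: energy_nonneg)

text \<open>Zero energy gives \<open>u' = 0\<close>; then all primitives of \<open>f\<close> vanish,
  and so does \<open>f\<close> almost everywhere.\<close>

lemma green_definite:
  assumes f: "f \<in> L2 G" and z: "L2_inner G (green f) f = 0"
  shows "L2_inner G f f = 0"
proof -
  obtain u' w where u: "form_domain G (green f) u' w" "L2_inner G (green f) f = L2_inner G u' u'"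
    "\<And>e. e \<in> edges G \<Longrightarrow> H2_on (len e) (green f e) (u' e) (\<lambda>x. - f e x)"
    by (rule green_energyE[OF f]) (rule that)
  have u'0: "u' e x = 0" if "e \<in> edges G" "x \<in> {0..len e}" for e x
    using form_domain_energy_zero(3)[OF u(1)] u(2) z that by simp
  have "(\<integral>x. (f e x)\<^sup>2 \<partial>lebesgue_on {0..len e}) = 0" if e: "e \<in> edges G" for e
  proof -
    have "integral {0..x} (f e) = 0" if x: "x \<in> {0..len e}" for x
      using H2_on_primitive[OF u(3)[OF e] x] u'0[OF e x] u'0[OF e, of 0] len_pos[OF e] by simp
    then have "AE x in lebesgue_on {0..len e}. f e x = 0"
      by (rule AE_zero_if_primitive_zero[OF L2_edge[OF f e]])
    then show ?thesis by (intro integral_eq_zero_AE) (auto elim: AE_mp)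
  qed
  then show ?thesis by (simp add: L2_norm_sum)
qed

text \<open>The pairing \<open>?a\<close> is the energy of \<open>green f\<close>. Cauchy--Schwarz
  and Poincare bound its square by \<open>C * ?a * L2_inner G f f\<close>, and a factor
  \<open>?a\<close> cancels.\<close>

lemma green_bound:
  obtains C where "0 < C" "\<And>f. f \<in> L2 G \<Longrightarrow> L2_inner G (green f) f \<le> C * L2_inner G f f"
proof -
  obtain C where C: "0 < C" "\<And>u u' w. form_domain G u u' w \<Longrightarrow> L2_inner G u u \<le> C * L2_inner G u' u'"
    using Poincare by blast
  have "L2_inner G (green f) f \<le> C * L2_inner G f f" if f: "f \<in> L2 G" for f
  proof -
    obtain u' w where u: "form_domain G (green f) u' w" "L2_inner G (green f) f = L2_inner G u' u'"
      by (rule green_energyE[OF f]) (rule that)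
    let ?a = "L2_inner G (green f) f"
    have "?a\<^sup>2 \<le> L2_inner G (green f) (green f) * L2_inner G f f"
      using f green_mem[OF f] by (intro L2.Cauchy_Schwarz)
    also have "\<dots> \<le> (C * ?a) * L2_inner G f f"
      using C(2)[OF u(1)] u(2) energy_nonneg by (intro mult_right_mono) auto
    finally have le: "?a * ?a \<le> (C * L2_inner G f f) * ?a" by (simp add: power2_eq_square mult_ac)
    show ?thesis
    proof (cases "?a = 0")
      case True
      then show ?thesis using C(1) energy_nonneg[of f] by simp
    next
      case False
      then have "0 < ?a" using green_nonneg[OF f] by simp
      then show ?thesis using le by simp
    qed
  qed
  with C(1) that show ?thesis by blast
qed

section \<open>Compactness of the Green operator and infinite dimension\<close>

text \<open>Subsequences are extracted edge by edge; passing to a further subsequence keeps the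
  uniform convergence on the edges already treated.\<close>

lemma edgewise_Arzela_Ascoli:
  assumes "finite A" "A \<subseteq> edges G"
    and b: "\<And>n e x. \<lbrakk>e \<in> edges G; x \<in> {0..len e}\<rbrakk> \<Longrightarrow> \<bar>u n e x\<bar> \<le> M"
    and h: "\<And>n e x y. \<lbrakk>e \<in> edges G; 0 \<le> x; x \<le> y; y \<le> len e\<rbrakk> \<Longrightarrow> \<bar>u n e y - u n e x\<bar> \<le> sqrt (y - x) * c"
  shows "\<exists>r g. strict_mono (r :: nat \<Rightarrow> nat) \<and> (\<forall>e\<in>A. continuous_on {0..len e} (g e) \<and>
    (\<forall>\<epsilon>>0. \<exists>N. \<forall>n\<ge>N. \<forall>x\<in>{0..len e}. \<bar>u (r n) e x - g e x\<bar> < \<epsilon>))"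
  using assms(1,2)
proof (induction A rule: finite_induct)
  case empty
  show ?case by (intro exI[of _ id]) (simp add: strict_mono_def)
next
  case (insert e A)
  then obtain r g where r: "strict_mono (r :: nat \<Rightarrow> nat)"
    and g: "\<And>e. e \<in> A \<Longrightarrow> continuous_on {0..len e} (g e)"
      "\<And>e \<epsilon>. e \<in> A \<Longrightarrow> 0 < \<epsilon> \<Longrightarrow> \<exists>N. \<forall>n\<ge>N. \<forall>x\<in>{0..len e}. \<bar>u (r n) e x - g e x\<bar> < \<epsilon>"
    by (metis insert_subset)
  have e: "e \<in> edges G" using insert.prems by simp
  have hh: "\<bar>u n e y - u n e x\<bar> \<le> sqrt \<bar>y - x\<bar> * \<bar>c\<bar>" if "x \<in> {0..len e}" "y \<in> {0..len e}" for n x y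
  proof -
    have "sqrt \<bar>y - x\<bar> * c \<le> sqrt \<bar>y - x\<bar> * \<bar>c\<bar>" by (intro mult_left_mono) auto
    moreover have "\<bar>u n e y - u n e x\<bar> \<le> sqrt \<bar>y - x\<bar> * c"
      using h[OF e, of x y n] h[OF e, of y x n] that
      by (cases "x \<le> y") (auto simp: abs_minus_commute)
    ultimately show ?thesis by linarith
  qed
  obtain g' k where g': "continuous_on {0..len e} g'" and k: "strict_mono (k :: nat \<Rightarrow> nat)"
    and lim: "\<And>\<epsilon>. 0 < \<epsilon> \<Longrightarrow> \<exists>N. \<forall>n x. n \<ge> N \<and> x \<in> {0..len e} \<longrightarrow> norm (u (r (k n)) e x - g' x) < \<epsilon>"
  proof (rule Arzela_Ascoli[of "{0..len e}" "\<lambda>n. u (r n) e" M])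
    fix x \<epsilon> :: real assume x: "x \<in> {0..len e}" and \<epsilon>: "0 < \<epsilon>"
    \<comment> \<open>Inverts the modulus \<open>sqrt d * c\<close>; the added 1 keeps the
      denominator positive.\<close>
    define d where "d = (\<epsilon> / (\<bar>c\<bar> + 1))\<^sup>2"
    have "0 < d" using \<epsilon> by (simp add: d_def add_nonneg_pos)
    moreover have "norm (u (r n) e x - u (r n) e y) < \<epsilon>" if y: "y \<in> {0..len e}" "norm (x - y) < d" for n y
    proof -
      have "sqrt \<bar>x - y\<bar> < \<epsilon> / (\<bar>c\<bar> + 1)"
        using real_sqrt_less_mono[OF y(2)[unfolded d_def real_norm_def]] \<epsilon> by simp
      then have lt: "sqrt \<bar>x - y\<bar> * (\<bar>c\<bar> + 1) < \<epsilon>" by (simp add: pos_less_divide_eq add_nonneg_pos)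
      have "\<bar>u (r n) e x - u (r n) e y\<bar> \<le> sqrt \<bar>x - y\<bar> * \<bar>c\<bar>" by (rule hh[OF y(1) x])
      also have "\<dots> \<le> sqrt \<bar>x - y\<bar> * (\<bar>c\<bar> + 1)" by (intro mult_left_mono) auto
      finally show ?thesis using lt by simp
    qed
    ultimately show "\<exists>d>0. \<forall>n y. y \<in> {0..len e} \<and> norm (x - y) < d \<longrightarrow> norm (u (r n) e x - u (r n) e y) < \<epsilon>"
      by blast
  qed (use b[OF e] that in auto)
  have rk: "k n \<ge> n" for n using k by (rule seq_suble)
  have "\<exists>N. \<forall>n\<ge>N. \<forall>x\<in>{0..len e'}. \<bar>u (r (k n)) e' x - (g(e := g')) e' x\<bar> < \<epsilon>"
    if e': "e' \<in> insert e A" and \<epsilon>: "0 < \<epsilon>" for e' \<epsilon>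
  proof (cases "e' = e")
    case True
    obtain N where "\<forall>n x. n \<ge> N \<and> x \<in> {0..len e} \<longrightarrow> norm (u (r (k n)) e x - g' x) < \<epsilon>"
      using lim[OF \<epsilon>] by blast
    then show ?thesis using True by (intro exI[of _ N]) simp
  next
    case False
    then obtain N where "\<forall>n\<ge>N. \<forall>x\<in>{0..len e'}. \<bar>u (r n) e' x - g e' x\<bar> < \<epsilon>"
      using g(2)[OF _ \<epsilon>] e' by blast
    then show ?thesis using False rk by (intro exI[of _ N]) (auto intro: order_trans)
  qed
  moreover have "strict_mono (\<lambda>n. r (k n))" using r k by (simp add: strict_mono_def)
  moreover have "continuous_on {0..len e'} ((g(e := g')) e')" if "e' \<in> insert e A" for e'
    using that g(1) g' by auto
  ultimately show ?case by (intro exI[of _ "\<lambda>n. r (k n)"] exI[of _ "g(e := g')"]) blast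
qed

text \<open>On the unit ball the energies of the solutions are bounded by \<open>C\<close>. This
  gives uniform bounds and a common Hoelder modulus on every edge, hence a uniformly convergent
  subsequence; on edges of finite length uniform convergence implies mean square
  convergence.\<close>

lemma green_compact:
  assumes X: "\<And>n. X n \<in> L2 G" and X1: "\<And>n. L2_inner G (X n) (X n) \<le> 1"
  shows "\<exists>r x. strict_mono (r :: nat \<Rightarrow> nat) \<and> x \<in> L2 G \<and> L2.converges_to (\<lambda>n. green (X (r n))) x"
proof -
  obtain C where C: "0 < C" "\<And>f. f \<in> L2 G \<Longrightarrow> L2_inner G (green f) f \<le> C * L2_inner G f f"
    using green_bound by blast
  obtain c where c: "0 < c" "\<And>u u' w e x. \<lbrakk>form_domain G u u' w; e \<in> edges G; x \<in> {0..len e}\<rbrakk>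
      \<Longrightarrow> \<bar>u e x\<bar> \<le> c * sqrt (L2_inner G u' u')"
    using Poincare_pointwise by blast
  have "\<exists>u' w. form_domain G (green (X n)) u' w \<and> L2_inner G u' u' \<le> C" for n
  proof -
    obtain u' w where u: "form_domain G (green (X n)) u' w" "L2_inner G (green (X n)) (X n) = L2_inner G u' u'"
      by (rule green_energyE[OF X]) (rule that)
    have "C * L2_inner G (X n) (X n) \<le> C * 1"
      using C(1) by (intro mult_left_mono X1) simp
    then have "L2_inner G u' u' \<le> C" using C(2)[OF X, of n] u(2) by linarith
    then show ?thesis using u(1) by auto
  qed
  then obtain U w where U: "\<And>n. form_domain G (green (X n)) (U n) (w n)" "\<And>n. L2_inner G (U n) (U n) \<le> C"
    by metis
  have b: "\<bar>green (X n) e x\<bar> \<le> c * sqrt C" if "e \<in> edges G" "x \<in> {0..len e}" for n e x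
    by (rule order_trans[OF c(2)[OF U(1) that]]) (intro mult_left_mono real_sqrt_le_mono U(2) less_imp_le c(1))
  have h: "\<bar>green (X n) e y - green (X n) e x\<bar> \<le> sqrt (y - x) * sqrt C"
    if "e \<in> edges G" "0 \<le> x" "x \<le> y" "y \<le> len e" for n e x y
    by (rule order_trans[OF form_domain_edge_Holder[OF U(1) that]], intro mult_left_mono real_sqrt_le_mono U(2))
       (use that in simp)
  have "\<exists>r g. strict_mono (r :: nat \<Rightarrow> nat) \<and> (\<forall>e\<in>edges G. continuous_on {0..len e} (g e) \<and>
      (\<forall>\<epsilon>>0. \<exists>N. \<forall>n\<ge>N. \<forall>x\<in>{0..len e}. \<bar>green (X (r n)) e x - g e x\<bar> < \<epsilon>))"
    by (rule edgewise_Arzela_Ascoli[OF finite_edges order_refl]) (rule b h; assumption)+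
  then obtain r g where r: "strict_mono (r :: nat \<Rightarrow> nat)"
    and g: "\<And>e. e \<in> edges G \<Longrightarrow> continuous_on {0..len e} (g e)"
      "\<And>e \<epsilon>. e \<in> edges G \<Longrightarrow> 0 < \<epsilon> \<Longrightarrow>
        \<exists>N. \<forall>n\<ge>N. \<forall>x\<in>{0..len e}. \<bar>green (X (r n)) e x - g e x\<bar> < \<epsilon>"
    by metis
  have gL: "g \<in> L2 G" using g(1) by (simp add: L2_def square_integrable_on_continuous)
  have "(\<lambda>n. \<integral>x. (green (X (r n)) e x - g e x)\<^sup>2 \<partial>lebesgue_on {0..len e}) \<longlonglongrightarrow> 0"
    if e: "e \<in> edges G" for e
  proof (rule LIMSEQ_I)
    fix \<eta> :: real assume \<eta>: "0 < \<eta>"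
    define \<epsilon> where "\<epsilon> = sqrt (\<eta> / (2 * len e))"
    have le: "0 < len e" using e by (rule len_pos)
    have \<epsilon>: "0 < \<epsilon>" "\<epsilon>\<^sup>2 * len e = \<eta> / 2" using \<eta> le by (auto simp: \<epsilon>_def)
    obtain N where N: "\<And>n x. n \<ge> N \<Longrightarrow> x \<in> {0..len e} \<Longrightarrow> \<bar>green (X (r n)) e x - g e x\<bar> < \<epsilon>"
      using g(2)[OF e \<epsilon>(1)] by blast
    have "(\<integral>x. (green (X (r n)) e x - g e x)\<^sup>2 \<partial>lebesgue_on {0..len e}) \<le> \<eta> / 2" if n: "n \<ge> N" for n
    proof -
      have "square_integrable_on (len e) (\<lambda>x. green (X (r n)) e x - g e x)"
        using L2_edge[OF L2.diff_mem[OF green_mem[OF X] gL] e, of "r n"] by (simp add: fun_diff_def)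
      then have "(\<integral>x. (green (X (r n)) e x - g e x)\<^sup>2 \<partial>lebesgue_on {0..len e}) \<le> (\<integral>x. \<epsilon>\<^sup>2 \<partial>lebesgue_on {0..len e})"
        using power_mono[OF less_imp_le[OF N[OF n]] abs_ge_zero, of _ 2]
          square_integrable_on_integrable[OF square_integrable_on_const]
        by (intro integral_mono) (auto simp: square_integrable_on_def)
      also have "\<dots> = \<eta> / 2" using \<epsilon>(2) le by (simp add: measure_restrict_space mult.commute)
      finally show ?thesis .
    qed
    then show "\<exists>no. \<forall>n\<ge>no. norm ((\<integral>x. (green (X (r n)) e x - g e x)\<^sup>2 \<partial>lebesgue_on {0..len e}) - 0) < \<eta>"
      using \<eta> by (intro exI[of _ N]) force
  qed
  then have "(\<lambda>n. \<Sum>e\<in>edges G. \<integral>x. (green (X (r n)) e x - g e x)\<^sup>2 \<partial>lebesgue_on {0..len e})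
      \<longlonglongrightarrow> (\<Sum>e\<in>edges G. 0)"
    by (intro tendsto_sum)
  then have "L2.converges_to (\<lambda>n. green (X (r n))) g"
    by (simp add: L2.converges_to_def L2_norm_sum)
  with r gL show ?thesis by blast
qed

text \<open>The support condition is what carries the induction: to meet one more constraint, the
  interval is halved, and of the two functions obtained on the halves, which satisfy the earlier
  constraints and are orthogonal to each other, a combination satisfies the new one.\<close>

lemma exists_orthogonal_supported:
  assumes "finite S" "S \<subseteq> L2 G" and e: "e \<in> edges G" and "0 \<le> a" "a < b" "b \<le> len e"
  shows "\<exists>x\<in>L2 G. 0 < L2_inner G x x \<and> (\<forall>y\<in>S. L2_inner G x y = 0) \<and>
    (\<forall>e' t. \<not> (e' = e \<and> a < t \<and> t \<le> b) \<longrightarrow> x e' t = 0)"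
  using assms(1,2,4-)
proof (induction S arbitrary: a b rule: finite_induct)
  case empty
  \<comment> \<open>Half-open intervals, so that the two halves of a bisected interval are
    disjoint.\<close>
  define x where "x e' t = (if e' = e then indicat_real {a<..b} t else 0)" for e' t
  let ?M = "lebesgue_on {0..len e}"
  have S: "{a<..b} \<in> sets ?M" using empty by (auto simp: sets_restrict_space_iff)
  have "emeasure ?M {a<..b} = ennreal (b - a)"
    using empty by (subst emeasure_restrict_space) auto
  then have i: "integrable ?M (indicat_real {a<..b})" and v: "(\<integral>t. indicat_real {a<..b} t \<partial>?M) = b - a"
    using empty S by (auto simp: measure_def Int_absorb2 greaterThanAtMost_subseteq_atLeastAtMost_iff)
  have sq: "(indicat_real A t)\<^sup>2 = indicat_real A t" for A and t :: real by (simp add: indicator_def)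
  have "square_integrable_on (len e') (x e')" for e'
  proof (cases "e' = e")
    case True
    then have "x e' = indicat_real {a<..b}" by (simp add: x_def fun_eq_iff)
    then show ?thesis using True S i by (simp add: square_integrable_on_def sq)
  next
    case False
    then have "x e' = (\<lambda>_. 0)" by (simp add: x_def fun_eq_iff)
    then show ?thesis by simp
  qed
  then have xL: "x \<in> L2 G" by (simp add: L2_def)
  have "L2_inner G x x \<ge> b - a"
    using edge_norm_le[OF e, of x] v by (simp add: x_def sq)
  then show ?case
    using xL empty by (intro bexI[of _ x] conjI) (auto, auto simp: x_def)
next
  case (insert y S)
  let ?m = "(a + b) / 2"
  obtain x1 where x1: "x1 \<in> L2 G" "0 < L2_inner G x1 x1" "\<And>y. y \<in> S \<Longrightarrow> L2_inner G x1 y = 0"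
    "\<And>e' t. \<not> (e' = e \<and> a < t \<and> t \<le> ?m) \<Longrightarrow> x1 e' t = 0"
    using insert.IH[of a ?m] insert.prems by auto
  obtain x2 where x2: "x2 \<in> L2 G" "0 < L2_inner G x2 x2" "\<And>y. y \<in> S \<Longrightarrow> L2_inner G x2 y = 0"
    "\<And>e' t. \<not> (e' = e \<and> ?m < t \<and> t \<le> b) \<Longrightarrow> x2 e' t = 0"
    using insert.IH[of ?m b] insert.prems by auto
  have yL: "y \<in> L2 G" "S \<subseteq> L2 G" using insert.prems by auto
  show ?case
  proof (cases "L2_inner G x1 y = 0")
    case True
    then show ?thesis using x1 insert.prems by (intro bexI[of _ x1]) auto
  next
    case False
    \<comment> \<open>The coefficients are crossed so that the pairings with \<open>y\<close>
      cancel. The result is not null because the coefficient of \<open>x2\<close> is nonzero and the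
      supports are disjoint.\<close>
    let ?x = "L2_inner G x2 y *\<^sub>R x1 - L2_inner G x1 y *\<^sub>R x2"
    have "x1 e' t * x2 e' t = 0" for e' t using x1(4)[of e' t] x2(4)[of e' t] by force
    then have o: "L2_inner G x1 x2 = 0" "L2_inner G x2 x1 = 0"
      unfolding L2_inner_sum mult.commute[of "x2 _ _"] by (simp_all only:) simp_all
    have "L2_inner G ?x ?x = (L2_inner G x2 y)\<^sup>2 * L2_inner G x1 x1 + (L2_inner G x1 y)\<^sup>2 * L2_inner G x2 x2"
      using x1(1) x2(1) o by (simp add: L2.bilinear power2_eq_square algebra_simps)
    also have "\<dots> > 0" using False x1(2) x2(2) by (intro add_nonneg_pos) auto
    finally have "0 < L2_inner G ?x ?x" .
    moreover have "L2_inner G ?x z = 0" if "z \<in> insert y S" for z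
      using that x1(1,3) x2(1,3) yL by (auto simp: L2.bilinear subset_iff)
    moreover have "?x e' t = 0" if "\<not> (e' = e \<and> a < t \<and> t \<le> b)" for e' t
      using that x1(4)[of e' t] x2(4)[of e' t] insert.prems by force
    moreover have "?x \<in> L2 G" using x1(1) x2(1) by blast
    ultimately show ?thesis by blast
  qed
qed

theorem eigenbasis_exists: "\<exists>lam phi. eigenbasis G lam phi"
proof -
  obtain C where C: "0 < C" "\<And>f. f \<in> L2 G \<Longrightarrow> L2_inner G (green f) f \<le> C * L2_inner G f f"
    using green_bound by blast
  obtain e0 where e0: "e0 \<in> edges G" using edges_nonempty by blast
  interpret green: compact_positive_operator "L2 G" "L2_inner G" green C
  proof
    show "green (x + y) = green x + green y" if "x \<in> L2 G" "y \<in> L2 G" for x y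
      using green_lin[OF that, of 1] by simp
    show "green (c *\<^sub>R x) = c *\<^sub>R green x" if "x \<in> L2 G" for x c
    proof -
      have "green 0 = 0"
        using green[of 0] by (intro laplacian_unique[of _ 0]) (auto simp: laplacian_zero supported_def)
      then show ?thesis using green_lin[of 0 x c] that by simp
    qed
    show "\<exists>x\<in>L2 G. 0 < L2_inner G x x \<and> (\<forall>y\<in>S. L2_inner G x y = 0)" if "finite S" "S \<subseteq> L2 G" for S
      using exists_orthogonal_supported[OF that e0, of 0 "len e0"] len_pos[OF e0] by blast
  qed (use green_mem green_sym green_nonneg green_definite C(2) green_compact in \<open>auto simp: green_sym\<close>)
  obtain \<mu> p \<phi> where \<mu>: "\<And>n. 0 < \<mu> n" "decseq \<mu>" "\<mu> \<longlonglongrightarrow> 0" and p: "\<And>n. p n \<in> L2 G"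
    and \<phi>: "\<And>n. \<phi> n = (1 / \<mu> n) *\<^sub>R green (p n)"
    and null: "\<And>n. L2_inner G (\<phi> n - p n) (\<phi> n - p n) = 0"
    and on: "\<And>m n. L2_inner G (\<phi> m) (\<phi> n) = (if m = n then 1 else 0)"
    and basis: "\<And>x. x \<in> L2 G \<Longrightarrow> L2.converges_to (\<lambda>N. \<Sum>n<N. L2_inner G x (\<phi> n) *\<^sub>R \<phi> n) x"
    by (rule green.spectral_theorem_range) (rule that)
  have \<phi>L: "\<phi> n \<in> L2 G" for n unfolding \<phi> using p green_mem by auto
  define lam where "lam n = 1 / \<mu> n" for n
  have "laplacian G (\<phi> n) (\<lambda>e x. lam n * \<phi> n e x)" for n
  proof -
    \<comment> \<open>By its definition \<open>\<phi> n\<close> solves the equation with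
      \<open>p n\<close> on the right; since the two differ by a null function, \<open>p n\<close>
      may then be replaced by \<open>\<phi> n\<close>.\<close>
    have "laplacian G (\<phi> n) (lam n *\<^sub>R p n)"
      unfolding \<phi> lam_def by (intro laplacian_scale green p)
    moreover have "lam n *\<^sub>R p n - lam n *\<^sub>R \<phi> n = (- lam n) *\<^sub>R (\<phi> n - p n)"
      by (simp add: algebra_simps)
    then have "L2_inner G (lam n *\<^sub>R p n - lam n *\<^sub>R \<phi> n) (lam n *\<^sub>R p n - lam n *\<^sub>R \<phi> n) = 0"
      using null[of n] \<phi>L p
      by (simp only: L2.scale_left L2.scale_right L2.diff_mem L2.scale_mem)
    ultimately have "laplacian G (\<phi> n) (lam n *\<^sub>R \<phi> n)"
      by (rule laplacian_null_cong[OF _ L2.scale_mem[OF \<phi>L]])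
    then show ?thesis by (simp add: scaleR_fun_def)
  qed
  moreover have "0 < lam 0" using \<mu>(1) by (simp add: lam_def)
  moreover have "mono lam"
    using \<mu>(1,2) by (auto simp: mono_def lam_def decseq_def intro!: divide_left_mono mult_pos_pos)
  moreover have "filterlim lam at_top sequentially"
    unfolding lam_def[abs_def] using filterlim_inverse_at_top[OF \<mu>(3)] \<mu>(1)
    by (simp add: inverse_eq_divide)
  moreover have "L2_sums G (\<lambda>n e x. L2_inner G f (\<phi> n) * \<phi> n e x) f" if f: "f \<in> L2 G" for f
  proof -
    have "(\<lambda>n e x. L2_inner G f (\<phi> n) * \<phi> n e x) = (\<lambda>n. L2_inner G f (\<phi> n) *\<^sub>R \<phi> n)"
      by (simp add: scaleR_fun_def)
    then show ?thesis using L2_sums_iff[of "\<lambda>n. L2_inner G f (\<phi> n) *\<^sub>R \<phi> n" f] basis f \<phi>L by simp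
  qed
  ultimately have "eigenbasis G lam \<phi>" using on unfolding eigenbasis_def by blast
  then show ?thesis by blast
qed

end

section \<open>Torsional rigidity and the resolvent\<close>

context dirichlet_graph
begin

section \<open>Coefficients of the torsion function\<close>

abbreviation one :: "'e graph_fun" where "one \<equiv> \<lambda>e x. 1"

abbreviation "lam \<equiv> eigenval G"
abbreviation "phi \<equiv> eigenfun G"

lemma eigenbasis_spectral_data: "eigenbasis G lam phi"
proof -
  have "\<exists>q. case q of (l, p) \<Rightarrow> eigenbasis G l p" using eigenbasis_exists by auto
  from someI_ex[OF this] show ?thesis
    by (simp add: eigenval_def eigenfun_def spectral_data_def case_prod_unfold)
qed

lemma lam_mono: "m \<le> n \<Longrightarrow> lam m \<le> lam n"
  using eigenbasis_spectral_data by (auto simp: eigenbasis_def mono_def)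

lemma lam_pos: "0 < lam n"
  using eigenbasis_spectral_data lam_mono[of 0 n] by (auto simp: eigenbasis_def)

lemma phi_laplacian: "laplacian G (phi n) (lam n *\<^sub>R phi n)"
  using eigenbasis_spectral_data by (simp add: eigenbasis_def scaleR_fun_def)

lemma phi_L2 [simp]: "phi n \<in> L2 G"
  by (rule laplacianE[OF phi_laplacian]) (rule form_domain_L2(1))

lemma phi_orthonormal: "L2_inner G (phi m) (phi n) = (if m = n then 1 else 0)"
  using eigenbasis_spectral_data by (simp add: eigenbasis_def)

lemma phi_basis:
  assumes "f \<in> L2 G"
  shows "L2.converges_to (\<lambda>N. \<Sum>n<N. L2_inner G f (phi n) *\<^sub>R phi n) f"
proof -
  have "L2_sums G (\<lambda>n e x. L2_inner G f (phi n) * phi n e x) f"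
    using eigenbasis_spectral_data assms by (simp add: eigenbasis_def)
  moreover have "(\<lambda>n e x. L2_inner G f (phi n) * phi n e x) = (\<lambda>n. L2_inner G f (phi n) *\<^sub>R phi n)"
    by (simp add: scaleR_fun_def)
  ultimately show ?thesis
    using L2_sums_iff[of "\<lambda>n. L2_inner G f (phi n) *\<^sub>R phi n" f] assms by simp
qed

lemma one_L2 [simp]: "one \<in> L2 G"
  by (simp add: L2_def)

lemma converges_to_inner_sums:
  assumes c: "L2.converges_to (\<lambda>N. \<Sum>n<N. c n *\<^sub>R p n) f" and p: "\<And>n. p n \<in> L2 G"
    and f: "f \<in> L2 G" and g: "g \<in> L2 G"
  shows "(\<lambda>n. c n * L2_inner G (p n) g) sums L2_inner G f g"
proof -
  have "(\<lambda>N. L2_inner G (\<Sum>n<N. c n *\<^sub>R p n) g) \<longlonglongrightarrow> L2_inner G f g"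
    using c p f g by (intro L2.converges_to_inner) auto
  then show ?thesis
    unfolding sums_def using p g by (subst (asm) L2.sum_left) (auto simp: L2.scale_left)
qed

lemma Parseval:
  assumes "f \<in> L2 G" "g \<in> L2 G"
  shows "(\<lambda>n. L2_inner G f (phi n) * L2_inner G g (phi n)) sums L2_inner G f g"
  using converges_to_inner_sums[OF phi_basis[OF assms(1)] phi_L2 assms] assms
  by (simp add: L2.sym[OF phi_L2 assms(2)])

definition coeff :: "nat \<Rightarrow> real" where
  "coeff n = L2_inner G one (phi n)"

lemma coeff_summable: "summable (\<lambda>n. (coeff n)\<^sup>2)"
  using Parseval[OF one_L2 one_L2] by (auto simp: coeff_def power2_eq_square summable_def)

lemma graph_integral_inner: "graph_integral G u = L2_inner G u one"
  by (simp add: L2_inner_def)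

text \<open>Pairing the defining series with \<open>phi k\<close> isolates a single term. Thus every
  solution has the same coefficients, whichever one \<open>SOME\<close> selects.\<close>

lemma frac_laplacian_coeff:
  assumes "frac_laplacian G \<alpha> u one"
  shows "L2_inner G u (phi k) = lam k powr (- \<alpha>) * coeff k"
proof -
  let ?c = "\<lambda>n. lam n powr \<alpha> * L2_inner G u (phi n)"
  have "(\<lambda>n e x. ?c n * phi n e x) = (\<lambda>n. ?c n *\<^sub>R phi n)" by (simp add: scaleR_fun_def)
  then have "L2_sums G (\<lambda>n. ?c n *\<^sub>R phi n) one"
    using assms by (simp add: frac_laplacian_def)
  then have "L2.converges_to (\<lambda>N. \<Sum>n<N. ?c n *\<^sub>R phi n) one"
    using L2_sums_iff[of "\<lambda>n. ?c n *\<^sub>R phi n" one] by simp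
  then have "(\<lambda>n. ?c n * L2_inner G (phi n) (phi k)) sums coeff k"
    unfolding coeff_def by (intro converges_to_inner_sums) auto
  moreover have "(\<lambda>n. ?c n * L2_inner G (phi n) (phi k)) = (\<lambda>n. if n = k then ?c n else 0)"
    by (auto simp: phi_orthonormal)
  ultimately have "(\<lambda>n. if n = k then ?c n else 0) sums coeff k" by simp
  then have "?c k = coeff k" by (rule sums_unique2[OF sums_single])
  then show ?thesis using lam_pos[of k] by (auto simp: powr_minus field_simps)
qed

text \<open>The eigenvalues are bounded below by \<open>lam 0 > 0\<close>, so dividing by their
  powers preserves square summability of the coefficients of 1.\<close>

lemma frac_laplacian_solvable:
  assumes "0 < \<alpha>"
  shows "\<exists>u. frac_laplacian G \<alpha> u one"
proof -
  define c where "c n = lam n powr (- \<alpha>) * coeff n" for n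
  have "summable (\<lambda>n. (c n)\<^sup>2)"
  proof (rule summable_comparison_test')
    show "summable (\<lambda>n. (lam 0 powr (- \<alpha>))\<^sup>2 * (coeff n)\<^sup>2)" using coeff_summable by (rule summable_mult)
    show "norm ((c n)\<^sup>2) \<le> (lam 0 powr (- \<alpha>))\<^sup>2 * (coeff n)\<^sup>2" if "n \<ge> 0" for n
    proof -
      have "lam n powr (- \<alpha>) \<le> lam 0 powr (- \<alpha>)"
        using assms lam_mono[of 0 n] lam_pos[of 0] by (intro powr_mono2') auto
      then show ?thesis by (auto simp: c_def power_mult_distrib intro!: mult_right_mono power_mono)
    qed
  qed
  then obtain u where u: "u \<in> L2 G" "\<And>n. L2_inner G u (phi n) = c n"
    by (rule L2.orthonormal_series[OF phi_L2 phi_orthonormal]) (rule that)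
  have e: "lam n powr \<alpha> * L2_inner G u (phi n) = coeff n" for n
    using lam_pos[of n] by (simp add: u c_def powr_minus)
  have "L2_sums G (\<lambda>n. coeff n *\<^sub>R phi n) one"
    using L2_sums_iff[of "\<lambda>n. coeff n *\<^sub>R phi n" one] phi_basis[OF one_L2] by (simp add: coeff_def)
  moreover have "lam n powr (2 * \<alpha>) * (L2_inner G u (phi n))\<^sup>2 = (coeff n)\<^sup>2" for n
    unfolding e[symmetric] mult_2 powr_add by (simp add: power2_eq_square)
  ultimately show ?thesis
    using u(1) coeff_summable by (auto simp: frac_laplacian_def e scaleR_fun_def)
qed

lemma frac_laplacian_torsion_function:
  "0 < \<alpha> \<Longrightarrow> frac_laplacian G \<alpha> (frac_torsion_function G \<alpha>) one"
  unfolding frac_torsion_function_def using someI_ex[OF frac_laplacian_solvable] .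

lemma torsion_sums:
  assumes "0 < \<alpha>"
  shows "(\<lambda>n. (coeff n)\<^sup>2 * lam n powr (- \<alpha>)) sums frac_torsional_rigidity G \<alpha>"
proof -
  let ?u = "frac_torsion_function G \<alpha>"
  note u = frac_laplacian_torsion_function[OF assms]
  have "?u \<in> L2 G" using u by (simp add: frac_laplacian_def)
  from Parseval[OF this one_L2] show ?thesis
    by (simp add: frac_laplacian_coeff[OF u] frac_torsional_rigidity_def graph_integral_inner
        power2_eq_square mult_ac flip: coeff_def)
qed

lemma phi_derivativeE:
  obtains d w where "form_domain G (phi n) d w"
    "\<And>v v' z. form_domain G v v' z \<Longrightarrow> lam n * L2_inner G v (phi n) = L2_inner G v' d"
proof -
  obtain d w where d: "form_domain G (phi n) d w"
    "\<And>v v' z. form_domain G v v' z \<Longrightarrow> L2_inner G (lam n *\<^sub>R phi n) v = L2_inner G d v'"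
    by (rule laplacianE[OF phi_laplacian]) (rule that)
  have "lam n * L2_inner G v (phi n) = L2_inner G v' d" if v: "form_domain G v v' z" for v v' z
    using d(2)[OF v] form_domain_L2[OF v] form_domain_L2[OF d(1)]
    by (simp add: L2.scale_left L2.sym[of v] L2.sym[of v'])
  with d(1) that show ?thesis by blast
qed

section \<open>The resolvent sum and its variational bound\<close>

definition resolvent_sum :: "real \<Rightarrow> real" where
  "resolvent_sum s = (\<Sum>n. (coeff n)\<^sup>2 / (lam n + s))"

lemma resolvent_summable:
  assumes "0 < s"
  shows "summable (\<lambda>n. (coeff n)\<^sup>2 / (lam n + s))"
proof (rule summable_comparison_test')
  show "summable (\<lambda>n. (1 / s) * (coeff n)\<^sup>2)" using coeff_summable by (rule summable_mult)
  show "norm ((coeff n)\<^sup>2 / (lam n + s)) \<le> (1 / s) * (coeff n)\<^sup>2" for n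
    using assms lam_pos[of n] by (simp add: frac_le)
qed

text \<open>
  The functions \<open>phi n ' / sqrt (lam n)\<close> are orthonormal, so that Bessel's inequality bounds
  \<open>\<Sum>n. lam n * \<langle>w, phi n\<rangle>\<^sup>2\<close> by the energy of \<open>w\<close>.
\<close>

lemma energy_Bessel:
  assumes w: "form_domain G w w' z"
  shows "(\<Sum>n<N. lam n * (L2_inner G w (phi n))\<^sup>2) \<le> L2_inner G w' w'"
proof -
  have "\<exists>d w. form_domain G (phi n) d w \<and>
    (\<forall>v v' z. form_domain G v v' z \<longrightarrow> lam n * L2_inner G v (phi n) = L2_inner G v' d)" for n
    by (rule phi_derivativeE[of n]) blast
  then obtain d w0 where d: "\<And>n. form_domain G (phi n) (d n) (w0 n)"
    "\<And>n v v' z. form_domain G v v' z \<Longrightarrow> lam n * L2_inner G v (phi n) = L2_inner G v' (d n)"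
    by metis
  define \<psi> where "\<psi> n = (1 / sqrt (lam n)) *\<^sub>R d n" for n
  have dL: "d n \<in> L2 G" for n using form_domain_L2(2)[OF d(1)] .
  then have \<psi>L: "\<psi> n \<in> L2 G" for n by (auto simp: \<psi>_def)
  have "L2_inner G (\<psi> m) (\<psi> n) = (if m = n then 1 else 0)" for m n
    using d(2)[OF d(1), of n m] lam_pos[of n] dL
    by (simp add: \<psi>_def L2.scale_left L2.scale_right phi_orthonormal split: if_splits flip: real_sqrt_mult)
  from L2.Bessel(2)[OF \<psi>L this form_domain_L2(2)[OF w], of "{..<N}"]
  have "(\<Sum>n<N. (L2_inner G w' (\<psi> n))\<^sup>2) \<le> L2_inner G w' w'" by simp
  moreover have "(L2_inner G w' (\<psi> n))\<^sup>2 = lam n * (L2_inner G w (phi n))\<^sup>2" for n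
    using d(2)[OF w, of n] dL[of n] form_domain_L2(2)[OF w] lam_pos[of n]
    by (simp add: \<psi>_def L2.scale_right power_divide power_mult_distrib power2_eq_square field_simps
        flip: d(2)[OF w])
  ultimately show ?thesis by simp
qed

text \<open>For any trial function, twice the pairing with 1 is at most the energy plus
  \<open>s\<close> times the squared norm plus \<open>resolvent_sum s\<close>. Under the assumption
  \<open>e\<close> the first two of these make up one copy of the pairing. The trial function need
  not satisfy the Kirchhoff condition, so solutions of a problem with more Dirichlet vertices
  qualify.\<close>

lemma resolvent_sum_ge:
  assumes s: "0 < s" and w: "form_domain G w w' z"
    and e: "L2_inner G w' w' + s * L2_inner G w w = L2_inner G one w"
  shows "L2_inner G one w \<le> resolvent_sum s"
proof -
  define c where "c n = L2_inner G w (phi n)" for n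
  have wL: "w \<in> L2 G" by (rule form_domain_L2(1)[OF w])
  have 1: "(\<lambda>N. \<Sum>n<N. coeff n * c n) \<longlonglongrightarrow> L2_inner G one w"
    using Parseval[OF one_L2 wL] by (simp add: sums_def coeff_def c_def)
  have "(\<Sum>n<N. coeff n * c n) * 2 \<le> L2_inner G one w + resolvent_sum s" for N
  proof -
    \<comment> \<open>A completed square with weight \<open>lam n + s\<close>; equality holds
      exactly for the coefficients of the true resolvent.\<close>
    have young: "coeff n * c n * 2 \<le> (lam n * (c n)\<^sup>2 + s * (c n)\<^sup>2) + (coeff n)\<^sup>2 / (lam n + s)" for n
    proof -
      have p: "0 < lam n + s" using s lam_pos[of n] by simp
      have "0 \<le> ((lam n + s) * c n - coeff n)\<^sup>2 / (lam n + s)" using p by simp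
      also have "\<dots> = (lam n * (c n)\<^sup>2 + s * (c n)\<^sup>2) + (coeff n)\<^sup>2 / (lam n + s) - coeff n * c n * 2"
        using p by (simp add: field_simps power2_eq_square)
      finally show ?thesis by simp
    qed
    have "(\<Sum>n<N. coeff n * c n) * 2 \<le> (\<Sum>n<N. lam n * (c n)\<^sup>2) + s * (\<Sum>n<N. (c n)\<^sup>2)
        + (\<Sum>n<N. (coeff n)\<^sup>2 / (lam n + s))"
      unfolding sum_distrib_right sum_distrib_left sum.distrib[symmetric] by (rule sum_mono) (rule young)
    also have "(\<Sum>n<N. lam n * (c n)\<^sup>2) \<le> L2_inner G w' w'"
      unfolding c_def by (rule energy_Bessel[OF w])
    also have "(\<Sum>n<N. (c n)\<^sup>2) \<le> L2_inner G w w"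
      unfolding c_def by (rule L2.Bessel(2)[OF phi_L2 phi_orthonormal wL]) simp
    also have "(\<Sum>n<N. (coeff n)\<^sup>2 / (lam n + s)) \<le> resolvent_sum s"
      unfolding resolvent_sum_def
      using s lam_pos by (intro sum_le_suminf resolvent_summable) (auto intro!: divide_nonneg_pos add_pos_pos)
    finally show ?thesis using s e by (simp add: mult_left_mono)
  qed
  then have "L2_inner G one w * 2 \<le> L2_inner G one w + resolvent_sum s"
    by (intro LIMSEQ_le_const2[OF tendsto_mult_right[OF 1]]) auto
  then show ?thesis by simp
qed

text \<open>Testing the equation of \<open>w\<close> against \<open>phi n\<close> and that of
  \<open>phi n\<close> against \<open>w\<close> gives the coefficients
  \<open>coeff n / (lam n + s)\<close>; Parseval does the rest.\<close>

lemma resolvent_sum_eq: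
  assumes s: "0 < s" and w: "laplacian G w (one - s *\<^sub>R w)"
  shows "resolvent_sum s = L2_inner G one w"
proof -
  obtain w' z where w': "form_domain G w w' z"
    "\<And>v v' z. form_domain G v v' z \<Longrightarrow> L2_inner G (one - s *\<^sub>R w) v = L2_inner G w' v'"
    by (rule laplacianE[OF w]) (rule that)
  have wL: "w \<in> L2 G" by (rule form_domain_L2(1)[OF w'(1)])
  have "L2_inner G w (phi n) = coeff n / (lam n + s)" for n
  proof -
    obtain d y where d: "form_domain G (phi n) d y"
      "\<And>v v' z. form_domain G v v' z \<Longrightarrow> lam n * L2_inner G v (phi n) = L2_inner G v' d"
      by (rule phi_derivativeE[of n]) (rule that)
    have "coeff n - s * L2_inner G w (phi n) = lam n * L2_inner G w (phi n)"
      using d(2)[OF w'(1)] w'(2)[OF d(1)] wL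
      by (simp add: L2.diff_left L2.scale_left flip: coeff_def)
    then show ?thesis using s lam_pos[of n] by (simp add: field_simps)
  qed
  then have "(\<lambda>n. (coeff n)\<^sup>2 / (lam n + s)) sums L2_inner G one w"
    using Parseval[OF one_L2 wL] by (simp add: power2_eq_square flip: coeff_def)
  then show ?thesis unfolding resolvent_sum_def by (rule sums_unique[symmetric])
qed

text \<open>
  \<open>\<Sum>j. \<mu> j powr - \<alpha> * \<langle>1, p j\<rangle> * p j\<close> has the same coefficients as the torsion function, because
  \<open>\<langle>p j, phi n\<rangle> = 0\<close> unless \<open>\<mu> j = lam n\<close>.
\<close>

lemma torsion_sums_eigenfunctions:
  assumes "0 < \<alpha>"
    and p: "\<And>j. laplacian G (p j) (\<mu> j *\<^sub>R p j)" and pL: "\<And>j. p j \<in> L2 G"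
    and on: "\<And>i j. L2_inner G (p i) (p j) = (if i = j then 1 else 0)"
    and \<mu>: "0 < m" "\<And>j. m \<le> \<mu> j"
    and one: "L2.converges_to (\<lambda>N. \<Sum>j<N. a j *\<^sub>R p j) one" and a: "\<And>j. a j = L2_inner G one (p j)"
  shows "(\<lambda>j. (a j)\<^sup>2 * \<mu> j powr (- \<alpha>)) sums frac_torsional_rigidity G \<alpha>"
proof -
  have sa: "summable (\<lambda>j. (a j)\<^sup>2)"
    using L2.Bessel(2)[OF pL on one_L2] unfolding a
    by (intro summableI_nonneg_bounded[of _ "L2_inner G one one"]) auto
  define c where "c j = \<mu> j powr (- \<alpha>) * a j" for j
  have "summable (\<lambda>j. (c j)\<^sup>2)"
  proof (rule summable_comparison_test')
    show "summable (\<lambda>j. (m powr (- \<alpha>))\<^sup>2 * (a j)\<^sup>2)" using sa by (rule summable_mult)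
    show "norm ((c j)\<^sup>2) \<le> (m powr (- \<alpha>))\<^sup>2 * (a j)\<^sup>2" if "j \<ge> 0" for j
    proof -
      have "\<mu> j powr (- \<alpha>) \<le> m powr (- \<alpha>)"
        using assms(1) \<mu> by (intro powr_mono2') auto
      then show ?thesis by (auto simp: c_def power_mult_distrib intro!: mult_right_mono power_mono)
    qed
  qed
  then obtain u where u: "u \<in> L2 G" "L2.converges_to (\<lambda>N. \<Sum>j<N. c j *\<^sub>R p j) u"
    by (rule L2.orthonormal_series[OF pL on]) (rule that)
  have "L2_inner G u (phi n) = lam n powr (- \<alpha>) * coeff n" for n
  proof -
    have "(\<lambda>j. c j * L2_inner G (p j) (phi n)) = (\<lambda>j. lam n powr (- \<alpha>) * (a j * L2_inner G (p j) (phi n)))"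
    proof (rule ext)
      fix j
      show "c j * L2_inner G (p j) (phi n) = lam n powr (- \<alpha>) * (a j * L2_inner G (p j) (phi n))"
      proof (cases "L2_inner G (p j) (phi n) = 0")
        case False
        obtain d y where d: "form_domain G (phi n) d y"
          "\<And>v v' z. form_domain G v v' z \<Longrightarrow> lam n * L2_inner G v (phi n) = L2_inner G v' d"
          by (rule phi_derivativeE[of n]) (rule that)
        obtain q' z where q: "form_domain G (p j) q' z"
          "\<And>v v' z. form_domain G v v' z \<Longrightarrow> L2_inner G (\<mu> j *\<^sub>R p j) v = L2_inner G q' v'"
          by (rule laplacianE[OF p]) (rule that)
        have "lam n * L2_inner G (p j) (phi n) = \<mu> j * L2_inner G (p j) (phi n)"
          using d(2)[OF q(1)] q(2)[OF d(1)] pL[of j] by (simp add: L2.scale_left)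
        then have "lam n = \<mu> j" using False by simp
        then show ?thesis by (simp add: c_def)
      qed simp
    qed
    moreover have "(\<lambda>j. lam n powr (- \<alpha>) * (a j * L2_inner G (p j) (phi n))) sums (lam n powr (- \<alpha>) * coeff n)"
      unfolding coeff_def by (intro sums_mult converges_to_inner_sums[OF one pL]) auto
    moreover have "(\<lambda>j. c j * L2_inner G (p j) (phi n)) sums L2_inner G u (phi n)"
      by (intro converges_to_inner_sums[OF u(2) pL u(1)]) auto
    ultimately show ?thesis by (metis sums_unique2)
  qed
  then have "(\<lambda>n. (coeff n)\<^sup>2 * lam n powr (- \<alpha>)) sums L2_inner G u one"
    using Parseval[OF u(1) one_L2] by (simp add: power2_eq_square mult_ac flip: coeff_def)
  then have "frac_torsional_rigidity G \<alpha> = L2_inner G u one"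
    using torsion_sums[OF assms(1)] sums_unique2 by blast
  then show ?thesis
    using converges_to_inner_sums[OF u(2) pL u(1) one_L2]
    by (simp add: c_def a L2.sym[OF pL one_L2] power2_eq_square mult_ac)
qed

end

section \<open>Comparison through the Stieltjes representation\<close>

text \<open>The substitution of \<open>c * s\<close> for \<open>s\<close> pulls out the power of
  \<open>c\<close> and leaves a constant that depends on \<open>\<alpha>\<close> alone.\<close>

lemma nn_integral_stieltjes_kernel_scale:
  assumes "0 < c"
  shows "(\<integral>\<^sup>+ s. ennreal (indicator {0<..} s * (s powr (- \<alpha>) / (c + s))) \<partial>lborel)
    = ennreal (c powr (- \<alpha>)) * (\<integral>\<^sup>+ s. ennreal (indicator {0<..} s * (s powr (- \<alpha>) / (1 + s))) \<partial>lborel)"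
proof -
  have eq: "ennreal (indicator {0<..} (0 + c * s) * ((0 + c * s) powr (- \<alpha>) / (c + (0 + c * s))))
    = ennreal (c powr (- \<alpha>) / c) * ennreal (indicator {0<..} s * (s powr (- \<alpha>) / (1 + s)))" for s
  proof (cases "0 < s")
    case True
    have "(c * s) powr (- \<alpha>) / (c + c * s) = (c powr (- \<alpha>) / c) * (s powr (- \<alpha>) / (1 + s))"
      using assms True by (simp add: powr_mult field_simps)
    moreover have "indicator {0<..} (0 + c * s) * ((0 + c * s) powr (- \<alpha>) / (c + (0 + c * s))) = (c * s) powr (- \<alpha>) / (c + c * s)"
      "indicator {0<..} s * (s powr (- \<alpha>) / (1 + s)) = s powr (- \<alpha>) / (1 + s)"
      using assms True by simp_all
    ultimately show ?thesis
      using assms True by (simp only:) (intro ennreal_mult divide_nonneg_nonneg, auto)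
  next
    case False
    then show ?thesis using assms by (simp add: zero_less_mult_iff)
  qed
  have "(\<integral>\<^sup>+ s. ennreal (indicator {0<..} s * (s powr (- \<alpha>) / (c + s))) \<partial>lborel)
    = ennreal \<bar>c\<bar> * (\<integral>\<^sup>+ s. ennreal (indicator {0<..} (0 + c * s) * ((0 + c * s) powr (- \<alpha>) / (c + (0 + c * s)))) \<partial>lborel)"
    using assms by (intro nn_integral_real_affine) auto
  also have "\<dots> = ennreal c * (ennreal (c powr (- \<alpha>) / c)
      * (\<integral>\<^sup>+ s. ennreal (indicator {0<..} s * (s powr (- \<alpha>) / (1 + s))) \<partial>lborel))"
    unfolding eq using assms by (subst nn_integral_cmult) auto
  also have "\<dots> = ennreal (c powr (- \<alpha>)) * (\<integral>\<^sup>+ s. ennreal (indicator {0<..} s * (s powr (- \<alpha>) / (1 + s))) \<partial>lborel)"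
    using assms by (simp flip: mult.assoc ennreal_mult'')
  finally show ?thesis .
qed

text \<open>The kernel is dominated by \<open>s powr (- \<alpha>)\<close> near 0 and by
  \<open>s powr (- 1 - \<alpha>)\<close> at infinity; the former is integrable because
  \<open>\<alpha> < 1\<close>, the latter because \<open>0 < \<alpha>\<close>.\<close>

lemma nn_integral_stieltjes_kernel_finite:
  fixes \<alpha> :: real
  assumes "0 < \<alpha>" "\<alpha> < 1"
  shows "(\<integral>\<^sup>+ s. ennreal (indicator {0<..} s * (s powr (- \<alpha>) / (1 + s))) \<partial>lborel) < \<infinity>"
proof -
  have "(\<integral>\<^sup>+ s. ennreal (indicator {0<..} s * (s powr (- \<alpha>) / (1 + s))) \<partial>lborel)
    \<le> (\<integral>\<^sup>+ s. ennreal (s powr (- \<alpha>)) * indicator {0..1} s + ennreal (s powr (- 1 - \<alpha>)) * indicator {1..} s \<partial>lborel)"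
  proof (rule nn_integral_mono)
    fix s :: real
    consider "s \<le> 0" | "0 < s" "s \<le> 1" | "1 < s" by linarith
    then show "ennreal (indicator {0<..} s * (s powr (- \<alpha>) / (1 + s)))
      \<le> ennreal (s powr (- \<alpha>)) * indicator {0..1} s + ennreal (s powr (- 1 - \<alpha>)) * indicator {1..} s"
    proof cases
      case 2
      have "s powr (- \<alpha>) / (1 + s) \<le> s powr (- \<alpha>) / 1" using 2 by (intro divide_left_mono) auto
      then show ?thesis using 2 by (auto intro!: add_increasing2 ennreal_leI)
    next
      case 3
      have "s powr (- \<alpha>) / (1 + s) \<le> s powr (- \<alpha>) / s" using 3 by (intro divide_left_mono) auto
      also have "\<dots> = s powr (- 1 - \<alpha>)" using 3 by (simp add: powr_diff powr_minus field_simps)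
      finally show ?thesis using 3 by (auto intro!: ennreal_leI)
    qed simp
  qed
  also have "\<dots> = (\<integral>\<^sup>+ s. ennreal (s powr (- \<alpha>)) * indicator {0..1} s \<partial>lborel)
      + (\<integral>\<^sup>+ s. ennreal (s powr (- 1 - \<alpha>)) * indicator {1..} s \<partial>lborel)"
    by (intro nn_integral_add) auto
  also have "(\<integral>\<^sup>+ s. ennreal (s powr (- \<alpha>)) * indicator {0..1} s \<partial>lborel) = ennreal (1 powr (- \<alpha> + 1) / (- \<alpha> + 1))"
    using assms has_integral_powr_from_0[of "- \<alpha>" 1] by (intro nn_integral_has_integral_lebesgue') auto
  also have "(\<integral>\<^sup>+ s. ennreal (s powr (- 1 - \<alpha>)) * indicator {1..} s \<partial>lborel)
      = ennreal (- (1 powr (- 1 - \<alpha> + 1)) / (- 1 - \<alpha> + 1))"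
    using assms has_integral_powr_to_inf[of "- 1 - \<alpha>" 1] by (intro nn_integral_has_integral_lebesgue') auto
  also have "ennreal (1 powr (- \<alpha> + 1) / (- \<alpha> + 1)) + ennreal (- (1 powr (- 1 - \<alpha> + 1)) / (- 1 - \<alpha> + 1)) < \<infinity>"
    by simp
  finally show ?thesis .
qed

lemma nn_integral_stieltjes_kernel_pos:
  fixes \<alpha> :: real
  assumes "\<alpha> < 1"
  shows "0 < (\<integral>\<^sup>+ s. ennreal (indicator {0<..} s * (s powr (- \<alpha>) / (1 + s))) \<partial>lborel)"
proof -
  \<comment> \<open>On \<open>{1..2}\<close> the numerator is at least 1/2 and the denominator at
    most 3, which explains 1/6.\<close>
  have "0 < (\<integral>\<^sup>+ s. ennreal (1 / 6) * indicator {1..2::real} s \<partial>lborel)"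
    by (simp add: nn_integral_cmult_indicator ennreal_zero_less_mult_iff)
  also have "\<dots> \<le> (\<integral>\<^sup>+ s. ennreal (indicator {0<..} s * (s powr (- \<alpha>) / (1 + s))) \<partial>lborel)"
  proof (rule nn_integral_mono)
    fix s :: real
    show "ennreal (1 / 6) * indicator {1..2} s \<le> ennreal (indicator {0<..} s * (s powr (- \<alpha>) / (1 + s)))"
    proof (cases "s \<in> {1..2}")
      case True
      have "1 / 2 \<le> s powr (- 1)" using True by (simp add: powr_minus field_simps)
      also have "\<dots> \<le> s powr (- \<alpha>)" using True assms by (intro powr_mono) auto
      finally have "(1 / 2) / 3 \<le> s powr (- \<alpha>) / (1 + s)" using True by (intro frac_le) auto
      then show ?thesis using True by (auto intro!: ennreal_leI)
    qed simp
  qed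
  finally show ?thesis .
qed

text \<open>Writing each power as an integral of resolvents and interchanging sum and integral,
  which nonnegativity permits, reduces the claim to the pointwise inequality in \<open>s\<close>.
  The common factor \<open>K\<close> can be cancelled because it is positive and finite.\<close>

lemma stieltjes_comparison:
  fixes a b lam \<mu> :: "nat \<Rightarrow> real"
  assumes \<alpha>: "0 < \<alpha>" "\<alpha> < 1"
    and nn: "\<And>n. 0 \<le> a n" "\<And>n. 0 \<le> b n" and pos: "\<And>n. 0 < lam n" "\<And>n. 0 < \<mu> n"
    and A: "(\<lambda>n. a n * lam n powr (- \<alpha>)) sums A" and B: "(\<lambda>n. b n * \<mu> n powr (- \<alpha>)) sums B"
    and sum: "\<And>s. 0 < s \<Longrightarrow> summable (\<lambda>n. a n / (lam n + s))" "\<And>s. 0 < s \<Longrightarrow> summable (\<lambda>n. b n / (\<mu> n + s))"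
    and le: "\<And>s. 0 < s \<Longrightarrow> (\<Sum>n. a n / (lam n + s)) \<le> (\<Sum>n. b n / (\<mu> n + s))"
  shows "A \<le> B"
proof -
  define k where "k c s = indicator {0<..} s * (s powr (- \<alpha>) / (c + s))" for c s :: real
  define K where "K = (\<integral>\<^sup>+ s. ennreal (k 1 s) \<partial>lborel)"
  have K: "0 < K" "K < \<infinity>"
    unfolding K_def k_def using nn_integral_stieltjes_kernel_pos nn_integral_stieltjes_kernel_finite \<alpha> by auto
  have meas [measurable]: "k c \<in> borel_measurable borel" for c unfolding k_def by measurable
  have kpos: "0 \<le> k c s" if "0 < c" for c s using that by (auto simp: k_def indicator_def)
  have rep: "(\<integral>\<^sup>+ s. (\<Sum>n. ennreal (x n * k (c n) s)) \<partial>lborel) = ennreal X * K"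
    if x: "\<And>n. 0 \<le> x n" and c: "\<And>n. 0 < c n" and X: "(\<lambda>n. x n * c n powr (- \<alpha>)) sums X" for x c X
  proof -
    have "(\<integral>\<^sup>+ s. (\<Sum>n. ennreal (x n * k (c n) s)) \<partial>lborel) = (\<Sum>n. \<integral>\<^sup>+ s. ennreal (x n * k (c n) s) \<partial>lborel)"
      by (rule nn_integral_suminf) measurable
    also have "\<dots> = (\<Sum>n. ennreal (x n * c n powr (- \<alpha>)) * K)"
    proof (rule suminf_cong)
      fix n
      have "(\<integral>\<^sup>+ s. ennreal (x n * k (c n) s) \<partial>lborel) = ennreal (x n) * (\<integral>\<^sup>+ s. ennreal (k (c n) s) \<partial>lborel)"
        using x kpos[OF c] by (simp add: ennreal_mult nn_integral_cmult)
      also have "(\<integral>\<^sup>+ s. ennreal (k (c n) s) \<partial>lborel) = ennreal (c n powr (- \<alpha>)) * K"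
        unfolding K_def k_def by (rule nn_integral_stieltjes_kernel_scale[OF c])
      finally show "(\<integral>\<^sup>+ s. ennreal (x n * k (c n) s) \<partial>lborel) = ennreal (x n * c n powr (- \<alpha>)) * K"
        using x by (simp add: ennreal_mult mult.assoc)
    qed
    also have "\<dots> = (\<Sum>n. ennreal (x n * c n powr (- \<alpha>))) * K" by (rule ennreal_suminf_multc)
    also have "(\<Sum>n. ennreal (x n * c n powr (- \<alpha>))) = ennreal X"
      using x by (intro suminf_ennreal_eq X) auto
    finally show ?thesis .
  qed
  have "ennreal A * K = (\<integral>\<^sup>+ s. (\<Sum>n. ennreal (a n * k (lam n) s)) \<partial>lborel)"
    using rep[OF nn(1) pos(1) A] by simp
  also have "\<dots> \<le> (\<integral>\<^sup>+ s. (\<Sum>n. ennreal (b n * k (\<mu> n) s)) \<partial>lborel)"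
  proof (rule nn_integral_mono)
    fix s :: real
    show "(\<Sum>n. ennreal (a n * k (lam n) s)) \<le> (\<Sum>n. ennreal (b n * k (\<mu> n) s))"
    proof (cases "0 < s")
      case True
      have e: "(\<Sum>n. ennreal (x n * k (c n) s)) = ennreal (s powr (- \<alpha>) * (\<Sum>n. x n / (c n + s)))"
        if "\<And>n. 0 \<le> x n" "\<And>n. 0 < c n" "summable (\<lambda>n. x n / (c n + s))" for x c
      proof -
        have "(\<lambda>n. s powr (- \<alpha>) * (x n / (c n + s))) sums (s powr (- \<alpha>) * (\<Sum>n. x n / (c n + s)))"
          by (intro sums_mult summable_sums that(3))
        moreover have "x n * k (c n) s = s powr (- \<alpha>) * (x n / (c n + s))" for n
          using True by (simp add: k_def)
        moreover have "0 \<le> s powr (- \<alpha>) * (x n / (c n + s))" for n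
          using that(1)[of n] that(2)[of n] True by simp
        ultimately show ?thesis by (simp only:) (rule suminf_ennreal_eq; simp)
      qed
      show ?thesis
        unfolding e[OF nn(1) pos(1) sum(1)[OF True]] e[OF nn(2) pos(2) sum(2)[OF True]]
        using le[OF True] by (intro ennreal_leI mult_left_mono) auto
    qed (simp add: k_def)
  qed
  also have "\<dots> = ennreal B * K" by (rule rep[OF nn(2) pos(2) B])
  finally have "ennreal A \<le> ennreal B"
    using K ennreal_mult_le_mult_iff[of K "ennreal A" "ennreal B"] by (simp add: mult.commute less_top)
  moreover have "0 \<le> B" using sums_le[OF _ sums_zero B] nn(2) by auto
  ultimately show ?thesis by (simp add: ennreal_le_iff)
qed

section \<open>The resolvent on a Dirichlet interval\<close>

lemma lebesgue_on_FTC: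
  fixes P :: "real \<Rightarrow> real"
  assumes "0 \<le> l" "\<And>x. x \<in> {0..l} \<Longrightarrow> (P has_real_derivative f x) (at x within {0..l})"
    and "continuous_on {0..l} f"
  shows "(\<integral>x. f x \<partial>lebesgue_on {0..l}) = P l - P 0"
proof -
  have "(\<integral>x. f x \<partial>lebesgue_on {0..l}) = integral {0..l} f"
    by (intro lebesgue_integral_eq_integral continuous_imp_integrable_real assms) auto
  also have "\<dots> = P l - P 0"
    using assms(1,2) by (intro integral_unique fundamental_theorem_of_calculus)
      (auto simp flip: has_real_derivative_iff_has_vector_derivative)
  finally show ?thesis .
qed

lemma H2_on_smoothI:
  assumes "\<And>x. (u has_real_derivative u' x) (at x)" "\<And>x. (u' has_real_derivative g x) (at x)"
    and g: "continuous_on UNIV g"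
  shows "H2_on l u u' g"
  unfolding H2_on_def
proof (intro conjI ballI)
  have cg: "continuous_on S g" for S using g continuous_on_subset by blast
  show "square_integrable_on l g" by (rule square_integrable_on_continuous[OF cg])
  fix x assume x: "x \<in> {0..l}"
  show "(u has_real_derivative u' x) (at x within {0..l})"
    using assms(1) by (rule has_field_derivative_at_within)
  have "integral\<^sup>L (lebesgue_on {0..x}) g = u' x - u' 0"
    using x assms(2) by (intro lebesgue_on_FTC cg) (auto intro: has_field_derivative_at_within)
  then show "u' x = u' 0 + integral\<^sup>L (lebesgue_on {0..x}) g" by simp
qed

text \<open>The solution of \<open>- w'' + s * w = 1\<close> with zero values at 0 and
  \<open>l\<close>; centred at \<open>l / 2\<close>, it involves only the even function
  \<open>cosh\<close>.\<close>

definition interval_resolvent :: "real \<Rightarrow> real \<Rightarrow> real \<Rightarrow> real" where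
  "interval_resolvent l s x = (1 - cosh (sqrt s * (x - l / 2)) / cosh (sqrt s * (l / 2))) / s"

definition interval_resolvent' :: "real \<Rightarrow> real \<Rightarrow> real \<Rightarrow> real" where
  "interval_resolvent' l s x = - (sqrt s * sinh (sqrt s * (x - l / 2)) / cosh (sqrt s * (l / 2))) / s"

definition interval_resolvent_integral :: "real \<Rightarrow> real \<Rightarrow> real" where
  "interval_resolvent_integral l s = (l - 2 / sqrt s * tanh (sqrt s * (l / 2))) / s"

lemma interval_resolvent_derivs:
  assumes "0 < s"
  shows "(interval_resolvent l s has_real_derivative interval_resolvent' l s x) (at x)"
    and "(interval_resolvent' l s has_real_derivative - (1 - s * interval_resolvent l s x)) (at x)"
proof -
  have c: "cosh (sqrt s * (l / 2)) \<noteq> 0" using cosh_real_pos[of "sqrt s * (l / 2)"] by linarith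
  show "(interval_resolvent l s has_real_derivative interval_resolvent' l s x) (at x)"
    unfolding interval_resolvent_def[abs_def] interval_resolvent'_def using assms c
    by (auto intro!: derivative_eq_intros simp: field_simps)
  show "(interval_resolvent' l s has_real_derivative - (1 - s * interval_resolvent l s x)) (at x)"
    unfolding interval_resolvent_def interval_resolvent'_def[abs_def] using assms c
    by (auto intro!: derivative_eq_intros simp: field_simps)
qed

lemma interval_resolvent_ends: "interval_resolvent l s 0 = 0" "interval_resolvent l s l = 0"
proof -
  have c: "cosh (sqrt s * (l / 2)) \<noteq> 0" using cosh_real_pos[of "sqrt s * (l / 2)"] by linarith
  have "sqrt s * (0 - l / 2) = - (sqrt s * (l / 2))" "sqrt s * (l - l / 2) = sqrt s * (l / 2)"
    by (auto simp: field_simps)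
  then show "interval_resolvent l s 0 = 0" "interval_resolvent l s l = 0"
    using c by (simp_all only: interval_resolvent_def cosh_minus divide_self) auto
qed

lemma interval_resolvent_continuous:
  assumes "0 < s"
  shows "continuous_on S (interval_resolvent l s)" "continuous_on S (interval_resolvent' l s)"
  using interval_resolvent_derivs[OF assms]
  by (meson DERIV_isCont continuous_at_imp_continuous_on)+

lemma interval_resolvent_H2:
  assumes "0 < s"
  shows "H2_on l (interval_resolvent l s) (interval_resolvent' l s) (\<lambda>x. - (1 - s * interval_resolvent l s x))"
  by (intro H2_on_smoothI interval_resolvent_derivs assms continuous_intros interval_resolvent_continuous)

lemma interval_resolvent_has_integral:
  assumes s: "0 < s" and l: "0 < l"
  shows "(\<integral>x. interval_resolvent l s x \<partial>lebesgue_on {0..l}) = interval_resolvent_integral l s"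
proof -
  have c: "cosh (sqrt s * (l / 2)) \<noteq> 0" using cosh_real_pos[of "sqrt s * (l / 2)"] by linarith
  let ?P = "\<lambda>x. (x - sinh (sqrt s * (x - l / 2)) / (sqrt s * cosh (sqrt s * (l / 2)))) / s"
  have "(?P has_real_derivative interval_resolvent l s x) (at x)" for x
    unfolding interval_resolvent_def using s c by (auto intro!: derivative_eq_intros simp: field_simps)
  then have "(\<integral>x. interval_resolvent l s x \<partial>lebesgue_on {0..l}) = ?P l - ?P 0"
    using l s by (intro lebesgue_on_FTC interval_resolvent_continuous) (auto intro: has_field_derivative_at_within)
  also have "\<dots> = interval_resolvent_integral l s"
  proof -
    have "sqrt s * (0 - l / 2) = - (sqrt s * (l / 2))" "sqrt s * (l - l / 2) = sqrt s * (l / 2)"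
      by (auto simp: field_simps)
    then show ?thesis
      using s c by (simp only: sinh_minus) (simp add: interval_resolvent_integral_def tanh_def field_simps)
  qed
  finally show ?thesis .
qed

text \<open>Concavity on the half line: the derivative is 1 minus the square of \<open>tanh\<close>,
  which decreases there.\<close>

lemma tanh_le_tangent:
  fixes x a :: real
  assumes "0 \<le> x" "0 \<le> a"
  shows "tanh x \<le> tanh a + (1 - (tanh a)\<^sup>2) * (x - a)"
proof -
  have d: "(tanh has_real_derivative 1 - (tanh y)\<^sup>2) (at y)" for y :: real
    using cosh_real_pos[of y] by (auto intro!: derivative_eq_intros)
  have mono: "(tanh y)\<^sup>2 \<le> (tanh z)\<^sup>2" if "0 \<le> y" "y \<le> z" for y z :: real
    using that by (intro power_mono) auto
  consider "x < a" | "x = a" | "a < x" by linarith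
  then show ?thesis
  proof cases
    case 1
    obtain z where z: "x < z" "z < a" "tanh a - tanh x = (a - x) * (1 - (tanh z)\<^sup>2)"
      using MVT2[OF 1, of tanh "\<lambda>y. 1 - (tanh y)\<^sup>2"] d by blast
    have "(a - x) * (1 - (tanh a)\<^sup>2) \<le> (a - x) * (1 - (tanh z)\<^sup>2)"
      using mono[of z a] z assms 1 by (intro mult_left_mono) auto
    then show ?thesis using z(3) by (simp add: algebra_simps)
  next
    case 3
    obtain z where z: "a < z" "z < x" "tanh x - tanh a = (x - a) * (1 - (tanh z)\<^sup>2)"
      using MVT2[OF 3, of tanh "\<lambda>y. 1 - (tanh y)\<^sup>2"] d by blast
    have "(x - a) * (1 - (tanh z)\<^sup>2) \<le> (x - a) * (1 - (tanh a)\<^sup>2)"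
      using mono[of a z] z assms 3 by (intro mult_left_mono) auto
    then show ?thesis using z(3) by (simp add: algebra_simps)
  qed simp
qed

text \<open>The tangent to \<open>tanh\<close> is taken at the mean length, so the linear terms
  cancel in the sum. As \<open>tanh\<close> enters the integral with a negative sign, its concavity
  gives a lower bound.\<close>

lemma interval_resolvent_integral_Jensen:
  assumes s: "0 < s" and A: "finite A" "A \<noteq> {}" and l: "\<And>e. e \<in> A \<Longrightarrow> 0 < l e"
    and L: "L = (\<Sum>e\<in>A. l e) / real (card A)"
  shows "real (card A) * interval_resolvent_integral L s \<le> (\<Sum>e\<in>A. interval_resolvent_integral (l e) s)"
proof -
  have card: "0 < real (card A)" using A by (simp add: card_gt_0_iff)
  have suml: "(\<Sum>e\<in>A. l e) = real (card A) * L" using card L by simp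
  have L0: "0 \<le> L" unfolding L using l by (intro divide_nonneg_nonneg sum_nonneg) (auto intro: less_imp_le)
  let ?k = "sqrt s" let ?t = "tanh (sqrt s * (L / 2))"
  have "(\<Sum>e\<in>A. tanh (?k * (l e / 2))) \<le> (\<Sum>e\<in>A. ?t + (1 - ?t\<^sup>2) * (?k * (l e / 2) - ?k * (L / 2)))"
    using s l L0 by (intro sum_mono tanh_le_tangent) (auto intro: less_imp_le)
  also have "\<dots> = real (card A) * ?t + (1 - ?t\<^sup>2) * (?k * ((\<Sum>e\<in>A. l e) / 2) - real (card A) * (?k * (L / 2)))"
    by (simp add: sum.distrib sum_subtractf sum_distrib_left[symmetric] sum_divide_distrib[symmetric])
  also have "\<dots> = real (card A) * ?t" by (simp add: suml)
  finally have t: "(\<Sum>e\<in>A. tanh (?k * (l e / 2))) \<le> real (card A) * ?t" .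
  have "real (card A) * interval_resolvent_integral L s = ((\<Sum>e\<in>A. l e) - 2 / ?k * (real (card A) * ?t)) / s"
    by (simp add: interval_resolvent_integral_def suml right_diff_distrib)
  also have "\<dots> \<le> ((\<Sum>e\<in>A. l e) - 2 / ?k * (\<Sum>e\<in>A. tanh (?k * (l e / 2)))) / s"
    using t s by (intro divide_right_mono diff_left_mono mult_left_mono) auto
  also have "\<dots> = (\<Sum>e\<in>A. interval_resolvent_integral (l e) s)"
    by (simp add: interval_resolvent_integral_def sum_subtractf sum_distrib_left flip: sum_divide_distrib)
  finally show ?thesis .
qed

context dirichlet_graph
begin

section \<open>The edgewise Dirichlet resolvent as trial function\<close>

text \<open>Being zero at all vertices, it is admissible in \<open>resolvent_sum_ge\<close> for
  every graph; where all vertices are Dirichlet, it solves the resolvent equation itself, and the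
  bound becomes an equality.\<close>

definition edge_resolvent :: "real \<Rightarrow> 'e graph_fun" where
  "edge_resolvent s = (\<lambda>e. interval_resolvent (len e) s)"

definition edge_resolvent' :: "real \<Rightarrow> 'e graph_fun" where
  "edge_resolvent' s = (\<lambda>e. interval_resolvent' (len e) s)"

lemma edge_resolvent_form_domain:
  assumes "0 < s"
  shows "form_domain G (edge_resolvent s) (edge_resolvent' s) (\<lambda>_. 0)"
  unfolding form_domain_def edge_resolvent_def edge_resolvent'_def
  by (auto simp: interval_resolvent_ends interval_resolvent_continuous[OF assms]
      intro: has_field_derivative_at_within interval_resolvent_derivs[OF assms])

lemma edge_resolvent_integral:
  "0 < s \<Longrightarrow> L2_inner G one (edge_resolvent s) = (\<Sum>e\<in>edges G. interval_resolvent_integral (len e) s)"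
  by (simp add: L2_inner_sum edge_resolvent_def interval_resolvent_has_integral len_pos)

lemma edge_resolvent_energy:
  assumes s: "0 < s"
  shows "L2_inner G (edge_resolvent' s) (edge_resolvent' s) + s * L2_inner G (edge_resolvent s) (edge_resolvent s)
    = L2_inner G one (edge_resolvent s)"
  unfolding L2_inner_sum sum_distrib_left sum.distrib[symmetric]
proof (rule sum.cong)
  fix e assume e: "e \<in> edges G"
  let ?l = "len e" let ?w = "interval_resolvent (len e) s" let ?w' = "interval_resolvent' (len e) s"
  have w: "square_integrable_on ?l ?w"
    by (rule square_integrable_on_continuous[OF interval_resolvent_continuous(1)[OF s]])
  have "(\<integral>x. (1 - s * ?w x) * ?w x \<partial>lebesgue_on {0..?l}) = (\<integral>x. ?w' x * ?w' x \<partial>lebesgue_on {0..?l})"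
    using H2_on_Green[OF _ interval_resolvent_H2[OF s, of ?l], of ?w ?w'] len_pos[OF e]
      interval_resolvent_continuous[OF s] interval_resolvent_derivs[OF s]
    by (simp add: interval_resolvent_ends has_field_derivative_at_within)
  moreover have "(\<integral>x. (1 - s * ?w x) * ?w x \<partial>lebesgue_on {0..?l})
      = (\<integral>x. ?w x \<partial>lebesgue_on {0..?l}) - s * (\<integral>x. ?w x * ?w x \<partial>lebesgue_on {0..?l})"
    using square_integrable_on_integrable[OF w] square_integrable_on_mult[OF w w]
    by (simp add: left_diff_distrib mult.assoc)
  ultimately show "(\<integral>x. edge_resolvent' s e x * edge_resolvent' s e x \<partial>lebesgue_on {0..?l})
      + s * (\<integral>x. edge_resolvent s e x * edge_resolvent s e x \<partial>lebesgue_on {0..?l})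
      = (\<integral>x. 1 * edge_resolvent s e x \<partial>lebesgue_on {0..?l})"
    by (simp add: edge_resolvent_def edge_resolvent'_def)
qed simp

lemma resolvent_sum_ge_intervals:
  "0 < s \<Longrightarrow> (\<Sum>e\<in>edges G. interval_resolvent_integral (len e) s) \<le> resolvent_sum s"
  using resolvent_sum_ge[OF _ edge_resolvent_form_domain edge_resolvent_energy] edge_resolvent_integral by simp

lemma resolvent_sum_eq_intervals:
  assumes s: "0 < s" and D: "vertices G = dirichlet G"
  shows "resolvent_sum s = (\<Sum>e\<in>edges G. interval_resolvent_integral (len e) s)"
proof -
  have "laplacian G (edge_resolvent s) (one - s *\<^sub>R edge_resolvent s)"
    unfolding laplacian_def
  proof (intro exI[of _ "edge_resolvent' s"] conjI ballI)
    fix e assume "e \<in> edges G"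
    show "H2_on (len e) (edge_resolvent s e) (edge_resolvent' s e) (\<lambda>x. - (one - s *\<^sub>R edge_resolvent s) e x)"
      using interval_resolvent_H2[OF s] by (simp add: edge_resolvent_def edge_resolvent'_def)
  next
    show "continuous_at_vertices G (edge_resolvent s)"
      unfolding continuous_at_vertices_def
      by (intro exI[of _ "\<lambda>_. 0"]) (simp add: edge_resolvent_def interval_resolvent_ends)
    show "kirchhoff G (edge_resolvent' s)" by (simp add: kirchhoff_def D)
  qed
  from resolvent_sum_eq[OF s this] show ?thesis using edge_resolvent_integral[OF s] by simp
qed

end

section \<open>The equilateral flower\<close>

text \<open>The terms of the zeta series are grouped in pairs, the bases being
  \<open>2 * n + 1\<close> and \<open>2 * n + 2\<close>. The even ones form the series itself times
  \<open>2 powr (- p)\<close>, which is subtracted.\<close>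

lemma odd_powr_sums:
  assumes "(\<lambda>n. real (Suc n) powr (- p)) sums Z"
  shows "(\<lambda>n. real (2 * n + 1) powr (- p)) sums ((1 - 2 powr (- p)) * Z)"
proof -
  let ?f = "\<lambda>n. real (Suc n) powr (- p)"
  have "(\<lambda>n. sum ?f {n * 2..<n * 2 + 2}) sums Z" by (rule sums_group[OF assms]) simp
  moreover have "sum ?f {n * 2..<n * 2 + 2} = real (2 * n + 1) powr (- p) + 2 powr (- p) * ?f n" for n
  proof -
    have "{n * 2..<n * 2 + 2} = {n * 2, Suc (n * 2)}" by auto
    moreover have "real (Suc (Suc (n * 2))) powr (- p) = 2 powr (- p) * ?f n"
      by (subst powr_mult[symmetric]) (auto simp: algebra_simps)
    ultimately show ?thesis by (simp add: mult.commute add.commute)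
  qed
  ultimately have "(\<lambda>n. real (2 * n + 1) powr (- p) + 2 powr (- p) * ?f n) sums Z" by simp
  from sums_diff[OF this sums_mult[OF assms, of "2 powr (- p)"]] show ?thesis
    by (simp add: algebra_simps)
qed

text \<open>This is Parseval's identity for the constant 1 in the odd sine modes of an interval, and
  is used as such for the flower.\<close>

lemma odd_inverse_squares_sums: "(\<lambda>n. 1 / (real (2 * n + 1))\<^sup>2) sums (pi\<^sup>2 / 8)"
proof -
  have e: "real k powr (- 2) = 1 / (real k)\<^sup>2" if "0 < k" for k :: nat
    using that by (intro powr_neg_numeral) simp
  have "(\<lambda>n. real (Suc n) powr (- 2)) sums (pi\<^sup>2 / 6)"
    using inverse_squares_sums by (simp add: e add.commute del: of_nat_Suc)
  from odd_powr_sums[OF this] have "(\<lambda>n. real (2 * n + 1) powr (- 2)) sums ((1 - 2 powr (- 2)) * (pi\<^sup>2 / 6))" .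
  also have "(1 - 2 powr (- 2)) * (pi\<^sup>2 / 6) = pi\<^sup>2 / 8" using e[of 2] by simp
  finally show ?thesis by (subst (asm) e) auto
qed

lemma zeta_real_sums:
  assumes "1 < p"
  shows "(\<lambda>n. real (Suc n) powr (- p)) sums zeta_real p"
proof -
  have "summable (\<lambda>n. real n powr (- p))" using assms by (subst summable_real_powr_iff) simp
  then have "summable (\<lambda>n. real (Suc n) powr (- p))" by (subst summable_Suc_iff)
  then show ?thesis unfolding zeta_real_def by (rule summable_sums)
qed

lemma flower_simps [simp]:
  "edges (flower m L) = {..<m}" "vertices (flower m L) = {()}" "dirichlet (flower m L) = {()}"
  "elength (flower m L) e = L"
  by (simp_all add: flower_def)

lemma flower_dirichlet_graph:
  assumes "0 < m" "0 < L"
  shows "dirichlet_graph (flower m L)"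
proof
  show "compact_metric_graph (flower m L)"
    using assms by (auto simp: compact_metric_graph_def flower_def) (unfold_locales, auto)
  show "connected_metric_graph (flower m L)"
    by (auto simp: connected_metric_graph_def connected_def strongly_connected_def mk_symmetric_def
        flower_def reachable_def)
qed (use assms in auto)

text \<open>Only modes that agree on all petals and are symmetric about the midpoints are used. They
  are far from a basis, but the constant 1 lies in their closed span, and
  \<open>torsion_sums_eigenfunctions\<close> asks for no more.\<close>

lemma flower_torsion:
  assumes m: "0 < m" and L: "0 < L" and \<alpha>: "0 < \<alpha>"
  shows "frac_torsional_rigidity (flower m L) \<alpha> =
    real m * (8 * L powr (1 + 2 * \<alpha>) * pi powr (- 2 * (1 + \<alpha>)) *
      (1 - 2 powr (- 2 * (1 + \<alpha>))) * zeta_real (2 * (1 + \<alpha>)))"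
proof -
  interpret dirichlet_graph "flower m L" by (rule flower_dirichlet_graph[OF m L])
  define c where "c j = real (2 * j + 1) * pi / L" for j
  \<comment> \<open>The square of the sine integrates to \<open>L / 2\<close> on each of the
    \<open>m\<close> petals.\<close>
  define N where "N = sqrt (2 / (real m * L))"
  define p :: "nat \<Rightarrow> nat graph_fun" where "p j = (\<lambda>e x. N * sin (c j * x))" for j
  define p' :: "nat \<Rightarrow> nat graph_fun" where "p' j = (\<lambda>e x. N * (c j * cos (c j * x)))" for j
  have N2: "N\<^sup>2 = 2 / (real m * L)" using m L by (simp add: N_def)
  have c0: "0 < c j" for j using L by (simp add: c_def)
  have cL: "c j * L = real (2 * j + 1) * pi" for j using L by (simp add: c_def)
  have sL: "sin (c j * L) = 0" for j unfolding cL by (rule sin_npi)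
  have cosL: "cos (c j * L) = - 1" for j unfolding cL by (simp only: cos_npi) simp
  have H2: "H2_on L (p j e) (p' j e) (\<lambda>x. - ((c j)\<^sup>2 *\<^sub>R p j) e x)" for j e
    unfolding p_def p'_def
    by (intro H2_on_smoothI) (auto intro!: derivative_eq_intros continuous_intros simp: power2_eq_square)
  have lap: "laplacian (flower m L) (p j) ((c j)\<^sup>2 *\<^sub>R p j)" for j
    unfolding laplacian_def
  proof (intro exI[of _ "p' j"] conjI ballI)
    show "continuous_at_vertices (flower m L) (p j)"
      unfolding continuous_at_vertices_def by (intro exI[of _ "\<lambda>_. 0"]) (simp add: p_def sL)
    show "kirchhoff (flower m L) (p' j)" by (simp add: kirchhoff_def)
  qed (use H2 in simp)
  have pL: "p j \<in> L2 (flower m L)" for j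
    by (rule laplacianE[OF lap]) (rule form_domain_L2(1))
  have norm: "L2_inner (flower m L) (p j) (p j) = 1" for j
  proof -
    have "(\<integral>x. (N * sin (c j * x)) * (N * sin (c j * x)) \<partial>lebesgue_on {0..L})
        = N\<^sup>2 * (L / 2 - sin (2 * (c j * L)) / (4 * c j)) - N\<^sup>2 * (0 / 2 - sin (2 * (c j * 0)) / (4 * c j))"
    proof (rule lebesgue_on_FTC)
      fix x
      have "((\<lambda>x. N\<^sup>2 * (x / 2 - sin (2 * (c j * x)) / (4 * c j))) has_real_derivative
          N\<^sup>2 * (1 / 2 - cos (2 * (c j * x)) / 2)) (at x within {0..L})"
        using c0[of j] by (auto intro!: derivative_eq_intros simp: field_simps)
      moreover have "N\<^sup>2 * (1 / 2 - cos (2 * (c j * x)) / 2) = (N * sin (c j * x)) * (N * sin (c j * x))"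
        unfolding cos_double_sin by (simp add: diff_divide_distrib power_mult_distrib power2_eq_square)
      ultimately show "((\<lambda>x. N\<^sup>2 * (x / 2 - sin (2 * (c j * x)) / (4 * c j))) has_real_derivative
          (N * sin (c j * x)) * (N * sin (c j * x))) (at x within {0..L})" by simp
    qed (use L in \<open>auto intro!: continuous_intros\<close>)
    also have "sin (2 * (c j * L)) = 0" unfolding sin_double by (simp add: sL)
    finally show ?thesis using m L by (simp add: L2_inner_sum p_def N2)
  qed
  have on: "L2_inner (flower m L) (p i) (p j) = (if i = j then 1 else 0)" for i j
  proof (cases "i = j")
    case False
    \<comment> \<open>Orthogonality follows from Green's formula and the distinctness of the
      eigenvalues, without computing the mixed integrals.\<close>
    have "(c i)\<^sup>2 * L2_inner (flower m L) (p i) (p j) = (c j)\<^sup>2 * L2_inner (flower m L) (p i) (p j)"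
    proof -
      obtain q z where q: "form_domain (flower m L) (p i) q z"
        "\<And>v v' z. form_domain (flower m L) v v' z \<Longrightarrow> L2_inner (flower m L) ((c i)\<^sup>2 *\<^sub>R p i) v = L2_inner (flower m L) q v'"
        by (rule laplacianE[OF lap[of i]]) (rule that)
      obtain r y where r: "form_domain (flower m L) (p j) r y"
        "\<And>v v' z. form_domain (flower m L) v v' z \<Longrightarrow> L2_inner (flower m L) ((c j)\<^sup>2 *\<^sub>R p j) v = L2_inner (flower m L) r v'"
        by (rule laplacianE[OF lap[of j]]) (rule that)
      have "L2_inner (flower m L) q r = L2_inner (flower m L) r q"
        using form_domain_L2(2)[OF q(1)] form_domain_L2(2)[OF r(1)] by (rule L2.sym)
      then show ?thesis
        using q(2)[OF r(1)] r(2)[OF q(1)] pL L2.sym[OF pL pL, of i j] by (simp add: L2.scale_left)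
    qed
    moreover have "(c i)\<^sup>2 \<noteq> (c j)\<^sup>2"
      using False c0[of i] c0[of j] L by (simp add: power2_eq_iff_nonneg less_imp_le) (simp add: c_def)
    ultimately show ?thesis using False by simp
  qed (simp add: norm)
  define a where "a j = L2_inner (flower m L) one (p j)" for j
  have a: "a j = real m * (N * (2 / c j))" for j
  proof -
    have "(\<integral>x. N * sin (c j * x) \<partial>lebesgue_on {0..L}) = - N * cos (c j * L) / c j - (- N * cos (c j * 0) / c j)"
      using L c0[of j]
      by (intro lebesgue_on_FTC) (auto intro!: derivative_eq_intros continuous_intros simp: field_simps)
    then show ?thesis by (simp add: a_def L2_inner_sum p_def cosL)
  qed
  have a2: "(a j)\<^sup>2 = 8 * real m * L / pi\<^sup>2 * (1 / (real (2 * j + 1))\<^sup>2)" for j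
  proof -
    have "(real m * (N * (2 / (k * pi / L))))\<^sup>2 = 8 * real m * L / pi\<^sup>2 * (1 / k\<^sup>2)" if "0 < k" for k
      unfolding power_mult_distrib power_divide N2 using m L that
      by (simp add: field_simps power2_eq_square)
    from this[of "real (2 * j + 1)"] show ?thesis unfolding a c_def by simp
  qed
  \<comment> \<open>The squared coefficients add up to \<open>m * L\<close>, the squared norm of 1;
    by the exact form of \<open>Bessel\<close> the residuals of the expansion then tend to
    0.\<close>
  have "(\<lambda>j. (a j)\<^sup>2) sums (8 * real m * L / pi\<^sup>2 * (pi\<^sup>2 / 8))"
    unfolding a2 by (intro sums_mult odd_inverse_squares_sums)
  also have "8 * real m * L / pi\<^sup>2 * (pi\<^sup>2 / 8) = L2_inner (flower m L) one one"
    using L by (simp add: L2_inner_sum measure_restrict_space)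
  finally have "(\<lambda>n. L2_inner (flower m L) one one - (\<Sum>j<n. (a j)\<^sup>2)) \<longlonglongrightarrow> 0"
    unfolding sums_def by (auto intro!: tendsto_eq_intros)
  then have conv: "L2.converges_to (\<lambda>n. \<Sum>j<n. a j *\<^sub>R p j) one"
    using L2.Bessel(1)[OF pL on one_L2, of "{..<_}"]
    by (simp add: L2.converges_to_def a_def L2_norm_sum power2_commute)
  have c_ge: "(c 0)\<^sup>2 \<le> (c j)\<^sup>2" for j
    using L by (intro power_mono) (auto simp: c_def intro!: divide_right_mono)
  have "(\<lambda>j. (a j)\<^sup>2 * (c j)\<^sup>2 powr (- \<alpha>)) sums frac_torsional_rigidity (flower m L) \<alpha>"
    using c0[of 0] by (intro torsion_sums_eigenfunctions[OF \<alpha> lap pL on _ c_ge conv]) (auto simp: a_def)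
  moreover have "(\<lambda>j. (a j)\<^sup>2 * (c j)\<^sup>2 powr (- \<alpha>)) sums
    (real m * (8 * L powr (1 + 2 * \<alpha>) * pi powr (- 2 * (1 + \<alpha>))) *
      ((1 - 2 powr (- (2 * (1 + \<alpha>)))) * zeta_real (2 * (1 + \<alpha>))))"
  proof -
    have "(a j)\<^sup>2 * (c j)\<^sup>2 powr (- \<alpha>) =
      real m * (8 * L powr (1 + 2 * \<alpha>) * pi powr (- 2 * (1 + \<alpha>))) * real (2 * j + 1) powr (- (2 * (1 + \<alpha>)))" for j
    proof -
      let ?k = "real (2 * j + 1)"
      have k: "0 < ?k" by simp
      have "(c j)\<^sup>2 powr (- \<alpha>) = c j powr (- (2 * \<alpha>))"
        using c0[of j] by (simp add: powr_powr flip: powr_numeral)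
      also have "\<dots> = ?k powr (- (2 * \<alpha>)) * pi powr (- (2 * \<alpha>)) * L powr (2 * \<alpha>)"
      proof -
        have "(k * pi / L) powr (- (2 * \<alpha>)) = k powr (- (2 * \<alpha>)) * pi powr (- (2 * \<alpha>)) * L powr (2 * \<alpha>)"
          if "0 < k" for k
          using that L by (simp add: powr_mult powr_divide powr_minus field_simps)
        then show ?thesis unfolding c_def using k by blast
      qed
      finally have e: "(c j)\<^sup>2 powr (- \<alpha>) = ?k powr (- (2 * \<alpha>)) * pi powr (- (2 * \<alpha>)) * L powr (2 * \<alpha>)" .
      have 1: "L powr (1 + 2 * \<alpha>) = L * L powr (2 * \<alpha>)" using L by (simp add: powr_add)
      have 2: "x powr (- 2 * (1 + \<alpha>)) = x powr (- (2 * \<alpha>)) / x\<^sup>2" if "0 < x" for x :: real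
      proof -
        have "x powr (- 2 * (1 + \<alpha>)) = x powr (- (2 * \<alpha>) - 2)"
          by (rule arg_cong[of _ _ "(powr) x"]) simp
        also have "\<dots> = x powr (- (2 * \<alpha>)) / x\<^sup>2" using that by (simp add: powr_diff powr_numeral)
        finally show ?thesis .
      qed
      have 3: "?k powr (- (2 * (1 + \<alpha>))) = ?k powr (- (2 * \<alpha>)) / ?k\<^sup>2" using 2[OF k] by simp
      show ?thesis unfolding a2 e 1 3 2[OF pi_gt_zero] by simp
    qed
    then show ?thesis
      using sums_mult[OF odd_powr_sums[OF zeta_real_sums[of "2 * (1 + \<alpha>)"]],
          of "real m * (8 * L powr (1 + 2 * \<alpha>) * pi powr (- 2 * (1 + \<alpha>)))"] \<alpha> by simp
  qed
  ultimately show ?thesis using sums_unique2 by (simp add: mult_ac) fastforce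
qed

theorem theorem7p1:
  fixes G :: "('v, 'e) metric_graph" and \<alpha> L :: real and F :: "(unit, nat) metric_graph"
  assumes "compact_metric_graph G"
    and "connected_metric_graph G"
    and "dirichlet G \<noteq> {}"
    and "0 < \<alpha>" and "\<alpha> < 1"
    and L_def: "L = total_length G / real (card (edges G))"
    and F_def: "F = flower (card (edges G)) L"
  shows "total_length F = total_length G \<and>
         frac_torsional_rigidity G \<alpha> \<ge> frac_torsional_rigidity F \<alpha> \<and>
         frac_torsional_rigidity F \<alpha> =
           real (card (edges G)) * (8 * L powr (1 + 2 * \<alpha>) * pi powr (- 2 * (1 + \<alpha>)) *
             (1 - 2 powr (- 2 * (1 + \<alpha>))) * zeta_real (2 * (1 + \<alpha>)))"
proof (cases "edges G = {}")
  \<comment> \<open>The flower then has no petals, and all quantities are empty sums or multiples of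
    0.\<close>
  case True
  then show ?thesis
    by (simp add: F_def total_length_def frac_torsional_rigidity_def graph_integral_def)
next
  case False
  interpret G: dirichlet_graph G using assms(1-3) False by unfold_locales
  let ?m = "card (edges G)"
  have m: "0 < ?m" using False by (simp add: card_gt_0_iff)
  have tl: "0 < total_length G"
    unfolding total_length_def using False G.len_pos by (intro sum_pos) auto
  then have L: "0 < L" using m by (simp add: L_def)
  interpret F: dirichlet_graph F unfolding F_def by (rule flower_dirichlet_graph[OF m L])
  have "frac_torsional_rigidity F \<alpha> \<le> frac_torsional_rigidity G \<alpha>"
  proof (rule stieltjes_comparison[OF assms(4,5) _ _ F.lam_pos G.lam_pos
        F.torsion_sums[OF assms(4)] G.torsion_sums[OF assms(4)] F.resolvent_summable G.resolvent_summable])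
    fix s :: real assume s: "0 < s"
    have "F.resolvent_sum s = real ?m * interval_resolvent_integral L s"
      using F.resolvent_sum_eq_intervals[OF s] by (simp add: F_def)
    also have "\<dots> \<le> (\<Sum>e\<in>edges G. interval_resolvent_integral (elength G e) s)"
      using False G.len_pos by (intro interval_resolvent_integral_Jensen s) (auto simp: L_def total_length_def)
    also have "\<dots> \<le> G.resolvent_sum s" by (rule G.resolvent_sum_ge_intervals[OF s])
    finally show "(\<Sum>n. (F.coeff n)\<^sup>2 / (eigenval F n + s)) \<le> (\<Sum>n. (G.coeff n)\<^sup>2 / (eigenval G n + s))"
      by (simp only: F.resolvent_sum_def G.resolvent_sum_def)
  qed auto
  moreover have "total_length F = total_length G"
    using m False by (simp add: F_def total_length_def[of "flower _ _"] L_def)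
  ultimately show ?thesis
    using flower_torsion[OF m L assms(4)] by (simp add: F_def)
qed

end
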